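(* Let $n \geq 2$, and let $F_n$ be the free group on $n$ generators. Then there is a unital nonsimple prime AF algebra $A$ such that there is a minimal action $\alpha \colon F_n \to \mathrm{Aut}(A)$ which is effective on $\mathrm{Prim}(A)$, and such that, for any abelian subgroup $H \subset F_n$, the restricted action $\alpha|_H$ is not minimal.
   Context: $\mathrm{Prim}(A)$ is the primitive ideal space of the C*-algebra $A$; an action $\alpha$ of a group on $A$ induces an action on $\mathrm{Prim}(A)$ by $g \cdot J = \alpha_g(J)$. An action $\alpha \colon G \to \mathrm{Aut}(A)$ is minimal if the only $\alpha$-invariant closed two-sided ideals of $A$ are $0$ and $A$. An action of $G$ on a set $S$ is effective if for every $g \in G \setminus \{1\}$ there is $s \in S$ with $gs \neq s$. *)

theory Defs
  imports
    "HOL-Algebra.Bij"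
    "HOL-Algebra.Module"
    "HOL-Algebra.Ideal"
    "HOL-Analysis.Abstract_Metric_Spaces"
begin

section \<open>Free groups\<close>

text \<open>
  The letter \<open>(i, False)\<close> stands for the generator with index \<open>i\<close>, and \<open>(i, True)\<close> for its inverse.
  Elements of the free group are reduced words; the product is concatenation followed by
  cancellation, which for a reduced right factor amounts to prepending the letters of the left
  factor one at a time.
\<close>

type_synonym letter = "nat \<times> bool"

definition flip :: "letter \<Rightarrow> letter" where
  "flip x = (fst x, \<not> snd x)"

definition reduced :: "letter list \<Rightarrow> bool" where
  "reduced w \<longleftrightarrow> successively (\<lambda>x y. y \<noteq> flip x) w"

fun push :: "letter \<Rightarrow> letter list \<Rightarrow> letter list" where
  "push x [] = [x]"
| "push x (y # w) = (if y = flip x then w else x # y # w)"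

definition free_group :: "nat \<Rightarrow> letter list monoid" where
  "free_group n =
    \<lparr>carrier = {w. reduced w \<and> fst ` set w \<subseteq> {..<n}},
     mult = (\<lambda>u v. foldr push u v),
     one = []\<rparr>"

lemma flip_flip [simp]: "flip (flip x) = x"
  by (simp add: flip_def)

lemma fst_flip [simp]: "fst (flip x) = fst x"
  by (simp add: flip_def)

lemma reduced_Nil [simp]: "reduced []"
  by (simp add: reduced_def)

lemma reduced_Cons: "reduced (x # w) \<longleftrightarrow> w = [] \<or> (hd w \<noteq> flip x \<and> reduced w)"
  by (cases w) (auto simp: reduced_def)

lemma reduced_push: "reduced w \<Longrightarrow> reduced (push x w)"
  by (cases w) (auto simp: reduced_Cons)

lemma push_flip_push: "reduced w \<Longrightarrow> push x (push (flip x) w) = w"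
  by (cases w rule: list.exhaust; cases "tl w") (auto simp: reduced_Cons)

lemma reduced_foldr: "reduced w \<Longrightarrow> reduced (foldr push u w)"
  by (induction u) (auto intro: reduced_push)

lemma push_foldr: "reduced v \<Longrightarrow> reduced w \<Longrightarrow> foldr push (push x v) w = push x (foldr push v w)"
proof (cases v)
  case (Cons y v')
  assume "reduced v" "reduced w"
  then have "reduced (foldr push v' w)" by (simp add: reduced_foldr)
  then show ?thesis using Cons push_flip_push[of _ x] by auto
qed auto

lemma foldr_foldr: "reduced v \<Longrightarrow> reduced w \<Longrightarrow>
    foldr push (foldr push u v) w = foldr push u (foldr push v w)"
  by (induction u) (auto simp: push_foldr reduced_foldr)

lemma foldr_reduced: "reduced u \<Longrightarrow> foldr push u [] = u"
proof (induction u)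
  case (Cons x u)
  then have "foldr push u [] = u" by (auto simp: reduced_Cons)
  then show ?case using Cons.prems by (cases u) (auto simp: reduced_Cons)
qed simp

lemma fst_push: "fst ` set (push x w) \<subseteq> insert (fst x) (fst ` set w)"
  by (cases w) auto

lemma fst_foldr: "fst ` set (foldr push u w) \<subseteq> fst ` set u \<union> fst ` set w"
proof (induction u)
  case (Cons x u)
  then show ?case using fst_push[of x "foldr push u w"] by (simp, blast)
qed simp

lemma foldr_inverse:
  "reduced w \<Longrightarrow> foldr push (map flip (rev u)) (foldr push u w) = w"
proof (induction u)
  case (Cons x u)
  then show ?case
    using push_flip_push[of "foldr push u w" "flip x"] by (simp add: reduced_foldr)
qed simp

lemma group_free_group: "group (free_group n)"
proof (rule groupI)
  fix u v assume "u \<in> carrier (free_group n)" "v \<in> carrier (free_group n)"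
  then show "u \<otimes>\<^bsub>free_group n\<^esub> v \<in> carrier (free_group n)"
    using order_trans[OF fst_foldr[of u v], of "{..<n}"] by (simp add: free_group_def reduced_foldr)
next
  fix u assume u: "u \<in> carrier (free_group n)"
  let ?v = "foldr push (map flip (rev u)) []"
  have "foldr push ?v u = foldr push (map flip (rev u)) (foldr push [] u)"
    using u by (intro foldr_foldr) (auto simp: free_group_def reduced_def)
  also have "\<dots> = foldr push (map flip (rev u)) (foldr push u [])"
    using u by (simp add: foldr_reduced free_group_def)
  also have "\<dots> = []"
    by (rule foldr_inverse) (simp add: reduced_def)
  finally have "?v \<otimes>\<^bsub>free_group n\<^esub> u = \<one>\<^bsub>free_group n\<^esub>"
    by (simp add: free_group_def)
  moreover have "reduced ?v"
    by (rule reduced_foldr) (simp add: reduced_def)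
  then have "?v \<in> carrier (free_group n)"
    using u order_trans[OF fst_foldr[of "map flip (rev u)" "[]"], of "{..<n}"]
    by (simp add: free_group_def image_image)
  ultimately show "\<exists>v\<in>carrier (free_group n). v \<otimes>\<^bsub>free_group n\<^esub> u = \<one>\<^bsub>free_group n\<^esub>"
    by (rule rev_bexI[rotated])
qed (simp_all add: free_group_def foldr_foldr)


section \<open>Complex normed spaces and Hilbert spaces\<close>

definition complex_ring :: "complex ring" where
  "complex_ring = \<lparr>carrier = UNIV, mult = (*), one = 1, zero = 0, add = (+)\<rparr>"

lemma cring_complex_ring: "cring complex_ring"
proof (rule cringI)
  show "abelian_group complex_ring"
  proof (rule abelian_groupI)
    show "\<exists>y\<in>carrier complex_ring. y \<oplus>\<^bsub>complex_ring\<^esub> x = \<zero>\<^bsub>complex_ring\<^esub>" for x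
      by (rule bexI[of _ "- x"]) (auto simp: complex_ring_def)
  qed (auto simp: complex_ring_def)
  show "Group.comm_monoid complex_ring"
    by (rule comm_monoidI) (auto simp: complex_ring_def)
qed (auto simp: complex_ring_def algebra_simps)

text \<open>
  The distance is cut off outside the carrier because \<open>Metric_space\<close> asks for nonnegativity and
  symmetry on the whole type.
\<close>

definition norm_dist :: "('a, 'm) ring_scheme \<Rightarrow> ('a \<Rightarrow> real) \<Rightarrow> 'a \<Rightarrow> 'a \<Rightarrow> real" where
  "norm_dist V N x y = (if x \<in> carrier V \<and> y \<in> carrier V then N (x \<ominus>\<^bsub>V\<^esub> y) else 0)"

definition norm_topology :: "('a, 'm) ring_scheme \<Rightarrow> ('a \<Rightarrow> real) \<Rightarrow> 'a topology" where
  "norm_topology V N = Metric_space.mtopology (carrier V) (norm_dist V N)"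

locale complex_normed_space = Module.module complex_ring V
  for V :: "(complex, 'a, 'm) module_scheme" (structure) +
  fixes N :: "'a \<Rightarrow> real"
  assumes norm_nonneg: "x \<in> carrier V \<Longrightarrow> N x \<ge> 0"
    and norm_eq_zero: "x \<in> carrier V \<Longrightarrow> N x = 0 \<longleftrightarrow> x = \<zero>"
    and norm_triangle: "x \<in> carrier V \<Longrightarrow> y \<in> carrier V \<Longrightarrow> N (x \<oplus> y) \<le> N x + N y"
    and norm_smult: "x \<in> carrier V \<Longrightarrow> N (c \<odot> x) = cmod c * N x"
begin

lemma norm_minus: "x \<in> carrier V \<Longrightarrow> N (\<ominus> x) = N x"
proof -
  assume x: "x \<in> carrier V"
  have "(-1) \<odot> x = \<ominus> x"
  proof -
    have "\<ominus>\<^bsub>complex_ring\<^esub> 1 = - 1"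
      by (rule R.minus_equality) (auto simp: complex_ring_def)
    then show ?thesis
      using smult_l_minus[of 1 x] smult_one[of x] x by (simp add: complex_ring_def)
  qed
  then show ?thesis using norm_smult[OF x, of "-1"] by simp
qed

lemma Metric_space_norm_dist: "Metric_space (carrier V) (norm_dist V N)"
proof
  fix x y z
  show "0 \<le> norm_dist V N x y"
    by (auto simp: norm_dist_def a_minus_def intro!: norm_nonneg)
  show "norm_dist V N x y = norm_dist V N y x"
    using norm_minus[of "x \<ominus> y"]
    by (auto simp: norm_dist_def a_minus_def M.minus_add M.a_comm M.minus_minus)
  show "norm_dist V N x y = 0 \<longleftrightarrow> x = y" if "x \<in> carrier V" "y \<in> carrier V"
    using that by (simp add: norm_dist_def norm_eq_zero a_minus_def)
      (metis M.add.inv_closed M.minus_equality M.minus_minus M.r_neg)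
  show "norm_dist V N x z \<le> norm_dist V N x y + norm_dist V N y z"
    if "x \<in> carrier V" "y \<in> carrier V" "z \<in> carrier V"
  proof -
    have "x \<ominus> z = (x \<ominus> y) \<oplus> (y \<ominus> z)"
      using that by (simp add: a_minus_def M.a_assoc M.r_neg1 M.r_neg2)
    then show ?thesis
      using that norm_triangle[of "x \<ominus> y" "y \<ominus> z"] by (simp add: norm_dist_def)
  qed
qed

end

text \<open>The multiplicative fields of the underlying ring record play no role in a Hilbert space.\<close>

record 'h hilbert = "(complex, 'h) module" +
  cinner :: "'h \<Rightarrow> 'h \<Rightarrow> complex"

definition hnorm :: "'h hilbert \<Rightarrow> 'h \<Rightarrow> real" where
  "hnorm H v = sqrt (Re (cinner H v v))"

locale complex_inner_space = Module.module complex_ring H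
  for H :: "'h hilbert" (structure) +
  assumes cinner_add: "u \<in> carrier H \<Longrightarrow> v \<in> carrier H \<Longrightarrow> w \<in> carrier H \<Longrightarrow>
      cinner H (u \<oplus> v) w = cinner H u w + cinner H v w"
    and cinner_smult: "u \<in> carrier H \<Longrightarrow> v \<in> carrier H \<Longrightarrow> cinner H (c \<odot> u) v = c * cinner H u v"
    and cinner_commute: "u \<in> carrier H \<Longrightarrow> v \<in> carrier H \<Longrightarrow> cinner H v u = cnj (cinner H u v)"
    and cinner_nonneg: "v \<in> carrier H \<Longrightarrow> Re (cinner H v v) \<ge> 0"
    and cinner_definite: "v \<in> carrier H \<Longrightarrow> cinner H v v = 0 \<Longrightarrow> v = \<zero>"
begin

lemma cinner_add_right: "u \<in> carrier H \<Longrightarrow> v \<in> carrier H \<Longrightarrow> w \<in> carrier H \<Longrightarrow>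
    cinner H w (u \<oplus> v) = cinner H w u + cinner H w v"
  using cinner_commute[of "u \<oplus> v" w] cinner_commute[of u w] cinner_commute[of v w]
  by (simp add: cinner_add)

lemma smult_in: "v \<in> carrier H \<Longrightarrow> c \<odot> v \<in> carrier H"
  by (rule smult_closed) (auto simp: complex_ring_def)

lemma cinner_smult_right: "u \<in> carrier H \<Longrightarrow> v \<in> carrier H \<Longrightarrow>
    cinner H u (c \<odot> v) = cnj c * cinner H u v"
  using cinner_commute[of "c \<odot> v" u] cinner_commute[of v u] by (simp add: cinner_smult smult_in)

lemma Im_cinner_self: "v \<in> carrier H \<Longrightarrow> Im (cinner H v v) = 0"
  using cinner_commute[of v v] by (simp add: complex_eq_iff)

lemma cinner_self: "v \<in> carrier H \<Longrightarrow> cinner H v v = of_real ((hnorm H v)\<^sup>2)"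
  by (simp add: complex_eq_iff Im_cinner_self hnorm_def cinner_nonneg)

lemma Cauchy_Schwarz:
  assumes u: "u \<in> carrier H" and v: "v \<in> carrier H"
  shows "cmod (cinner H u v) \<le> hnorm H u * hnorm H v"
proof (cases "hnorm H v = 0")
  case True
  then have "v = \<zero>" using cinner_self[OF v] cinner_definite[OF v] by simp
  moreover have "cinner H u \<zero> = 0"
    using cinner_add_right[of "\<zero>" "\<zero>" u] u by simp
  ultimately show ?thesis using True by simp
next
  case False
  have pos: "hnorm H u \<ge> 0" "hnorm H v > 0"
    using False u v cinner_nonneg[OF u] cinner_nonneg[OF v] by (auto simp: hnorm_def less_le)
  define a where "a = cinner H u v"
  define q where "q = (hnorm H v)\<^sup>2"
  define c where "c = - a / of_real q"
  have q: "q > 0" using pos by (simp add: q_def)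
  have vu: "cinner H v u = cnj a" using cinner_commute[OF u v] by (simp add: a_def)
  have cv: "c \<odot> v \<in> carrier H" using v by (rule smult_in)
  have "cinner H (u \<oplus> c \<odot> v) (u \<oplus> c \<odot> v)
      = cinner H u u + cnj c * a + (c * cnj a + c * (cnj c * cinner H v v))"
    using u v cv by (simp add: cinner_add cinner_add_right cinner_smult cinner_smult_right vu a_def
        algebra_simps)
  also have "\<dots> = of_real ((hnorm H u)\<^sup>2) - a * cnj a / of_real q"
    using q by (simp add: cinner_self[OF u] cinner_self[OF v] c_def flip: q_def)
  also have "\<dots> = of_real ((hnorm H u)\<^sup>2 - (cmod a)\<^sup>2 / q)"
    by (simp flip: complex_norm_square)
  finally have "Re (cinner H (u \<oplus> c \<odot> v) (u \<oplus> c \<odot> v)) = (hnorm H u)\<^sup>2 - (cmod a)\<^sup>2 / q"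
    by simp
  then have "0 \<le> (hnorm H u)\<^sup>2 - (cmod a)\<^sup>2 / q"
    using cinner_nonneg[of "u \<oplus> c \<odot> v"] u cv by simp
  then have "(cmod a)\<^sup>2 \<le> (hnorm H u * hnorm H v)\<^sup>2"
    using q by (simp add: q_def field_simps)
  then show ?thesis
    using pos unfolding a_def by - (rule power2_le_imp_le, auto)
qed

lemma complex_normed_space: "complex_normed_space H (hnorm H)"
proof
  fix u v c
  assume u: "u \<in> carrier H"
  show n: "hnorm H u \<ge> 0" using cinner_nonneg[OF u] by (simp add: hnorm_def)
  show "hnorm H u = 0 \<longleftrightarrow> u = \<zero>"
    using cinner_self[OF u] cinner_definite[OF u] cinner_add[of "\<zero>" "\<zero>" "\<zero>"]
    by (auto simp: hnorm_def)
  show "hnorm H (c \<odot> u) = cmod c * hnorm H u"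
  proof -
    have "cinner H (c \<odot> u) (c \<odot> u) = (c * cnj c) * of_real ((hnorm H u)\<^sup>2)"
      using u by (simp add: cinner_smult cinner_smult_right smult_in cinner_self[OF u])
    also have "\<dots> = of_real ((cmod c * hnorm H u)\<^sup>2)"
      by (simp only: power_mult_distrib of_real_mult complex_norm_square[of c])
    finally have "Re (cinner H (c \<odot> u) (c \<odot> u)) = (cmod c * hnorm H u)\<^sup>2"
      by (metis Re_complex_of_real)
    then have "hnorm H (c \<odot> u) = sqrt ((cmod c * hnorm H u)\<^sup>2)"
      by (simp only: hnorm_def[of H "c \<odot> u"])
    also have "\<dots> = cmod c * hnorm H u"
      using n by (intro real_sqrt_unique) auto
    finally show ?thesis .
  qed
  assume v: "v \<in> carrier H"
  have nv: "hnorm H v \<ge> 0" using cinner_nonneg[OF v] by (simp add: hnorm_def)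
  have "cinner H (u \<oplus> v) (u \<oplus> v) = cinner H u u + cinner H v v + (cinner H u v + cnj (cinner H u v))"
    using u v cinner_commute[OF u v] by (simp add: cinner_add cinner_add_right)
  then have "(hnorm H (u \<oplus> v))\<^sup>2 = (hnorm H u)\<^sup>2 + (hnorm H v)\<^sup>2 + 2 * Re (cinner H u v)"
    using u v cinner_nonneg[of "u \<oplus> v"] cinner_nonneg[OF u] cinner_nonneg[OF v]
    by (simp add: hnorm_def)
  also have "\<dots> \<le> (hnorm H u + hnorm H v)\<^sup>2"
    using Cauchy_Schwarz[OF u v] complex_Re_le_cmod[of "cinner H u v"]
    by (simp add: power2_sum)
  finally show "hnorm H (u \<oplus> v) \<le> hnorm H u + hnorm H v"
    using n nv by - (rule power2_le_imp_le, auto)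
qed

end

locale hilbert_space = complex_inner_space +
  assumes complete: "Metric_space.mcomplete (carrier H) (norm_dist H (hnorm H))"


section \<open>C*-algebras\<close>

text \<open>
  A separable C*-algebra has at most continuum many elements, so every AF algebra is isomorphic to
  one whose carrier lies in the type \<^typ>\<open>nat \<Rightarrow> nat \<Rightarrow> complex\<close>; no matrix structure is implied by
  this choice.
\<close>

record 'a cstar = "(complex, 'a) module" +
  star :: "'a \<Rightarrow> 'a"
  cnorm :: "'a \<Rightarrow> real"

locale unital_cstar_algebra = ring A + complex_normed_space A "cnorm A"
  for A :: "'a cstar" (structure) +
  assumes smult_mult_left: "x \<in> carrier A \<Longrightarrow> y \<in> carrier A \<Longrightarrow> (c \<odot> x) \<otimes> y = c \<odot> (x \<otimes> y)"
    and smult_mult_right: "x \<in> carrier A \<Longrightarrow> y \<in> carrier A \<Longrightarrow> x \<otimes> (c \<odot> y) = c \<odot> (x \<otimes> y)"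
    and norm_mult: "x \<in> carrier A \<Longrightarrow> y \<in> carrier A \<Longrightarrow> cnorm A (x \<otimes> y) \<le> cnorm A x * cnorm A y"
    and star_closed: "x \<in> carrier A \<Longrightarrow> star A x \<in> carrier A"
    and star_star: "x \<in> carrier A \<Longrightarrow> star A (star A x) = x"
    and star_add: "x \<in> carrier A \<Longrightarrow> y \<in> carrier A \<Longrightarrow> star A (x \<oplus> y) = star A x \<oplus> star A y"
    and star_smult: "x \<in> carrier A \<Longrightarrow> star A (c \<odot> x) = cnj c \<odot> star A x"
    and star_mult: "x \<in> carrier A \<Longrightarrow> y \<in> carrier A \<Longrightarrow> star A (x \<otimes> y) = star A y \<otimes> star A x"
    and cstar_identity: "x \<in> carrier A \<Longrightarrow> cnorm A (star A x \<otimes> x) = (cnorm A x)\<^sup>2"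
    and complete: "Metric_space.mcomplete (carrier A) (norm_dist A (cnorm A))"

abbreviation cstar_topology :: "'a cstar \<Rightarrow> 'a topology" where
  "cstar_topology A \<equiv> norm_topology A (cnorm A)"

definition closed_ideal :: "'a cstar \<Rightarrow> 'a set \<Rightarrow> bool" where
  "closed_ideal A I \<longleftrightarrow> ideal I A \<and> closedin (cstar_topology A) I"

definition simple_cstar :: "'a cstar \<Rightarrow> bool" where
  "simple_cstar A \<longleftrightarrow> carrier A \<noteq> {\<zero>\<^bsub>A\<^esub>} \<and>
     (\<forall>I. closed_ideal A I \<longrightarrow> I = {\<zero>\<^bsub>A\<^esub>} \<or> I = carrier A)"

definition prime_cstar :: "'a cstar \<Rightarrow> bool" where
  "prime_cstar A \<longleftrightarrow> carrier A \<noteq> {\<zero>\<^bsub>A\<^esub>} \<and>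
     (\<forall>I J. closed_ideal A I \<longrightarrow> closed_ideal A J \<longrightarrow> (\<forall>x\<in>I. \<forall>y\<in>J. x \<otimes>\<^bsub>A\<^esub> y = \<zero>\<^bsub>A\<^esub>) \<longrightarrow>
        I = {\<zero>\<^bsub>A\<^esub>} \<or> J = {\<zero>\<^bsub>A\<^esub>})"

definition star_subalgebra :: "'a cstar \<Rightarrow> 'a set \<Rightarrow> bool" where
  "star_subalgebra A B \<longleftrightarrow> B \<subseteq> carrier A \<and> submodule B complex_ring A \<and>
     (\<forall>x\<in>B. \<forall>y\<in>B. x \<otimes>\<^bsub>A\<^esub> y \<in> B) \<and> (\<forall>x\<in>B. star A x \<in> B)"

definition finite_dim :: "(complex, 'a, 'm) module_scheme \<Rightarrow> 'a set \<Rightarrow> bool" where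
  "finite_dim V B \<longleftrightarrow> (\<exists>S. finite S \<and> S \<subseteq> B \<and>
     (\<forall>x\<in>B. \<exists>c. x = (\<Oplus>\<^bsub>V\<^esub>s\<in>S. c s \<odot>\<^bsub>V\<^esub> s)))"

text \<open>
  Finite-dimensional subspaces of a normed space are closed, so the \<open>B k\<close> are C*-subalgebras.
  They are not required to contain the unit of \<open>A\<close>.
\<close>

definition AF_algebra :: "'a cstar \<Rightarrow> bool" where
  "AF_algebra A \<longleftrightarrow> (\<exists>B :: nat \<Rightarrow> 'a set.
     (\<forall>k. star_subalgebra A (B k) \<and> finite_dim A (B k) \<and> B k \<subseteq> B (Suc k)) \<and>
     (cstar_topology A) closure_of (\<Union>k. B k) = carrier A)"


section \<open>Primitive ideals\<close>

locale star_representation = unital_cstar_algebra A + H: hilbert_space H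
  for A :: "'a cstar" and H :: "'h hilbert" and \<pi> :: "'a \<Rightarrow> 'h \<Rightarrow> 'h" +
  assumes rep_closed: "a \<in> carrier A \<Longrightarrow> v \<in> carrier H \<Longrightarrow> \<pi> a v \<in> carrier H"
    and rep_linear_add: "a \<in> carrier A \<Longrightarrow> v \<in> carrier H \<Longrightarrow> w \<in> carrier H \<Longrightarrow>
      \<pi> a (v \<oplus>\<^bsub>H\<^esub> w) = \<pi> a v \<oplus>\<^bsub>H\<^esub> \<pi> a w"
    and rep_linear_smult: "a \<in> carrier A \<Longrightarrow> v \<in> carrier H \<Longrightarrow>
      \<pi> a (c \<odot>\<^bsub>H\<^esub> v) = c \<odot>\<^bsub>H\<^esub> \<pi> a v"
    and rep_bounded: "a \<in> carrier A \<Longrightarrow> \<exists>K. \<forall>v\<in>carrier H. hnorm H (\<pi> a v) \<le> K * hnorm H v"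
    and rep_add: "a \<in> carrier A \<Longrightarrow> b \<in> carrier A \<Longrightarrow> v \<in> carrier H \<Longrightarrow>
      \<pi> (a \<oplus>\<^bsub>A\<^esub> b) v = \<pi> a v \<oplus>\<^bsub>H\<^esub> \<pi> b v"
    and rep_smult: "a \<in> carrier A \<Longrightarrow> v \<in> carrier H \<Longrightarrow> \<pi> (c \<odot>\<^bsub>A\<^esub> a) v = c \<odot>\<^bsub>H\<^esub> \<pi> a v"
    and rep_mult: "a \<in> carrier A \<Longrightarrow> b \<in> carrier A \<Longrightarrow> v \<in> carrier H \<Longrightarrow>
      \<pi> (a \<otimes>\<^bsub>A\<^esub> b) v = \<pi> a (\<pi> b v)"
    and rep_star: "a \<in> carrier A \<Longrightarrow> v \<in> carrier H \<Longrightarrow> w \<in> carrier H \<Longrightarrow>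
      cinner H (\<pi> (star A a) v) w = cinner H v (\<pi> a w)"

definition rep_kernel :: "'a cstar \<Rightarrow> 'h hilbert \<Rightarrow> ('a \<Rightarrow> 'h \<Rightarrow> 'h) \<Rightarrow> 'a set" where
  "rep_kernel A H \<pi> = {a \<in> carrier A. \<forall>v\<in>carrier H. \<pi> a v = \<zero>\<^bsub>H\<^esub>}"

text \<open>The zero representation on a one-dimensional space is not counted as irreducible.\<close>

definition irreducible_rep :: "'a cstar \<Rightarrow> 'h hilbert \<Rightarrow> ('a \<Rightarrow> 'h \<Rightarrow> 'h) \<Rightarrow> bool" where
  "irreducible_rep A H \<pi> \<longleftrightarrow> star_representation A H \<pi> \<and> rep_kernel A H \<pi> \<noteq> carrier A \<and>
     (\<forall>W. submodule W complex_ring H \<longrightarrow> closedin (norm_topology H (hnorm H)) W \<longrightarrow>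
        (\<forall>a\<in>carrier A. \<forall>v\<in>W. \<pi> a v \<in> W) \<longrightarrow> W = {\<zero>\<^bsub>H\<^esub>} \<or> W = carrier H)"

text \<open>
  Hilbert spaces with vectors in the type of the algebra suffice: if \<open>v\<close> is a nonzero vector of an
  irreducible representation, then by Kadison transitivity \<open>a \<mapsto> \<pi> a v\<close> maps \<open>A\<close> onto the whole
  Hilbert space, which is therefore isomorphic to one carried by a subset of \<open>A\<close>.
\<close>

definition Prim :: "'a cstar \<Rightarrow> 'a set set" where
  "Prim A = {J. \<exists>(H :: 'a hilbert) \<pi>. irreducible_rep A H \<pi> \<and> J = rep_kernel A H \<pi>}"


section \<open>Automorphisms and actions\<close>

text \<open>Preservation of the unit is part of \<open>ring_hom\<close> and automatic for bijections.\<close>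

definition cstar_Aut :: "'a cstar \<Rightarrow> ('a \<Rightarrow> 'a) monoid" where
  "cstar_Aut A = (BijGroup (carrier A))
     \<lparr>carrier := {f \<in> Bij (carrier A). f \<in> ring_hom A A \<and>
        (\<forall>c. \<forall>x\<in>carrier A. f (c \<odot>\<^bsub>A\<^esub> x) = c \<odot>\<^bsub>A\<^esub> f x) \<and>
        (\<forall>x\<in>carrier A. f (star A x) = star A (f x))}\<rparr>"

definition cstar_action :: "('g, 'm) monoid_scheme \<Rightarrow> 'a cstar \<Rightarrow> ('g \<Rightarrow> 'a \<Rightarrow> 'a) \<Rightarrow> bool" where
  "cstar_action G A \<alpha> \<longleftrightarrow> \<alpha> \<in> hom G (cstar_Aut A)"

definition minimal_action :: "('g, 'm) monoid_scheme \<Rightarrow> 'a cstar \<Rightarrow> ('g \<Rightarrow> 'a \<Rightarrow> 'a) \<Rightarrow> bool" where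
  "minimal_action G A \<alpha> \<longleftrightarrow>
     (\<forall>I. closed_ideal A I \<longrightarrow> (\<forall>g\<in>carrier G. \<alpha> g ` I = I) \<longrightarrow> I = {\<zero>\<^bsub>A\<^esub>} \<or> I = carrier A)"

definition effective_action :: "('g, 'm) monoid_scheme \<Rightarrow> ('g \<Rightarrow> 's \<Rightarrow> 's) \<Rightarrow> 's set \<Rightarrow> bool" where
  "effective_action G \<phi> S \<longleftrightarrow> (\<forall>g\<in>carrier G - {\<one>\<^bsub>G\<^esub>}. \<exists>s\<in>S. \<phi> g s \<noteq> s)"

definition ideal_action :: "('g \<Rightarrow> 'a \<Rightarrow> 'a) \<Rightarrow> 'g \<Rightarrow> 'a set \<Rightarrow> 'a set" where
  "ideal_action \<alpha> g J = \<alpha> g ` J"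

end

theory Submission
  imports Defs "HOL-Library.Function_Algebras" "HOL-Analysis.Infinite_Sum" "HOL-Analysis.L2_Norm"
    "HOL-Library.Extended_Nat" "HOL-Library.Countable_Set"
begin

text \<open>
  A configuration gives every element of a group \<open>G\<close> a value in \<open>{0, 1, \<dots>, \<infinity>}\<close>. Finite
  values may be changed into other finite values, at finitely many sites at a time; the value
  \<open>\<infinity>\<close> is frozen. The algebra \<open>A\<close> is the AF algebra of this relation of moves: an operator of its
  \<open>k\<close>-th level moves only values up to \<open>k\<close> at group elements of length up to \<open>k\<close>, with matrix
  entries that depend only on what is visible in a finite window. It acts on \<open>\<ell>\<^sup>2\<close> of the countable
  set of configurations with finite support and at most one infinite value, and \<open>G\<close> acts on it by
  translation. The elements that vanish on a set of configurations that is invariant under moves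
  form an ideal; such sets are described by their frozen sites.

  Configurations are constrained: if \<open>s\<^sup>-\<^sup>1 t\<close> and \<open>s\<^sup>-\<^sup>1 u\<close> do not commute, then the values at \<open>s\<close>, \<open>t\<close>
  and \<open>u\<close> do not all exceed \<open>d(s, t) + d(s, u)\<close>. So in the limit the frozen sites lie in a
  translate of an abelian subgroup, while a constraint that involves a site with a small value
  remains local; the latter is why the moves have finite levels (\<open>configs_lift\<close>).

  Any nonzero closed ideal contains the projection of some window, by an argument with corners and
  a Neumann series (\<open>ideal_contains_unit\<close>). All properties of \<open>A\<close> are thereby reduced to statements
  about configurations.

  \<^item> \<open>A\<close> is prime, since every window contains configurations without infinite values and any two of
    these are related by a move (\<open>prime_A\<close>).
  \<^item> The action is minimal: the free group has, for every \<open>r\<close>, three translates of the ball of radius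
    \<open>r\<close> such that points taken from the three always violate commutation (\<open>free_group_spread\<close>). By
    the constraint one of the three balls has bounded values, so a move can write a given
    window into it (\<open>translates_meet\<close>). Hence the projections of the translates of one window
    generate the unit (\<open>invariant_ideal_eq_carrier\<close>).
  \<^item> For an abelian subgroup \<open>H\<close> the constraint allows arbitrarily large values on \<open>H\<close>. The elements
    that vanish where the values on \<open>H\<close> are large therefore form a proper nonzero \<open>H\<close>-invariant
    closed ideal (\<open>abelian_subgroup_ideal\<close>); with \<open>H\<close> trivial, \<open>A\<close> is not simple.
  \<^item> The configurations with value \<open>\<infinity>\<close> exactly at one site \<open>s\<close> form an orbit that carries an
    irreducible representation (\<open>irreducible_H\<close>). Its kernel determines \<open>s\<close>, and so \<open>G\<close> acts
    effectively on the primitive ideals (\<open>effective_act\<close>).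
\<close>

section \<open>Bounded infinite matrices\<close>

type_synonym cmat = "nat \<Rightarrow> nat \<Rightarrow> complex"

abbreviation l2 :: "(nat \<Rightarrow> complex) \<Rightarrow> nat set \<Rightarrow> real" where
  "l2 u I \<equiv> L2_set (\<lambda>i. cmod (u i)) I"

text \<open>
  The operator norm on \<open>\<ell>\<^sup>2\<close> through the bilinear form on finitely supported vectors. In this form
  the bound passes to adjoints, to entrywise limits and to permutations of the basis by inspection.
\<close>

definition mbound :: "cmat \<Rightarrow> real \<Rightarrow> bool" where
  "mbound a K \<longleftrightarrow> 0 \<le> K \<and> (\<forall>I u v. finite I \<longrightarrow>
     cmod (\<Sum>i\<in>I. \<Sum>j\<in>I. u i * a i j * v j) \<le> K * l2 u I * l2 v I)"

definition mstar :: "cmat \<Rightarrow> cmat" where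
  "mstar a = (\<lambda>i j. cnj (a j i))"

definition msmult :: "complex \<Rightarrow> cmat \<Rightarrow> cmat" where
  "msmult c a = (\<lambda>i j. c * a i j)"

definition mone :: cmat where
  "mone = (\<lambda>i j. if i = j then 1 else 0)"

definition mmult :: "cmat \<Rightarrow> cmat \<Rightarrow> cmat" (infixl "\<star>" 70) where
  "a \<star> b = (\<lambda>i k. \<Sum>\<^sub>\<infinity>j. a i j * b j k)"

definition mnorm :: "cmat \<Rightarrow> real" where
  "mnorm a = Inf {K. mbound a K}"

definition bmat :: "cmat \<Rightarrow> bool" where
  "bmat a \<longleftrightarrow> (\<exists>K. mbound a K)"

lemma msmult_apply: "msmult c a i j = c * a i j"
  by (simp add: msmult_def)

lemma L2_set_extend:
  assumes "finite J" "I \<subseteq> J"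
  shows "L2_set (\<lambda>i. cmod (if i \<in> I then u i else 0)) J = l2 u I"
proof -
  have "(\<Sum>i\<in>J. (cmod (if i \<in> I then u i else 0))\<^sup>2) = (\<Sum>i\<in>I. (cmod (u i))\<^sup>2)"
    using assms by (intro sum.mono_neutral_cong_right) auto
  then show ?thesis by (simp add: L2_set_def)
qed

lemma l2_mono: "finite J \<Longrightarrow> I \<subseteq> J \<Longrightarrow> l2 u I \<le> l2 u J"
  by (auto simp: L2_set_def intro!: real_sqrt_le_mono sum_mono2)

lemma mbound_nonneg: "mbound a K \<Longrightarrow> 0 \<le> K"
  by (simp add: mbound_def)

lemma mboundI:
  assumes "0 \<le> K" "\<And>I u v. finite I \<Longrightarrow>
    cmod (\<Sum>i\<in>I. \<Sum>j\<in>I. u i * a i j * v j) \<le> K * l2 u I * l2 v I"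
  shows "mbound a K"
  using assms by (simp add: mbound_def)

lemma mboundD: "mbound a K \<Longrightarrow> finite I \<Longrightarrow>
    cmod (\<Sum>i\<in>I. \<Sum>j\<in>I. u i * a i j * v j) \<le> K * l2 u I * l2 v I"
  by (simp add: mbound_def)

lemma mbound_rect:
  assumes "mbound a K" "finite I" "finite J"
  shows "cmod (\<Sum>i\<in>I. \<Sum>j\<in>J. u i * a i j * v j) \<le> K * l2 u I * l2 v J"
proof -
  let ?u = "\<lambda>i. if i \<in> I then u i else 0" and ?v = "\<lambda>i. if i \<in> J then v i else 0"
  have "(\<Sum>i\<in>I. \<Sum>j\<in>J. u i * a i j * v j) = (\<Sum>i\<in>I. \<Sum>j\<in>I \<union> J. u i * a i j * ?v j)"
    by (rule sum.cong[OF refl], rule sum.mono_neutral_cong_left) (use assms in auto)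
  also have "\<dots> = (\<Sum>i\<in>I \<union> J. \<Sum>j\<in>I \<union> J. ?u i * a i j * ?v j)"
    by (rule sum.mono_neutral_cong_left) (use assms in auto)
  finally have *: "(\<Sum>i\<in>I. \<Sum>j\<in>J. u i * a i j * v j) = (\<Sum>i\<in>I \<union> J. \<Sum>j\<in>I \<union> J. ?u i * a i j * ?v j)" .
  have "finite (I \<union> J)" using assms by simp
  then have "cmod (\<Sum>i\<in>I \<union> J. \<Sum>j\<in>I \<union> J. ?u i * a i j * ?v j) \<le> K * l2 ?u (I \<union> J) * l2 ?v (I \<union> J)"
    by (rule mboundD[OF assms(1)])
  also have "l2 ?u (I \<union> J) = l2 u I" by (rule L2_set_extend) (use assms in auto)
  also have "l2 ?v (I \<union> J) = l2 v J" by (rule L2_set_extend) (use assms in auto)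
  finally show ?thesis unfolding * .
qed

lemma l2_sq: "(l2 w I)\<^sup>2 = (\<Sum>i\<in>I. (cmod (w i))\<^sup>2)"
  by (simp add: L2_set_def sum_nonneg)

lemma cmod_square: "complex_of_real ((cmod z)\<^sup>2) = cnj z * z"
  by (metis complex_norm_square mult.commute)

lemma mbound_apply:
  assumes "mbound a K" "finite I" "finite J"
  shows "l2 (\<lambda>i. \<Sum>j\<in>J. a i j * v j) I \<le> K * l2 v J"
proof -
  let ?w = "\<lambda>i. \<Sum>j\<in>J. a i j * v j"
  have "of_real ((l2 ?w I)\<^sup>2) = (\<Sum>i\<in>I. cnj (?w i) * ?w i)"
    unfolding l2_sq of_real_sum by (intro sum.cong refl cmod_square)
  also have "\<dots> = (\<Sum>i\<in>I. \<Sum>j\<in>J. cnj (?w i) * a i j * v j)"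
    by (simp only: sum_distrib_left mult.assoc)
  finally have "cmod (of_real ((l2 ?w I)\<^sup>2)) = cmod (\<Sum>i\<in>I. \<Sum>j\<in>J. cnj (?w i) * a i j * v j)"
    by (rule arg_cong)
  then have "(l2 ?w I)\<^sup>2 = cmod (\<Sum>i\<in>I. \<Sum>j\<in>J. cnj (?w i) * a i j * v j)"
    unfolding norm_of_real abs_power2 .
  also have "\<dots> \<le> K * l2 (\<lambda>i. cnj (?w i)) I * l2 v J"
    by (rule mbound_rect[OF assms])
  finally have "(l2 ?w I)\<^sup>2 \<le> K * l2 ?w I * l2 v J"
    unfolding complex_mod_cnj .
  then have "l2 ?w I * l2 ?w I \<le> l2 ?w I * (K * l2 v J)"
    by (simp only: power2_eq_square mult_ac)
  moreover have "0 \<le> K * l2 v J" using mbound_nonneg[OF assms(1)] by simp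
  ultimately show ?thesis
    by (cases "l2 ?w I = 0") (simp_all add: mult_le_cancel_left less_le)
qed

lemma mboundI_apply:
  assumes "0 \<le> K" "\<And>I v. finite I \<Longrightarrow> l2 (\<lambda>i. \<Sum>j\<in>I. a i j * v j) I \<le> K * l2 v I"
  shows "mbound a K"
proof (rule mboundI)
  fix I :: "nat set" and u v :: "nat \<Rightarrow> complex"
  assume I: "finite I"
  have "cmod (\<Sum>i\<in>I. \<Sum>j\<in>I. u i * a i j * v j) = cmod (\<Sum>i\<in>I. u i * (\<Sum>j\<in>I. a i j * v j))"
    by (simp only: sum_distrib_left mult.assoc)
  also have "\<dots> \<le> (\<Sum>i\<in>I. \<bar>cmod (u i)\<bar> * \<bar>cmod (\<Sum>j\<in>I. a i j * v j)\<bar>)"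
    by (rule order_trans[OF norm_sum]) (simp add: norm_mult)
  also have "\<dots> \<le> l2 u I * l2 (\<lambda>i. \<Sum>j\<in>I. a i j * v j) I"
    by (rule L2_set_mult_ineq)
  also have "\<dots> \<le> l2 u I * (K * l2 v I)"
    by (rule mult_left_mono[OF assms(2)[OF I]]) simp
  finally show "cmod (\<Sum>i\<in>I. \<Sum>j\<in>I. u i * a i j * v j) \<le> K * l2 u I * l2 v I"
    by (simp add: mult_ac)
qed (fact assms(1))

lemma mbound_entry:
  assumes "mbound a K" shows "cmod (a i j) \<le> K"
  using mbound_rect[OF assms, of "{i}" "{j}" "\<lambda>_. 1" "\<lambda>_. 1"] by simp

lemma mbound_mono:
  assumes "mbound a K" "K \<le> L"
  shows "mbound a L"
proof (rule mboundI)
  fix I :: "nat set" and u v :: "nat \<Rightarrow> complex"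
  assume "finite I"
  then have "cmod (\<Sum>i\<in>I. \<Sum>j\<in>I. u i * a i j * v j) \<le> K * l2 u I * l2 v I"
    by (rule mboundD[OF assms(1)])
  also have "\<dots> \<le> L * l2 u I * l2 v I"
    using assms(2) by (intro mult_right_mono) auto
  finally show "cmod (\<Sum>i\<in>I. \<Sum>j\<in>I. u i * a i j * v j) \<le> L * l2 u I * l2 v I" .
qed (use mbound_nonneg[OF assms(1)] assms(2) in simp)

lemma mbound_star: assumes "mbound a K" shows "mbound (mstar a) K"
proof (rule mboundI)
  fix I :: "nat set" and u v :: "nat \<Rightarrow> complex"
  assume I: "finite I"
  have "(\<Sum>i\<in>I. \<Sum>j\<in>I. u i * mstar a i j * v j) = cnj (\<Sum>j\<in>I. \<Sum>i\<in>I. cnj (v j) * a j i * cnj (u i))"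
    by (subst sum.swap) (simp add: mstar_def mult_ac)
  then have "cmod (\<Sum>i\<in>I. \<Sum>j\<in>I. u i * mstar a i j * v j)
      = cmod (\<Sum>j\<in>I. \<Sum>i\<in>I. cnj (v j) * a j i * cnj (u i))" by (simp only: complex_mod_cnj)
  also have "\<dots> \<le> K * l2 (\<lambda>i. cnj (v i)) I * l2 (\<lambda>i. cnj (u i)) I"
    by (rule mboundD[OF assms I])
  finally show "cmod (\<Sum>i\<in>I. \<Sum>j\<in>I. u i * mstar a i j * v j) \<le> K * l2 u I * l2 v I"
    by (simp add: mult_ac)
qed (rule mbound_nonneg[OF assms])

lemma mbound_zero: "mbound 0 0"
  by (simp add: mbound_def)

lemma mbound_add:
  assumes "mbound a K" "mbound b L"
  shows "mbound (a + b) (K + L)"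
proof (rule mboundI)
  fix I :: "nat set" and u v :: "nat \<Rightarrow> complex"
  assume I: "finite I"
  have "(\<Sum>i\<in>I. \<Sum>j\<in>I. u i * (a + b) i j * v j)
     = (\<Sum>i\<in>I. \<Sum>j\<in>I. u i * a i j * v j) + (\<Sum>i\<in>I. \<Sum>j\<in>I. u i * b i j * v j)"
    by (simp add: algebra_simps sum.distrib)
  also have "cmod \<dots> \<le> K * l2 u I * l2 v I + L * l2 u I * l2 v I"
    by (intro norm_triangle_mono mboundD[OF assms(1) I] mboundD[OF assms(2) I])
  finally show "cmod (\<Sum>i\<in>I. \<Sum>j\<in>I. u i * (a + b) i j * v j) \<le> (K + L) * l2 u I * l2 v I"
    by (simp add: algebra_simps)
qed (simp add: assms[THEN mbound_nonneg])

lemma mbound_smult: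
  assumes "mbound a K"
  shows "mbound (msmult c a) (cmod c * K)"
proof (rule mboundI)
  fix I :: "nat set" and u v :: "nat \<Rightarrow> complex"
  assume I: "finite I"
  have "(\<Sum>i\<in>I. \<Sum>j\<in>I. u i * msmult c a i j * v j) = c * (\<Sum>i\<in>I. \<Sum>j\<in>I. u i * a i j * v j)"
    by (simp add: msmult_def sum_distrib_left mult_ac)
  then show "cmod (\<Sum>i\<in>I. \<Sum>j\<in>I. u i * msmult c a i j * v j) \<le> cmod c * K * l2 u I * l2 v I"
    using mult_left_mono[OF mboundD[OF assms I, of u v], of "cmod c"] by (simp add: norm_mult mult.assoc)
qed (simp add: assms[THEN mbound_nonneg])

lemma msmult_minus_one: "msmult (-1) a = - a"
  by (simp add: msmult_def fun_eq_iff)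

lemma mbound_uminus: "mbound a K \<Longrightarrow> mbound (- a) K"
  using mbound_smult[of a K "-1"] by (simp add: msmult_minus_one)

lemma mbound_diff: "mbound a K \<Longrightarrow> mbound b L \<Longrightarrow> mbound (a - b) (K + L)"
  using mbound_add[OF _ mbound_uminus, of a K b L] by simp

lemma mbound_minus_commute: "mbound (a - b) K \<Longrightarrow> mbound (b - a) K"
  using mbound_uminus[of "a - b" K] by simp

text \<open>Such a matrix is a partial isometry between coordinate subspaces.\<close>

lemma mbound_partial_permutation:
  assumes "\<And>i j. a i j = 0 \<or> a i j = 1"
    and row: "\<And>i j j'. a i j \<noteq> 0 \<Longrightarrow> a i j' \<noteq> 0 \<Longrightarrow> j = j'"
    and col: "\<And>i i' j. a i j \<noteq> 0 \<Longrightarrow> a i' j \<noteq> 0 \<Longrightarrow> i = i'"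
  shows "mbound a 1"
proof (rule mboundI_apply)
  fix I :: "nat set" and v :: "nat \<Rightarrow> complex"
  assume I: "finite I"
  define D where "D = {i \<in> I. \<exists>j\<in>I. a i j \<noteq> 0}"
  define f where "f = (\<lambda>i. SOME j. j \<in> I \<and> a i j \<noteq> 0)"
  have f: "f i \<in> I \<and> a i (f i) \<noteq> 0" if "i \<in> D" for i
  proof -
    have "\<exists>j. j \<in> I \<and> a i j \<noteq> 0" using that by (auto simp: D_def)
    then show ?thesis unfolding f_def by (rule someI_ex)
  qed
  have inj: "inj_on f D"
  proof (rule inj_onI)
    fix i i' assume "i \<in> D" "i' \<in> D" "f i = f i'"
    then show "i = i'" using f[of i] f[of i'] by (intro col[of i "f i" i']) auto
  qed
  have val: "(\<Sum>j\<in>I. a i j * v j) = v (f i)" if "i \<in> D" for i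
  proof -
    have "(\<Sum>j\<in>I. a i j * v j) = (\<Sum>j\<in>{f i}. a i j * v j)"
      using f[OF that] row[of i "f i"] I by (intro sum.mono_neutral_right) auto
    then show ?thesis using f[OF that] assms(1)[of i "f i"] by auto
  qed
  have zero: "(\<Sum>j\<in>I. a i j * v j) = 0" if "i \<in> I - D" for i
    using that by (auto simp: D_def intro!: sum.neutral)
  have "(l2 (\<lambda>i. \<Sum>j\<in>I. a i j * v j) I)\<^sup>2 = (\<Sum>i\<in>D. (cmod (v (f i)))\<^sup>2)"
    unfolding l2_sq using I zero val
    by (intro sum.mono_neutral_cong_right) (auto simp: D_def)
  also have "\<dots> = (\<Sum>j\<in>f ` D. (cmod (v j))\<^sup>2)"
    by (simp add: sum.reindex[OF inj])
  also have "\<dots> \<le> (\<Sum>j\<in>I. (cmod (v j))\<^sup>2)"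
    using f I by (intro sum_mono2) auto
  also have "\<dots> = (l2 v I)\<^sup>2" by (simp only: l2_sq)
  finally show "l2 (\<lambda>i. \<Sum>j\<in>I. a i j * v j) I \<le> 1 * l2 v I"
    unfolding mult_1 by (rule power2_le_imp_le) simp
qed simp

lemma mbound_one: "mbound mone 1"
  by (rule mbound_partial_permutation) (auto simp: mone_def split: if_splits)

lemma column_summable: assumes "mbound a K" shows "(\<lambda>i. (cmod (a i j))\<^sup>2) summable_on UNIV"
proof (rule nonneg_bdd_above_summable_on)
  have "(\<Sum>i\<in>F. (cmod (a i j))\<^sup>2) \<le> K\<^sup>2" if "finite F" for F
  proof -
    have "l2 (\<lambda>i. a i j) F \<le> K"
      using mbound_apply[OF assms that, of "{j}" "\<lambda>_. 1"] by simp
    then have "(l2 (\<lambda>i. a i j) F)\<^sup>2 \<le> K\<^sup>2" by (intro power_mono) auto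
    then show ?thesis by (simp only: l2_sq)
  qed
  then show "bdd_above (sum (\<lambda>i. (cmod (a i j))\<^sup>2) ` {F. F \<subseteq> UNIV \<and> finite F})"
    by (intro bdd_aboveI[of _ "K\<^sup>2"]) auto
qed simp

lemma row_summable: assumes "mbound a K" shows "(\<lambda>j. (cmod (a i j))\<^sup>2) summable_on UNIV"
  using column_summable[OF mbound_star[OF assms], of i] by (simp add: mstar_def)

lemma mmult_has_sum:
  assumes "bmat a" "bmat b"
  shows "((\<lambda>j. a i j * b j k) has_sum (a \<star> b) i k) UNIV"
proof -
  obtain K L where "mbound a K" "mbound b L" using assms by (auto simp: bmat_def)
  then have "(\<lambda>j. a i j * a i j) abs_summable_on UNIV" "(\<lambda>j. b j k * b j k) abs_summable_on UNIV"
    using row_summable[of a K i] column_summable[of b L k] by (simp_all add: norm_mult power2_eq_square)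
  then have "(\<lambda>j. a i j * b j k) abs_summable_on UNIV" by (rule abs_summable_product)
  then show ?thesis
    unfolding mmult_def by (simp add: abs_summable_summable)
qed

lemma has_sum_finite_sum:
  fixes f :: "'i \<Rightarrow> 'a \<Rightarrow> complex"
  assumes "\<And>i. i \<in> I \<Longrightarrow> (f i has_sum s i) A"
  shows "((\<lambda>x. \<Sum>i\<in>I. f i x) has_sum (\<Sum>i\<in>I. s i)) A"
  using assms by (induction I rule: infinite_finite_induct) (auto intro!: has_sum_add)

lemma has_sum_norm_le:
  fixes f :: "'a \<Rightarrow> complex"
  assumes "(f has_sum S) A" "\<And>F. finite F \<Longrightarrow> F \<subseteq> A \<Longrightarrow> cmod (sum f F) \<le> B"
  shows "cmod S \<le> B"
proof (rule tendsto_upperbound)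
  show "((\<lambda>F. cmod (sum f F)) \<longlongrightarrow> cmod S) (finite_subsets_at_top A)"
    using assms(1) unfolding has_sum_def by (rule tendsto_norm)
  show "\<forall>\<^sub>F F in finite_subsets_at_top A. cmod (sum f F) \<le> B"
    using assms(2) by (intro eventually_finite_subsets_at_top_weakI) auto
qed simp

lemma mbound_apply_left:
  assumes "mbound a K" "finite I" "finite J"
  shows "l2 (\<lambda>j. \<Sum>i\<in>I. u i * a i j) J \<le> K * l2 u I"
proof -
  have "(\<Sum>i\<in>I. mstar a j i * cnj (u i)) = cnj (\<Sum>i\<in>I. u i * a i j)" for j
    by (simp add: mstar_def mult.commute)
  then have "cmod (\<Sum>i\<in>I. mstar a j i * cnj (u i)) = cmod (\<Sum>i\<in>I. u i * a i j)" for j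
    by (simp only: complex_mod_cnj)
  then show ?thesis
    using mbound_apply[OF mbound_star[OF assms(1)] assms(3,2), of "\<lambda>i. cnj (u i)"]
    by (simp only: complex_mod_cnj)
qed

text \<open>
  By Cauchy--Schwarz in the summation index, applied to the vectors \<open>u a\<close> and \<open>b v\<close>; the finite
  partial sums have the bound, hence so has their limit.
\<close>

lemma mbound_mult:
  assumes a: "mbound a K" and b: "mbound b L"
  shows "mbound (a \<star> b) (K * L)"
proof (rule mboundI)
  show "0 \<le> K * L" using assms by (simp add: mbound_nonneg)
  fix I :: "nat set" and u v :: "nat \<Rightarrow> complex"
  assume I: "finite I"
  have ab: "bmat a" "bmat b" using assms by (auto simp: bmat_def)
  have "((\<lambda>j. \<Sum>i\<in>I. \<Sum>k\<in>I. u i * (a i j * b j k) * v k) has_sum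
      (\<Sum>i\<in>I. \<Sum>k\<in>I. u i * (a \<star> b) i k * v k)) UNIV"
    by (intro has_sum_finite_sum has_sum_cmult_left has_sum_cmult_right mmult_has_sum ab)
  then show "cmod (\<Sum>i\<in>I. \<Sum>k\<in>I. u i * (a \<star> b) i k * v k) \<le> K * L * l2 u I * l2 v I"
  proof (rule has_sum_norm_le)
    fix F :: "nat set" assume F: "finite F"
    define A where "A = (\<lambda>j. \<Sum>i\<in>I. u i * a i j)"
    define B where "B = (\<lambda>j. \<Sum>k\<in>I. b j k * v k)"
    have "(\<Sum>i\<in>I. \<Sum>k\<in>I. u i * (a i j * b j k) * v k) = A j * B j" for j
      by (simp add: A_def B_def sum_product mult_ac)
    then have "cmod (\<Sum>j\<in>F. \<Sum>i\<in>I. \<Sum>k\<in>I. u i * (a i j * b j k) * v k) = cmod (\<Sum>j\<in>F. A j * B j)"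
      by simp
    also have "\<dots> \<le> (\<Sum>j\<in>F. \<bar>cmod (A j)\<bar> * \<bar>cmod (B j)\<bar>)"
      by (rule order_trans[OF norm_sum]) (simp add: norm_mult)
    also have "\<dots> \<le> l2 A F * l2 B F" by (rule L2_set_mult_ineq)
    also have "\<dots> \<le> (K * l2 u I) * (L * l2 v I)"
      unfolding A_def B_def
      using mbound_apply_left[OF a I F] mbound_apply[OF b F I] mbound_nonneg[OF a]
      by (intro mult_mono) auto
    finally show "cmod (\<Sum>j\<in>F. \<Sum>i\<in>I. \<Sum>k\<in>I. u i * (a i j * b j k) * v k) \<le> K * L * l2 u I * l2 v I"
      by (simp add: mult_ac)
  qed
qed

text \<open>The bounds of a matrix form a closed half-line, so the infimum is attained.\<close>

lemma mbound_mnorm: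
  assumes "bmat a" shows "mbound a (mnorm a)"
proof -
  let ?S = "{K. mbound a K}"
  have ne: "?S \<noteq> {}" using assms by (auto simp: bmat_def)
  have bd: "bdd_below ?S" by (intro bdd_belowI[of _ 0]) (auto simp: mbound_nonneg)
  show ?thesis
  proof (rule mboundI)
    show "0 \<le> mnorm a" unfolding mnorm_def using ne by (intro cInf_greatest) (auto simp: mbound_nonneg)
    fix I :: "nat set" and u v :: "nat \<Rightarrow> complex"
    assume I: "finite I"
    let ?X = "cmod (\<Sum>i\<in>I. \<Sum>j\<in>I. u i * a i j * v j)" and ?c = "l2 u I * l2 v I"
    have le: "?X \<le> K * ?c" if "mbound a K" for K
      using mboundD[OF that I, of u v] by (simp only: mult.assoc)
    show "?X \<le> mnorm a * l2 u I * l2 v I"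
    proof (cases "?c = 0")
      case True then show ?thesis using le ne by (auto simp: mult.assoc)
    next
      case False
      then have c: "?c > 0" by (simp add: less_le)
      have "?X / ?c \<le> mnorm a" unfolding mnorm_def
        using ne le c by (intro cInf_greatest) (auto simp: divide_le_eq)
      then show ?thesis using c by (simp add: divide_le_eq mult.assoc)
    qed
  qed
qed

lemma mnorm_le: "mbound a K \<Longrightarrow> mnorm a \<le> K"
  unfolding mnorm_def by (intro cInf_lower bdd_belowI[of _ 0]) (auto simp: mbound_nonneg)

lemma bmatI: "mbound a K \<Longrightarrow> bmat a" by (auto simp: bmat_def)

lemma mnorm_le_iff: "bmat a \<Longrightarrow> mnorm a \<le> K \<longleftrightarrow> mbound a K"
  using mbound_mnorm mbound_mono mnorm_le by blast

lemma mnorm_nonneg: "bmat a \<Longrightarrow> 0 \<le> mnorm a"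
  using mbound_mnorm mbound_nonneg by blast

lemma bmat_zero: "bmat 0" using mbound_zero bmatI by blast
lemma bmat_one: "bmat mone" using mbound_one bmatI by blast
lemma bmat_add: "bmat a \<Longrightarrow> bmat b \<Longrightarrow> bmat (a + b)" unfolding bmat_def using mbound_add by blast
lemma bmat_diff: "bmat a \<Longrightarrow> bmat b \<Longrightarrow> bmat (a - b)" unfolding bmat_def using mbound_diff by blast
lemma bmat_uminus: "bmat a \<Longrightarrow> bmat (- a)" unfolding bmat_def using mbound_uminus by blast
lemma bmat_smult: "bmat a \<Longrightarrow> bmat (msmult c a)" unfolding bmat_def using mbound_smult by blast
lemma bmat_star: "bmat a \<Longrightarrow> bmat (mstar a)" unfolding bmat_def using mbound_star by blast
lemma bmat_mult: "bmat a \<Longrightarrow> bmat b \<Longrightarrow> bmat (a \<star> b)" unfolding bmat_def using mbound_mult by blast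

lemmas bmat_intros = bmat_zero bmat_one bmat_add bmat_diff bmat_uminus bmat_smult bmat_star bmat_mult

lemma mnorm_entry: "bmat a \<Longrightarrow> cmod (a i j) \<le> mnorm a"
  using mbound_entry mbound_mnorm by blast

lemma mnorm_eq_0_iff: "bmat a \<Longrightarrow> mnorm a = 0 \<longleftrightarrow> a = 0"
proof
  assume "bmat a" "mnorm a = 0"
  then have "cmod (a i j) \<le> 0" for i j using mnorm_entry by metis
  then show "a = 0" by (simp add: fun_eq_iff)
next
  assume "bmat a" "a = 0"
  then show "mnorm a = 0" using mnorm_le[OF mbound_zero] mnorm_nonneg[of a] by auto
qed

lemma mnorm_triangle: "bmat a \<Longrightarrow> bmat b \<Longrightarrow> mnorm (a + b) \<le> mnorm a + mnorm b"
  by (intro mnorm_le mbound_add mbound_mnorm)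

lemma mnorm_mult: "bmat a \<Longrightarrow> bmat b \<Longrightarrow> mnorm (a \<star> b) \<le> mnorm a * mnorm b"
  by (intro mnorm_le mbound_mult mbound_mnorm)

lemma mstar_mstar [simp]: "mstar (mstar a) = a"
  by (simp add: mstar_def)

lemma mnorm_star: "bmat a \<Longrightarrow> mnorm (mstar a) = mnorm a"
  by (metis antisym bmat_star mbound_mnorm mbound_star mnorm_le mstar_mstar)

lemma msmult_msmult: "msmult c (msmult d a) = msmult (c * d) a"
  by (simp add: msmult_def mult.assoc)

lemma msmult_one [simp]: "msmult 1 a = a"
  by (simp add: msmult_def)

lemma mnorm_smult: "bmat a \<Longrightarrow> mnorm (msmult c a) = cmod c * mnorm a"
proof (cases "c = 0")
  case True
  then have "msmult c a = 0" by (simp add: msmult_def fun_eq_iff)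
  then show ?thesis using True mnorm_eq_0_iff[OF bmat_zero] by simp
next
  case False
  assume a: "bmat a"
  have 1: "mnorm (msmult c a) \<le> cmod c * mnorm a" by (intro mnorm_le mbound_smult mbound_mnorm a)
  have "mnorm (msmult (inverse c) (msmult c a)) \<le> cmod (inverse c) * mnorm (msmult c a)"
    by (intro mnorm_le mbound_smult mbound_mnorm a bmat_smult)
  then have "mnorm a \<le> cmod (inverse c) * mnorm (msmult c a)"
    using False by (simp add: msmult_msmult)
  then have "cmod c * mnorm a \<le> cmod c * (cmod (inverse c) * mnorm (msmult c a))"
    by (rule mult_left_mono) simp
  also have "\<dots> = mnorm (msmult c a)" using False by (simp add: norm_inverse)
  finally have "cmod c * mnorm a \<le> mnorm (msmult c a)" .
  with 1 show ?thesis by simp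
qed

lemma mmult_eqI: "bmat a \<Longrightarrow> bmat b \<Longrightarrow> ((\<lambda>j. a i j * b j k) has_sum c) UNIV \<Longrightarrow> (a \<star> b) i k = c"
  using mmult_has_sum has_sum_unique by blast

lemma mmult_add_left: "bmat a \<Longrightarrow> bmat b \<Longrightarrow> bmat c \<Longrightarrow> (a + b) \<star> c = a \<star> c + b \<star> c"
  by (intro ext mmult_eqI) (auto intro!: bmat_intros has_sum_add mmult_has_sum simp: distrib_right)

lemma mmult_add_right: "bmat a \<Longrightarrow> bmat b \<Longrightarrow> bmat c \<Longrightarrow> c \<star> (a + b) = c \<star> a + c \<star> b"
  by (intro ext mmult_eqI) (auto intro!: bmat_intros has_sum_add mmult_has_sum simp: distrib_left)

lemma mmult_smult_left: "bmat a \<Longrightarrow> bmat b \<Longrightarrow> msmult c a \<star> b = msmult c (a \<star> b)"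
  by (intro ext mmult_eqI)
    (auto intro!: bmat_intros has_sum_cmult_right mmult_has_sum simp: msmult_apply mult.assoc)

lemma mmult_smult_right: "bmat a \<Longrightarrow> bmat b \<Longrightarrow> a \<star> msmult c b = msmult c (a \<star> b)"
  by (intro ext mmult_eqI)
    (auto intro!: bmat_intros has_sum_cmult_right mmult_has_sum simp: msmult_apply mult.left_commute)

lemma mmult_uminus_left: "bmat a \<Longrightarrow> bmat b \<Longrightarrow> (- a) \<star> b = - (a \<star> b)"
  using mmult_smult_left[of a b "-1"] by (simp add: msmult_minus_one)

lemma mmult_uminus_right: "bmat a \<Longrightarrow> bmat b \<Longrightarrow> a \<star> (- b) = - (a \<star> b)"
  using mmult_smult_right[of a b "-1"] by (simp add: msmult_minus_one)

lemma mmult_diff_left: "bmat a \<Longrightarrow> bmat b \<Longrightarrow> bmat c \<Longrightarrow> (a - b) \<star> c = a \<star> c - b \<star> c"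
  using mmult_add_left[of a "- b" c] by (simp add: bmat_intros mmult_uminus_left)

lemma mmult_diff_right: "bmat a \<Longrightarrow> bmat b \<Longrightarrow> bmat c \<Longrightarrow> c \<star> (a - b) = c \<star> a - c \<star> b"
  using mmult_add_right[of a "- b" c] by (simp add: bmat_intros mmult_uminus_right)

lemma mstar_mult: "bmat a \<Longrightarrow> bmat b \<Longrightarrow> mstar (a \<star> b) = mstar b \<star> mstar a"
  by (simp add: mstar_def mmult_def fun_eq_iff mult.commute flip: infsum_cnj)

lemma mmult_finite_left:
  assumes "finite J" "\<And>j. j \<notin> J \<Longrightarrow> a i j = 0"
  shows "(a \<star> b) i k = (\<Sum>j\<in>J. a i j * b j k)"
proof -
  have "(\<Sum>\<^sub>\<infinity>j. a i j * b j k) = (\<Sum>\<^sub>\<infinity>j\<in>J. a i j * b j k)"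
    using assms(2) by (intro infsum_cong_neutral) auto
  then show ?thesis using assms(1) by (simp add: mmult_def)
qed

lemma mmult_finite_right:
  assumes "finite J" "\<And>j. j \<notin> J \<Longrightarrow> b j k = 0"
  shows "(a \<star> b) i k = (\<Sum>j\<in>J. a i j * b j k)"
proof -
  have "(\<Sum>\<^sub>\<infinity>j. a i j * b j k) = (\<Sum>\<^sub>\<infinity>j\<in>J. a i j * b j k)"
    using assms(2) by (intro infsum_cong_neutral) auto
  then show ?thesis using assms(1) by (simp add: mmult_def)
qed

lemma mmult_one_left [simp]: "mone \<star> a = a"
  by (intro ext, subst mmult_finite_left[of "{_}"]) (auto simp: mone_def)

lemma mmult_one_right [simp]: "a \<star> mone = a"
  by (intro ext, subst mmult_finite_right[of "{_}"]) (auto simp: mone_def)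

text \<open>
  For a matrix with finite rows on the left and one with finite columns on the right, associativity
  is an exchange of a finite with an infinite sum.
\<close>

lemma mmult_assoc_finite:
  assumes b: "bmat a" "bmat b" "bmat c"
    and J: "finite J" "\<And>j. j \<notin> J \<Longrightarrow> a i j = 0" and K: "finite K" "\<And>k. k \<notin> K \<Longrightarrow> c k l = 0"
  shows "(a \<star> b \<star> c) i l = (a \<star> (b \<star> c)) i l"
proof -
  have "(a \<star> b \<star> c) i l = (\<Sum>k\<in>K. (a \<star> b) i k * c k l)"
    by (rule mmult_finite_right[where b = c and k = l, OF K])
  also have "\<dots> = (\<Sum>k\<in>K. \<Sum>j\<in>J. a i j * (b j k * c k l))"
    by (simp add: mmult_finite_left[where a = a and i = i, OF J] sum_distrib_right mult.assoc)
  also have "\<dots> = (\<Sum>j\<in>J. a i j * (b \<star> c) j l)"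
    by (subst sum.swap) (simp add: mmult_finite_right[where b = c and k = l, OF K] sum_distrib_left)
  also have "\<dots> = (a \<star> (b \<star> c)) i l"
    by (rule mmult_finite_left[where a = a and i = i, OF J, symmetric])
  finally show ?thesis .
qed

lemma tail_small:
  assumes "(\<lambda>j. (cmod (x j))\<^sup>2) summable_on UNIV" "\<epsilon> > 0"
  shows "\<exists>J. finite J \<and> (\<forall>F. finite F \<longrightarrow> F \<inter> J = {} \<longrightarrow> l2 x F \<le> \<epsilon>)"
proof -
  let ?f = "\<lambda>j. (cmod (x j))\<^sup>2"
  have hs: "(?f has_sum infsum ?f UNIV) UNIV" using assms(1) by simp
  obtain J where J: "finite J" "infsum ?f UNIV - sum ?f J < \<epsilon>\<^sup>2"
  proof -
    have "0 < \<epsilon>\<^sup>2 / 2" using assms(2) by simp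
    from has_sum_finite_approximation[OF hs this] obtain J where
      J: "finite J" "dist (sum ?f J) (infsum ?f UNIV) \<le> \<epsilon>\<^sup>2 / 2" by blast
    moreover have "\<epsilon>\<^sup>2 / 2 < \<epsilon>\<^sup>2" using assms(2) by simp
    ultimately have "infsum ?f UNIV - sum ?f J < \<epsilon>\<^sup>2" unfolding dist_real_def by linarith
    with J(1) show ?thesis by (rule that)
  qed
  show ?thesis
  proof (intro exI[of _ J] conjI allI impI)
    fix F :: "nat set" assume F: "finite F" "F \<inter> J = {}"
    have "sum ?f (F \<union> J) \<le> infsum ?f UNIV"
      by (rule finite_sum_le_has_sum[OF hs]) (use F J(1) in auto)
    then have "sum ?f F + sum ?f J \<le> infsum ?f UNIV"
      using F J(1) by (simp only: sum.union_disjoint)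
    then have "sum ?f F \<le> infsum ?f UNIV - sum ?f J" unfolding le_diff_eq .
    also have "\<dots> \<le> \<epsilon>\<^sup>2" using J(2) by (rule less_imp_le)
    finally have "(l2 x F)\<^sup>2 \<le> \<epsilon>\<^sup>2" by (subst l2_sq)
    then show "l2 x F \<le> \<epsilon>" by (rule power2_le_imp_le) (use assms(2) in simp)
  qed (fact J(1))
qed

lemma single_row_bound:
  assumes "K \<ge> 0" "\<And>i' j. i' \<noteq> i \<Longrightarrow> a i' j = 0" "\<And>F. finite F \<Longrightarrow> l2 (a i) F \<le> K"
  shows "mbound a K"
proof (rule mboundI_apply)
  fix I :: "nat set" and v :: "nat \<Rightarrow> complex"
  assume I: "finite I"
  have "l2 (\<lambda>i. \<Sum>j\<in>I. a i j * v j) I \<le> l2 (\<lambda>i. \<Sum>j\<in>I. a i j * v j) (insert i I)"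
    using I by (intro l2_mono) auto
  also have "\<dots> = cmod (\<Sum>j\<in>I. a i j * v j)"
  proof -
    have "(\<Sum>i'\<in>insert i I. (cmod (\<Sum>j\<in>I. a i' j * v j))\<^sup>2) = (\<Sum>i'\<in>{i}. (cmod (\<Sum>j\<in>I. a i' j * v j))\<^sup>2)"
      using I assms(2) by (intro sum.mono_neutral_right) auto
    then show ?thesis by (simp add: L2_set_def)
  qed
  also have "\<dots> \<le> (\<Sum>j\<in>I. \<bar>cmod (a i j)\<bar> * \<bar>cmod (v j)\<bar>)"
    by (rule order_trans[OF norm_sum]) (simp add: norm_mult)
  also have "\<dots> \<le> l2 (a i) I * l2 v I" by (rule L2_set_mult_ineq)
  also have "\<dots> \<le> K * l2 v I" by (rule mult_right_mono[OF assms(3)[OF I]]) simp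
  finally show "l2 (\<lambda>i. \<Sum>j\<in>I. a i j * v j) I \<le> K * l2 v I" .
qed (fact assms(1))

lemma single_column_bound:
  assumes "K \<ge> 0" "\<And>i j'. j' \<noteq> j \<Longrightarrow> a i j' = 0" "\<And>F. finite F \<Longrightarrow> l2 (\<lambda>i. a i j) F \<le> K"
  shows "mbound a K"
proof -
  have "mbound (mstar a) K"
    by (rule single_row_bound[of K j]) (auto simp: mstar_def assms)
  then show ?thesis using mbound_star[of "mstar a" K] by simp
qed

text \<open>
  An entry of a triple product depends on one row of the left and one column of the right factor,
  and both are limits of finitely supported ones in \<open>\<ell>\<^sup>2\<close>.
\<close>

lemma mmult_assoc:
  assumes "bmat a" "bmat b" "bmat c"
  shows "a \<star> b \<star> c = a \<star> (b \<star> c)"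
proof (intro ext)
  fix i l
  define a1 where "a1 = (\<lambda>i' j. if i' = i then a i j else 0)"
  define c1 where "c1 = (\<lambda>k l'. if l' = l then c k l else 0)"
  have row: "(a \<star> x) i k = (a1 \<star> x) i k" for x k by (simp add: mmult_def a1_def)
  have col: "(x \<star> c) k l = (x \<star> c1) k l" for x k by (simp add: mmult_def c1_def)
  have eq1: "(a \<star> b \<star> c) i l = (a1 \<star> b \<star> c1) i l"
    by (simp add: mmult_def a1_def c1_def)
  have eq2: "(a \<star> (b \<star> c)) i l = (a1 \<star> (b \<star> c1)) i l"
    by (simp add: mmult_def a1_def c1_def)
  obtain A where A: "mbound a A" using assms by (auto simp: bmat_def)
  obtain B where B: "mbound b B" using assms by (auto simp: bmat_def)
  obtain C where C: "mbound c C" using assms by (auto simp: bmat_def)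
  have A1: "mbound a1 A"
  proof (rule single_row_bound[of A i])
    show "l2 (a1 i) F \<le> A" if "finite F" for F
      using mbound_apply_left[OF A, of "{i}" F "\<lambda>_. 1"] that by (simp add: a1_def)
  qed (auto simp: a1_def mbound_nonneg[OF A])
  have C1: "mbound c1 C"
  proof (rule single_column_bound[of C l])
    show "l2 (\<lambda>k. c1 k l) F \<le> C" if "finite F" for F
      using mbound_apply[OF C that, of "{l}" "\<lambda>_. 1"] that by (simp add: c1_def)
  qed (auto simp: c1_def mbound_nonneg[OF C])
  have bm: "bmat a1" "bmat b" "bmat c1" using A1 C1 assms by (auto intro: bmatI)
  have "cmod ((a1 \<star> b \<star> c1) i l - (a1 \<star> (b \<star> c1)) i l) \<le> \<epsilon>" if "\<epsilon> > 0" for \<epsilon>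
  proof -
    have pos: "0 \<le> A" "0 \<le> B" "0 \<le> C" using A B C by (auto simp: mbound_nonneg)
    define \<delta> where "\<delta> = \<epsilon> / (2 * B * C + 2 * A * B + 1)"
    have D: "2 * B * C + 2 * A * B + 1 > 0" using pos by (simp add: add_nonneg_pos)
    have \<delta>: "\<delta> > 0" using that D by (simp add: \<delta>_def)
    obtain J where J: "finite J" "\<And>F. finite F \<Longrightarrow> F \<inter> J = {} \<Longrightarrow> l2 (a i) F \<le> \<delta>"
      using tail_small[OF row_summable[OF A] \<delta>] by blast
    obtain K where K: "finite K" "\<And>F. finite F \<Longrightarrow> F \<inter> K = {} \<Longrightarrow> l2 (\<lambda>k. c k l) F \<le> \<delta>"
      using tail_small[OF column_summable[OF C] \<delta>] by blast
    define a2 where "a2 = (\<lambda>i' j. if i' = i \<and> j \<in> J then a i j else 0)"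
    define c2 where "c2 = (\<lambda>k l'. if l' = l \<and> k \<in> K then c k l else 0)"
    have a12: "mbound (a1 - a2) \<delta>"
    proof (rule single_row_bound[of \<delta> i])
      fix F :: "nat set" assume F: "finite F"
      have "l2 ((a1 - a2) i) F = L2_set (\<lambda>j. cmod (if j \<in> F - J then a i j else 0)) F"
        by (intro L2_set_cong) (auto simp: a1_def a2_def)
      also have "\<dots> = l2 (a i) (F - J)" using F by (intro L2_set_extend) auto
      also have "\<dots> \<le> \<delta>" using F by (intro J) auto
      finally show "l2 ((a1 - a2) i) F \<le> \<delta>" .
    qed (use \<delta> in \<open>auto simp: a1_def a2_def\<close>)
    have c12: "mbound (c1 - c2) \<delta>"
    proof (rule single_column_bound[of \<delta> l])
      fix F :: "nat set" assume F: "finite F"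
      have "l2 (\<lambda>k. (c1 - c2) k l) F = L2_set (\<lambda>j. cmod (if j \<in> F - K then c j l else 0)) F"
        by (intro L2_set_cong) (auto simp: c1_def c2_def)
      also have "\<dots> = l2 (\<lambda>k. c k l) (F - K)" using F by (intro L2_set_extend) auto
      also have "\<dots> \<le> \<delta>" using F by (intro K) auto
      finally show "l2 (\<lambda>k. (c1 - c2) k l) F \<le> \<delta>" .
    qed (use \<delta> in \<open>auto simp: c1_def c2_def\<close>)
    have A2: "mbound a2 A"
    proof (rule single_row_bound[of A i])
      fix F :: "nat set" assume F: "finite F"
      have "l2 (a2 i) F \<le> l2 (a1 i) F" by (intro L2_set_mono) (auto simp: a1_def a2_def)
      also have "\<dots> \<le> A" using mbound_apply_left[OF A1, of "{i}" F "\<lambda>_. 1"] F by simp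
      finally show "l2 (a2 i) F \<le> A" .
    qed (auto simp: a2_def pos)
    have bm2: "bmat a2" "bmat (a1 - a2)" using A2 a12 by (auto intro: bmatI)
    have c2: "bmat c2" "bmat (c1 - c2)" using c12 bm(3) bmat_diff[of c1 "c1 - c2"] by (auto intro: bmatI)
    have ids: "a1 = a2 + (a1 - a2)" "c1 = c2 + (c1 - c2)" by simp_all
    have fin: "(a2 \<star> b \<star> c2) i l = (a2 \<star> (b \<star> c2)) i l"
      by (rule mmult_assoc_finite[OF bm2(1) bm(2) c2(1) J(1) _ K(1)]) (auto simp: a2_def c2_def)
    have e1: "a1 \<star> b \<star> c1 = (a1 - a2) \<star> b \<star> c1 + (a2 \<star> b \<star> (c1 - c2) + a2 \<star> b \<star> c2)"
      using bm bm2 c2 by (simp add: mmult_diff_left mmult_diff_right bmat_intros)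
    have e2: "a1 \<star> (b \<star> c1) = (a1 - a2) \<star> (b \<star> c1) + (a2 \<star> (b \<star> (c1 - c2)) + a2 \<star> (b \<star> c2))"
      using bm bm2 c2 by (simp add: mmult_diff_left mmult_diff_right bmat_intros)
    have "cmod ((a1 \<star> b \<star> c1) i l - (a1 \<star> (b \<star> c1)) i l)
      = cmod ((((a1 - a2) \<star> b \<star> c1) i l + (a2 \<star> b \<star> (c1 - c2)) i l)
         - (((a1 - a2) \<star> (b \<star> c1)) i l + (a2 \<star> (b \<star> (c1 - c2))) i l))"
      unfolding e1 e2 plus_fun_apply using fin by (simp add: algebra_simps)
    also have "\<dots> \<le> (\<delta> * B * C + A * B * \<delta>) + (\<delta> * (B * C) + A * (B * \<delta>))"
      by (intro order_trans[OF norm_triangle_ineq4] add_mono order_trans[OF norm_triangle_ineq]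
          mbound_entry mbound_mult a12 c12 A2 B C1)
    also have "\<dots> = \<delta> * (2 * B * C + 2 * A * B)" by (simp add: algebra_simps)
    also have "\<dots> \<le> \<delta> * (2 * B * C + 2 * A * B + 1)" using \<delta> by simp
    also have "\<dots> = \<epsilon>" using D by (simp add: \<delta>_def)
    finally show ?thesis .
  qed
  then have "cmod ((a1 \<star> b \<star> c1) i l - (a1 \<star> (b \<star> c1)) i l) \<le> 0"
    by (rule field_le_epsilon) simp
  then show "(a \<star> b \<star> c) i l = (a \<star> (b \<star> c)) i l"
    by (simp add: eq1 eq2)
qed

text \<open>
  The sum of \<open>|(a v)\<^sub>i|\<^sup>2\<close> over all rows is the value of the form of \<open>a\<^sup>* a\<close> at \<open>v\<close>, and a finite
  part of it is no larger.
\<close>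

lemma mnorm_cstar:
  assumes a: "bmat a" shows "mnorm (mstar a \<star> a) = (mnorm a)\<^sup>2"
proof (rule antisym)
  show "mnorm (mstar a \<star> a) \<le> (mnorm a)\<^sup>2"
    using mnorm_mult[of "mstar a" a] a by (simp add: bmat_star mnorm_star power2_eq_square)
  let ?N = "mnorm (mstar a \<star> a)"
  have N: "mbound (mstar a \<star> a) ?N" "0 \<le> ?N"
    by (auto intro!: mbound_mnorm mnorm_nonneg bmat_intros a)
  have "mbound a (sqrt ?N)"
  proof (rule mboundI_apply)
    fix I :: "nat set" and v :: "nat \<Rightarrow> complex"
    assume I: "finite I"
    let ?w = "\<lambda>i. \<Sum>j\<in>I. a i j * v j"
    let ?S = "\<Sum>j\<in>I. \<Sum>k\<in>I. cnj (v j) * (mstar a \<star> a) j k * v k"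
    have "((\<lambda>i. \<Sum>j\<in>I. \<Sum>k\<in>I. cnj (v j) * (mstar a j i * a i k) * v k) has_sum ?S) UNIV"
      by (intro has_sum_finite_sum has_sum_cmult_left has_sum_cmult_right mmult_has_sum bmat_intros a)
    also have "(\<lambda>i. \<Sum>j\<in>I. \<Sum>k\<in>I. cnj (v j) * (mstar a j i * a i k) * v k)
        = (\<lambda>i. of_real ((cmod (?w i))\<^sup>2))"
      unfolding cmod_square by (simp add: mstar_def sum_product mult_ac, rule ext, rule sum.swap)
    finally have hs: "((\<lambda>i. (cmod (?w i))\<^sup>2) has_sum Re ?S) UNIV"
      using has_sum_Re by fastforce
    have "(l2 ?w I)\<^sup>2 \<le> Re ?S"
      unfolding l2_sq by (rule finite_sum_le_has_sum[OF hs]) (auto simp: I)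
    also have "\<dots> \<le> cmod ?S" by (rule complex_Re_le_cmod)
    also have "\<dots> \<le> ?N * l2 (\<lambda>i. cnj (v i)) I * l2 v I"
      by (rule mbound_rect[OF N(1) I I])
    also have "\<dots> = (sqrt ?N * l2 v I)\<^sup>2"
      using N(2) by (simp add: power_mult_distrib power2_eq_square)
    finally show "l2 ?w I \<le> sqrt ?N * l2 v I"
      by (rule power2_le_imp_le) (use N(2) in simp)
  qed (use N in simp)
  then have "mnorm a \<le> sqrt ?N" by (rule mnorm_le)
  then have "(mnorm a)\<^sup>2 \<le> (sqrt ?N)\<^sup>2"
    using mnorm_nonneg[OF a] by (intro power_mono)
  then show "(mnorm a)\<^sup>2 \<le> ?N" using N(2) by simp
qed

lemma mbound_limit:
  assumes "\<And>m. m \<ge> N \<Longrightarrow> mbound (X m) K" "\<And>i j. (\<lambda>m. X m i j) \<longlonglongrightarrow> a i j"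
  shows "mbound a K"
proof (rule mboundI)
  show "0 \<le> K" using assms(1)[of N] mbound_nonneg by blast
  fix I :: "nat set" and u v :: "nat \<Rightarrow> complex"
  assume I: "finite I"
  have "(\<lambda>m. cmod (\<Sum>i\<in>I. \<Sum>j\<in>I. u i * X m i j * v j)) \<longlonglongrightarrow> cmod (\<Sum>i\<in>I. \<Sum>j\<in>I. u i * a i j * v j)"
    by (intro tendsto_intros assms(2))
  then show "cmod (\<Sum>i\<in>I. \<Sum>j\<in>I. u i * a i j * v j) \<le> K * l2 u I * l2 v I"
    by (rule LIMSEQ_le_const2) (intro exI[of _ N] allI impI mboundD[OF assms(1) I])
qed

text \<open>
  Norm-Cauchy sequences converge entrywise, and bounds survive entrywise limits, so that the
  entrywise limit is a limit in norm.
\<close>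

lemma bmat_complete:
  assumes X: "\<And>n. bmat (X n)"
    and C: "\<And>\<epsilon>. \<epsilon> > 0 \<Longrightarrow> \<exists>N. \<forall>m n. N \<le> m \<longrightarrow> N \<le> n \<longrightarrow> mnorm (X m - X n) < \<epsilon>"
  shows "\<exists>a. bmat a \<and> (\<forall>i j. (\<lambda>n. X n i j) \<longlonglongrightarrow> a i j) \<and> (\<forall>\<epsilon>>0. \<exists>N. \<forall>n\<ge>N. mnorm (X n - a) < \<epsilon>)"
proof -
  have "Cauchy (\<lambda>n. X n i j)" for i j
  proof (rule CauchyI)
    fix e :: real assume "e > 0"
    then obtain N where N: "\<forall>m n. N \<le> m \<longrightarrow> N \<le> n \<longrightarrow> mnorm (X m - X n) < e" using C by blast
    have "cmod (X m i j - X n i j) < e" if "N \<le> m" "N \<le> n" for m n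
      using mnorm_entry[OF bmat_diff[OF X[of m] X[of n]], of i j] N[rule_format, OF that] by simp
    then show "\<exists>M. \<forall>m\<ge>M. \<forall>n\<ge>M. cmod (X m i j - X n i j) < e" by blast
  qed
  then have "\<forall>i j. \<exists>l. (\<lambda>n. X n i j) \<longlonglongrightarrow> l" by (simp add: Cauchy_convergent_iff convergent_def)
  then obtain a where a: "(\<lambda>n. X n i j) \<longlonglongrightarrow> a i j" for i j by metis
  have lim: "\<exists>N. \<forall>n\<ge>N. mbound (X n - a) \<epsilon>" if e: "\<epsilon> > 0" for \<epsilon>
  proof -
    obtain N where N: "\<forall>m n. N \<le> m \<longrightarrow> N \<le> n \<longrightarrow> mnorm (X m - X n) < \<epsilon>" using C[OF e] by blast
    have "mbound (X n - a) \<epsilon>" if "n \<ge> N" for n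
    proof (rule mbound_limit[of N "\<lambda>m. X n - X m"])
      show "mbound (X n - X m) \<epsilon>" if "m \<ge> N" for m
        using N that \<open>n \<ge> N\<close> by (intro mbound_mono[OF mbound_mnorm]) (auto intro!: bmat_intros X less_imp_le)
      show "(\<lambda>m. (X n - X m) i j) \<longlonglongrightarrow> (X n - a) i j" for i j
        by (simp, intro tendsto_intros a)
    qed
    then show ?thesis by blast
  qed
  obtain N where "mbound (X N - a) 1" using lim[of 1] by auto
  then have "bmat (X N - (X N - a))" by (intro bmat_diff X bmatI)
  then have "bmat a" by simp
  moreover have "\<exists>N. \<forall>n\<ge>N. mnorm (X n - a) < \<epsilon>" if e: "\<epsilon> > 0" for \<epsilon>
  proof -
    obtain N where "\<forall>n\<ge>N. mbound (X n - a) (\<epsilon> / 2)" using lim[of "\<epsilon> / 2"] e by auto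
    then have "\<forall>n\<ge>N. mnorm (X n - a) \<le> \<epsilon> / 2" using mnorm_le by blast
    moreover have "\<epsilon> / 2 < \<epsilon>" using e by simp
    ultimately show ?thesis by (meson le_less_trans)
  qed
  ultimately show ?thesis using a by blast
qed

section \<open>C*-algebras of matrices\<close>

text \<open>
  Both the algebra and its Hilbert spaces of column vectors are spaces of this kind, so that
  completeness is proved once.
\<close>

locale matrix_space =
  fixes V :: "(complex, cmat, 'm) module_scheme" (structure)
  assumes add_eq: "add V = (+)" and zero_eq: "zero V = 0" and smult_eq: "smult V = msmult"
    and bounded: "x \<in> carrier V \<Longrightarrow> bmat x"
    and zero_in: "0 \<in> carrier V"
    and add_in: "x \<in> carrier V \<Longrightarrow> y \<in> carrier V \<Longrightarrow> x + y \<in> carrier V"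
    and smult_in: "x \<in> carrier V \<Longrightarrow> msmult c x \<in> carrier V"
    and limit_in: "bmat x \<Longrightarrow> (\<And>\<epsilon>. \<epsilon> > 0 \<Longrightarrow> \<exists>y\<in>carrier V. mbound (x - y) \<epsilon>) \<Longrightarrow> x \<in> carrier V"
begin

lemma uminus_in: "x \<in> carrier V \<Longrightarrow> - x \<in> carrier V"
  using smult_in[of x "-1"] by (simp add: msmult_minus_one)

lemma diff_in: "x \<in> carrier V \<Longrightarrow> y \<in> carrier V \<Longrightarrow> x - y \<in> carrier V"
  using add_in[of x "- y"] by (simp add: uminus_in)

lemma abelian_group_V: "abelian_group V"
proof (rule abelian_groupI)
  show "\<exists>y\<in>carrier V. y \<oplus> x = \<zero>" if "x \<in> carrier V" for x
    using uminus_in[OF that] by (intro bexI[of _ "- x"]) (auto simp: add_eq zero_eq)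
qed (auto simp: add_eq zero_eq zero_in add_in add_ac)

lemma module_V: "Module.module complex_ring V"
proof (rule moduleI[OF cring_complex_ring abelian_group_V])
qed (auto simp: complex_ring_def add_eq smult_eq smult_in msmult_apply fun_eq_iff algebra_simps)

lemma a_inv_V: "x \<in> carrier V \<Longrightarrow> \<ominus> x = - x"
proof -
  interpret abelian_group V by (rule abelian_group_V)
  assume "x \<in> carrier V"
  then show ?thesis by (intro minus_equality) (auto simp: add_eq zero_eq uminus_in)
qed

lemma a_minus_V: "x \<in> carrier V \<Longrightarrow> y \<in> carrier V \<Longrightarrow> x \<ominus> y = x - y"
  by (simp add: a_minus_def a_inv_V add_eq)

lemma normed_space_V: "complex_normed_space V mnorm"
proof (intro complex_normed_space.intro module_V complex_normed_space_axioms.intro)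
qed (auto simp: add_eq zero_eq smult_eq bounded mnorm_nonneg mnorm_eq_0_iff mnorm_triangle mnorm_smult)

lemma norm_dist_V: "x \<in> carrier V \<Longrightarrow> y \<in> carrier V \<Longrightarrow> norm_dist V mnorm x y = mnorm (x - y)"
  by (simp add: norm_dist_def a_minus_V)

lemma complete_V: "Metric_space.mcomplete (carrier V) (norm_dist V mnorm)"
proof -
  interpret Metric_space "carrier V" "norm_dist V mnorm"
    by (rule complex_normed_space.Metric_space_norm_dist[OF normed_space_V])
  show ?thesis
    unfolding mcomplete_def
  proof (intro allI impI)
    fix X assume X: "MCauchy X"
    then have in_V: "X k \<in> carrier V" for k by (auto simp: MCauchy_def)
    have C: "\<exists>N. \<forall>m n. N \<le> m \<longrightarrow> N \<le> n \<longrightarrow> mnorm (X m - X n) < \<epsilon>" if "\<epsilon> > 0" for \<epsilon>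
      using X that unfolding MCauchy_def by (simp add: norm_dist_V in_V)
    obtain a where a: "bmat a" "\<forall>\<epsilon>>0. \<exists>N. \<forall>n\<ge>N. mnorm (X n - a) < \<epsilon>"
      using bmat_complete[of X] C bounded[OF in_V] by blast
    have "a \<in> carrier V"
    proof (rule limit_in[OF a(1)])
      fix \<epsilon> :: real assume "\<epsilon> > 0"
      then obtain N where "mnorm (X N - a) < \<epsilon>" using a(2) by blast
      then have "mbound (X N - a) \<epsilon>"
        using mnorm_le_iff[of "X N - a" \<epsilon>] bounded[OF in_V] a(1) by (simp add: bmat_diff)
      then show "\<exists>y\<in>carrier V. mbound (a - y) \<epsilon>"
        using in_V mbound_minus_commute by blast
    qed
    then show "\<exists>x. limitin mtopology X x sequentially"
      using a(2) by (intro exI[of _ a]) (simp add: limit_metric_sequentially in_V norm_dist_V)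
  qed
qed

lemma closure_of_V: "S \<subseteq> carrier V \<Longrightarrow>
    Abstract_Topology.closure_of (norm_topology V mnorm) S = {x \<in> carrier V. \<forall>\<epsilon>>0. \<exists>y\<in>S. mbound (x - y) \<epsilon>}"
proof -
  interpret Metric_space "carrier V" "norm_dist V mnorm"
    by (rule complex_normed_space.Metric_space_norm_dist[OF normed_space_V])
  assume S: "S \<subseteq> carrier V"
  have "y \<in> mcball x r \<longleftrightarrow> mbound (x - y) r" if "x \<in> carrier V" "y \<in> S" for x y r
    using that S by (auto simp: norm_dist_V mnorm_le_iff bmat_diff bounded)
  then show ?thesis
    unfolding norm_topology_def metric_closure_of_alt by blast
qed

lemma closedin_V: "closedin (norm_topology V mnorm) S \<longleftrightarrow>
    S \<subseteq> carrier V \<and> (\<forall>x\<in>carrier V. (\<forall>\<epsilon>>0. \<exists>y\<in>S. mbound (x - y) \<epsilon>) \<longrightarrow> x \<in> S)"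
proof -
  interpret Metric_space "carrier V" "norm_dist V mnorm"
    by (rule complex_normed_space.Metric_space_norm_dist[OF normed_space_V])
  have "topspace (norm_topology V mnorm) = carrier V" by (simp add: norm_topology_def)
  then have "closedin (norm_topology V mnorm) S \<longleftrightarrow>
      S \<subseteq> carrier V \<and> Abstract_Topology.closure_of (norm_topology V mnorm) S \<subseteq> S"
    using closure_of_subset_eq[of S "norm_topology V mnorm"] by simp
  also have "\<dots> \<longleftrightarrow> S \<subseteq> carrier V \<and> {x \<in> carrier V. \<forall>\<epsilon>>0. \<exists>y\<in>S. mbound (x - y) \<epsilon>} \<subseteq> S"
    by (rule conj_cong[OF refl]) (simp only: closure_of_V)
  finally show ?thesis by (simp only: subset_iff mem_Collect_eq Ball_def) blast
qed

lemma submodule_V: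
  assumes "W \<subseteq> carrier V" "0 \<in> W" "\<And>x y. x \<in> W \<Longrightarrow> y \<in> W \<Longrightarrow> x + y \<in> W"
    "\<And>c x. x \<in> W \<Longrightarrow> msmult c x \<in> W"
  shows "submodule W complex_ring V"
proof (rule Module.module.submoduleI[OF module_V])
  show "\<ominus> x \<in> W" if "x \<in> W" for x
  proof -
    have "\<ominus> x = msmult (-1) x" using that assms(1) by (auto simp: a_inv_V msmult_minus_one)
    then show ?thesis using assms(4)[OF that] by simp
  qed
qed (use assms in \<open>auto simp: add_eq zero_eq smult_eq\<close>)

lemma submoduleD:
  assumes "submodule W complex_ring V"
  shows "W \<subseteq> carrier V" "0 \<in> W" "\<And>x y. x \<in> W \<Longrightarrow> y \<in> W \<Longrightarrow> x + y \<in> W"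
    "\<And>c x. x \<in> W \<Longrightarrow> msmult c x \<in> W"
proof -
  interpret submodule W complex_ring V by (rule assms)
  show "W \<subseteq> carrier V" "0 \<in> W" "\<And>x y. x \<in> W \<Longrightarrow> y \<in> W \<Longrightarrow> x + y \<in> W"
    using subset one_closed m_closed by (auto simp: add_eq zero_eq)
  show "\<And>c x. x \<in> W \<Longrightarrow> msmult c x \<in> W"
    using smult_closed by (auto simp: complex_ring_def smult_eq)
qed

lemma finsum_V:
  "finite T \<Longrightarrow> (\<And>s. s \<in> T \<Longrightarrow> f s \<in> carrier V) \<Longrightarrow> finsum V f T = (\<Sum>s\<in>T. f s)"
proof (induction T rule: finite_induct)
  interpret abelian_group V by (rule abelian_group_V)
  case empty show ?case by (simp add: zero_eq)
next
  interpret abelian_group V by (rule abelian_group_V)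
  case (insert s T)
  then show ?case by (subst finsum_insert) (auto simp: add_eq Pi_def)
qed

end

definition mclosure :: "cmat set \<Rightarrow> cmat set" where
  "mclosure S = {a. bmat a \<and> (\<forall>\<epsilon>>0. \<exists>b\<in>S. mbound (a - b) \<epsilon>)}"

lemma mclosureD: "a \<in> mclosure S \<Longrightarrow> \<epsilon> > 0 \<Longrightarrow> \<exists>b\<in>S. mbound (a - b) \<epsilon>"
  by (simp add: mclosure_def)

lemma mclosure_bmat: "a \<in> mclosure S \<Longrightarrow> bmat a"
  by (simp add: mclosure_def)

lemma mclosure_subset: "(\<And>b. b \<in> S \<Longrightarrow> bmat b) \<Longrightarrow> S \<subseteq> mclosure S"
proof
  fix b assume *: "\<And>b. b \<in> S \<Longrightarrow> bmat b" "b \<in> S"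
  have "mbound (b - b) \<epsilon>" if "\<epsilon> > 0" for \<epsilon> using mbound_mono[OF mbound_zero, of \<epsilon>] that by simp
  then show "b \<in> mclosure S" unfolding mclosure_def using * by blast
qed

lemma mclosure_mono: "S \<subseteq> T \<Longrightarrow> mclosure S \<subseteq> mclosure T"
  unfolding mclosure_def by blast

lemma mclosure_limit:
  assumes "bmat a" "\<And>\<epsilon>. \<epsilon> > 0 \<Longrightarrow> \<exists>b\<in>mclosure S. mbound (a - b) \<epsilon>"
  shows "a \<in> mclosure S"
  unfolding mclosure_def
proof (intro CollectI conjI allI impI)
  fix \<epsilon> :: real assume "\<epsilon> > 0"
  then have e: "\<epsilon> / 2 > 0" by simp
  obtain b where b: "b \<in> mclosure S" "mbound (a - b) (\<epsilon> / 2)" using assms(2)[OF e] by blast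
  obtain c where c: "c \<in> S" "mbound (b - c) (\<epsilon> / 2)" using mclosureD[OF b(1) e] by blast
  have "mbound (a - c) \<epsilon>" using mbound_add[OF b(2) c(2)] by simp
  then show "\<exists>b\<in>S. mbound (a - b) \<epsilon>" using c(1) by blast
qed (fact assms(1))

lemma mclosure_linear_image:
  assumes f: "\<And>x y. f (x - y) = f x - f y" "\<And>x K. mbound x K \<Longrightarrow> mbound (f x) (C * K)"
    and S: "\<And>x. x \<in> S \<Longrightarrow> f x \<in> T" and a: "a \<in> mclosure S"
  shows "f a \<in> mclosure T"
  unfolding mclosure_def
proof (intro CollectI conjI allI impI)
  show "bmat (f a)" using mclosure_bmat[OF a] f(2) by (auto simp: bmat_def)
  fix \<epsilon> :: real assume e: "\<epsilon> > 0"
  define \<delta> where "\<delta> = \<epsilon> / (\<bar>C\<bar> + 1)"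
  have \<delta>: "\<delta> > 0" using e by (simp add: \<delta>_def add_nonneg_pos)
  obtain b where b: "b \<in> S" "mbound (a - b) \<delta>" using mclosureD[OF a \<delta>] by blast
  have "C * \<delta> \<le> (\<bar>C\<bar> + 1) * \<delta>" using \<delta> by (intro mult_right_mono) auto
  also have "\<dots> = \<epsilon>" by (simp add: \<delta>_def)
  finally have "mbound (f a - f b) \<epsilon>" using mbound_mono[OF f(2)[OF b(2)]] by (simp add: f(1))
  then show "\<exists>b\<in>T. mbound (f a - b) \<epsilon>" using S[OF b(1)] by blast
qed

lemma mclosure_add:
  assumes S: "\<And>x y. x \<in> S \<Longrightarrow> y \<in> S \<Longrightarrow> x + y \<in> S" and a: "a \<in> mclosure S" "b \<in> mclosure S"
  shows "a + b \<in> mclosure S"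
  unfolding mclosure_def
proof (intro CollectI conjI allI impI)
  show "bmat (a + b)" using a by (intro bmat_add mclosure_bmat)
  fix \<epsilon> :: real assume "\<epsilon> > 0"
  then have e: "\<epsilon> / 2 > 0" by simp
  obtain x where x: "x \<in> S" "mbound (a - x) (\<epsilon> / 2)" using mclosureD[OF a(1) e] by blast
  obtain y where y: "y \<in> S" "mbound (b - y) (\<epsilon> / 2)" using mclosureD[OF a(2) e] by blast
  have "mbound ((a + b) - (x + y)) \<epsilon>" using mbound_add[OF x(2) y(2)] by (simp add: algebra_simps)
  then show "\<exists>b'\<in>S. mbound (a + b - b') \<epsilon>" using S[OF x(1) y(1)] by blast
qed

text \<open>
  From \<open>a b - x y = (a - x) b + x (b - y)\<close>: first choose \<open>x\<close> depending on a bound of \<open>b\<close>, then \<open>y\<close>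
  depending on a bound of \<open>x\<close>.
\<close>

lemma mclosure_mult:
  assumes S: "\<And>x y. x \<in> S \<Longrightarrow> y \<in> T \<Longrightarrow> x \<star> y \<in> U"
    and bm: "\<And>x. x \<in> S \<Longrightarrow> bmat x" "\<And>x. x \<in> T \<Longrightarrow> bmat x"
    and a: "a \<in> mclosure S" and b: "b \<in> mclosure T"
  shows "a \<star> b \<in> mclosure U"
  unfolding mclosure_def
proof (intro CollectI conjI allI impI)
  have ab: "bmat a" "bmat b" using a b by (auto intro: mclosure_bmat)
  then show "bmat (a \<star> b)" by (rule bmat_mult)
  fix \<epsilon> :: real assume e: "\<epsilon> > 0"
  obtain B where B: "mbound b B" using ab by (auto simp: bmat_def)
  define \<delta> where "\<delta> = \<epsilon> / 2 / (B + 1)"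
  have B0: "B + 1 > 0" using mbound_nonneg[OF B] by simp
  have \<delta>: "\<delta> > 0" using e B0 by (simp add: \<delta>_def)
  obtain x where x: "x \<in> S" "mbound (a - x) \<delta>" using mclosureD[OF a \<delta>] by blast
  obtain X where X: "mbound x X" using bm(1)[OF x(1)] by (auto simp: bmat_def)
  define \<gamma> where "\<gamma> = \<epsilon> / 2 / (X + 1)"
  have X0: "X + 1 > 0" using mbound_nonneg[OF X] by simp
  have \<gamma>: "\<gamma> > 0" using e X0 by (simp add: \<gamma>_def)
  obtain y where y: "y \<in> T" "mbound (b - y) \<gamma>" using mclosureD[OF b \<gamma>] by blast
  have eq: "a \<star> b - x \<star> y = (a - x) \<star> b + x \<star> (b - y)"
    using ab bm(1)[OF x(1)] bm(2)[OF y(1)] by (simp add: mmult_diff_left mmult_diff_right)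
  have "\<delta> * B \<le> \<delta> * (B + 1)" using \<delta> by simp
  also have "\<dots> = \<epsilon> / 2" unfolding \<delta>_def using B0 nonzero_eq_divide_eq[of "B + 1"] by (metis less_irrefl)
  finally have 1: "\<delta> * B \<le> \<epsilon> / 2" .
  have "X * \<gamma> \<le> (X + 1) * \<gamma>" using \<gamma> by simp
  also have "\<dots> = \<epsilon> / 2" unfolding \<gamma>_def using X0 nonzero_eq_divide_eq[of "X + 1"] by (metis less_irrefl mult.commute)
  finally have 2: "\<delta> * B + X * \<gamma> \<le> \<epsilon>" using 1 by simp
  have "mbound (a \<star> b - x \<star> y) \<epsilon>"
    unfolding eq by (rule mbound_mono[OF mbound_add[OF mbound_mult[OF x(2) B] mbound_mult[OF X y(2)]] 2])
  then show "\<exists>c\<in>U. mbound (a \<star> b - c) \<epsilon>" using S[OF x(1) y(1)] by blast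
qed

lemma mstar_diff: "mstar (x - y) = mstar x - mstar y"
  by (simp add: mstar_def fun_eq_iff)

lemma mclosure_star: "(\<And>x. x \<in> S \<Longrightarrow> mstar x \<in> T) \<Longrightarrow> a \<in> mclosure S \<Longrightarrow> mstar a \<in> mclosure T"
  by (rule mclosure_linear_image[where f = "mstar" and C = 1 and S = S]) (auto simp: mstar_diff mbound_star)

lemma mclosure_smult: "(\<And>x. x \<in> S \<Longrightarrow> msmult c x \<in> T) \<Longrightarrow> a \<in> mclosure S \<Longrightarrow> msmult c a \<in> mclosure T"
  by (rule mclosure_linear_image[where f = "msmult c" and C = "cmod c" and S = S])
    (auto simp: msmult_apply fun_eq_iff right_diff_distrib mbound_smult)

text \<open>Conjugation by the unitary that permutes the basis vectors along \<open>\<tau>\<close>.\<close>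

definition mconj :: "(nat \<Rightarrow> nat) \<Rightarrow> cmat \<Rightarrow> cmat" where
  "mconj \<tau> a = (\<lambda>i j. a (\<tau> i) (\<tau> j))"

lemma mconj_apply: "mconj \<tau> a i j = a (\<tau> i) (\<tau> j)"
  by (simp add: mconj_def)

lemma mbound_conj:
  assumes \<tau>: "bij \<tau>" and a: "mbound a K"
  shows "mbound (mconj \<tau> a) K"
proof (rule mboundI)
  fix I :: "nat set" and u v :: "nat \<Rightarrow> complex"
  assume I: "finite I"
  have inj: "inj \<tau>" using \<tau> by (rule bij_is_inj)
  then have inj_I: "inj_on \<tau> I" by (rule inj_on_subset) simp
  let ?u = "u \<circ> inv_into UNIV \<tau>" and ?v = "v \<circ> inv_into UNIV \<tau>"
  have e: "(\<Sum>i\<in>I. \<Sum>j\<in>I. u i * mconj \<tau> a i j * v j) = (\<Sum>i\<in>\<tau> ` I. \<Sum>j\<in>\<tau> ` I. ?u i * a i j * ?v j)"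
    by (simp add: sum.reindex[OF inj_I] mconj_apply inv_f_f[OF inj])
  have l: "l2 (w \<circ> inv_into UNIV \<tau>) (\<tau> ` I) = l2 w I" for w
    by (simp add: L2_set_def sum.reindex[OF inj_I] inv_f_f[OF inj])
  have "cmod (\<Sum>i\<in>\<tau> ` I. \<Sum>j\<in>\<tau> ` I. ?u i * a i j * ?v j) \<le> K * l2 ?u (\<tau> ` I) * l2 ?v (\<tau> ` I)"
    by (rule mboundD[OF a, where u = ?u and v = ?v]) (use I in simp)
  then show "cmod (\<Sum>i\<in>I. \<Sum>j\<in>I. u i * mconj \<tau> a i j * v j) \<le> K * l2 u I * l2 v I"
    unfolding e l .
qed (rule mbound_nonneg[OF a])

lemma mconj_diff: "mconj \<tau> (x - y) = mconj \<tau> x - mconj \<tau> y"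
  by (simp add: mconj_def fun_eq_iff)

lemma mconj_add: "mconj \<tau> (x + y) = mconj \<tau> x + mconj \<tau> y"
  by (simp add: mconj_def fun_eq_iff)

lemma mconj_smult: "mconj \<tau> (msmult c x) = msmult c (mconj \<tau> x)"
  by (simp add: mconj_def msmult_def)

lemma mconj_star: "mconj \<tau> (mstar x) = mstar (mconj \<tau> x)"
  by (simp add: mconj_def mstar_def)

lemma mconj_one: "bij \<tau> \<Longrightarrow> mconj \<tau> mone = mone"
  by (simp add: mconj_def mone_def fun_eq_iff bij_is_inj inj_eq)

lemma mconj_mult:
  assumes "bij \<tau>" shows "mconj \<tau> (x \<star> y) = mconj \<tau> x \<star> mconj \<tau> y"
proof (intro ext)
  fix i k
  show "mconj \<tau> (x \<star> y) i k = (mconj \<tau> x \<star> mconj \<tau> y) i k"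
    unfolding mconj_apply mmult_def
    using infsum_reindex_bij_betw[of \<tau> UNIV UNIV "\<lambda>j. x (\<tau> i) j * y j (\<tau> k)"] assms by simp
qed

lemma mconj_mconj: "mconj \<sigma> (mconj \<tau> x) = mconj (\<tau> \<circ> \<sigma>) x"
  by (simp add: mconj_def)

lemma mclosure_conj:
  "bij \<tau> \<Longrightarrow> (\<And>x. x \<in> S \<Longrightarrow> mconj \<tau> x \<in> T) \<Longrightarrow> a \<in> mclosure S \<Longrightarrow> mconj \<tau> a \<in> mclosure T"
  by (rule mclosure_linear_image[where f = "mconj \<tau>" and C = 1 and S = S]) (auto simp: mconj_diff mbound_conj)

definition matrix_cstar :: "cmat set \<Rightarrow> cmat cstar" where
  "matrix_cstar S = \<lparr>carrier = mclosure S, monoid.mult = mmult, one = mone, zero = 0, add = (+),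
     smult = msmult, star = mstar, cnorm = mnorm\<rparr>"

lemma matrix_cstar_simps [simp]:
  "carrier (matrix_cstar S) = mclosure S" "monoid.mult (matrix_cstar S) = mmult"
  "one (matrix_cstar S) = mone" "zero (matrix_cstar S) = 0" "add (matrix_cstar S) = (+)"
  "smult (matrix_cstar S) = msmult" "star (matrix_cstar S) = mstar" "cnorm (matrix_cstar S) = mnorm"
  by (simp_all add: matrix_cstar_def)

locale matrix_star_algebra =
  fixes S :: "cmat set"
  assumes bmat: "a \<in> S \<Longrightarrow> bmat a"
    and one_in: "mone \<in> S"
    and add_in: "a \<in> S \<Longrightarrow> b \<in> S \<Longrightarrow> a + b \<in> S"
    and smult_in: "a \<in> S \<Longrightarrow> msmult c a \<in> S"
    and mult_in: "a \<in> S \<Longrightarrow> b \<in> S \<Longrightarrow> a \<star> b \<in> S"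
    and star_in: "a \<in> S \<Longrightarrow> mstar a \<in> S"
begin

abbreviation A :: "cmat cstar" where "A \<equiv> matrix_cstar S"

lemma S_subset: "S \<subseteq> mclosure S"
  by (rule mclosure_subset) (rule bmat)

lemma zero_in: "0 \<in> S"
proof -
  have "msmult 0 mone = 0" by (simp add: msmult_def fun_eq_iff)
  then show ?thesis using smult_in[OF one_in, of 0] by simp
qed

lemma matrix_space_A: "matrix_space A"
proof
  fix x y c
  show "0 \<in> carrier A" using zero_in S_subset by auto
  show "x + y \<in> carrier A" if "x \<in> carrier A" "y \<in> carrier A"
    using that mclosure_add[of S] add_in by auto
  show "msmult c x \<in> carrier A" if "x \<in> carrier A"
    using that mclosure_smult[of S] smult_in by auto
qed (auto intro: mclosure_bmat mclosure_limit)

sublocale A: matrix_space A by (rule matrix_space_A)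

lemma mult_in_A: "a \<in> mclosure S \<Longrightarrow> b \<in> mclosure S \<Longrightarrow> a \<star> b \<in> mclosure S"
  by (rule mclosure_mult[OF mult_in]) (auto simp: bmat)

lemma star_in_A: "a \<in> mclosure S \<Longrightarrow> mstar a \<in> mclosure S"
  by (rule mclosure_star[OF star_in])

lemma one_in_A: "mone \<in> mclosure S"
  using S_subset one_in by blast

lemma ring_A: "ring A"
proof (rule ringI[OF A.abelian_group_V])
  show "monoid A"
    by (rule monoidI) (auto simp: mult_in_A one_in_A mmult_assoc mclosure_bmat)
qed (auto simp: mmult_add_left mmult_add_right mclosure_bmat)

lemma unital_cstar_algebra_A: "unital_cstar_algebra A"
proof (intro unital_cstar_algebra.intro ring_A unital_cstar_algebra_axioms.intro)
  show "complex_normed_space A (cnorm A)" using A.normed_space_V by simp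
  show "Metric_space.mcomplete (carrier A) (norm_dist A (cnorm A))"
    using A.complete_V by (simp only: matrix_cstar_simps)
qed (auto simp: mclosure_bmat mmult_smult_left mmult_smult_right mnorm_mult star_in_A mstar_mult mnorm_cstar,
    auto simp: mstar_def msmult_def fun_eq_iff)

lemma ideal_A:
  assumes "I \<subseteq> mclosure S" "0 \<in> I" "\<And>x y. x \<in> I \<Longrightarrow> y \<in> I \<Longrightarrow> x + y \<in> I"
    and l: "\<And>a x. a \<in> mclosure S \<Longrightarrow> x \<in> I \<Longrightarrow> a \<star> x \<in> I"
    and r: "\<And>a x. a \<in> mclosure S \<Longrightarrow> x \<in> I \<Longrightarrow> x \<star> a \<in> I"
  shows "ideal I A"
proof (rule idealI[OF ring_A])
  have "msmult c x \<in> I" if "x \<in> I" for c x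
  proof -
    have "msmult c mone \<in> mclosure S" using A.smult_in[of mone c] one_in_A by simp
    moreover have "msmult c mone \<star> x = msmult c x"
      using that assms(1) by (subst mmult_smult_left) (auto intro: mclosure_bmat bmat_one)
    ultimately show ?thesis using l[of "msmult c mone" x] that by simp
  qed
  then have "submodule I complex_ring A" using assms by (intro A.submodule_V) auto
  then show "subgroup I (add_monoid A)" by (simp add: submodule_def)
qed (use l r in auto)

lemma idealD:
  assumes "ideal I A"
  shows "I \<subseteq> mclosure S" "0 \<in> I" "\<And>x y. x \<in> I \<Longrightarrow> y \<in> I \<Longrightarrow> x + y \<in> I"
    "\<And>x y. x \<in> I \<Longrightarrow> y \<in> I \<Longrightarrow> x - y \<in> I"
    "\<And>a x. a \<in> mclosure S \<Longrightarrow> x \<in> I \<Longrightarrow> a \<star> x \<in> I"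
    "\<And>a x. a \<in> mclosure S \<Longrightarrow> x \<in> I \<Longrightarrow> x \<star> a \<in> I"
    "\<And>c x. x \<in> I \<Longrightarrow> msmult c x \<in> I"
proof -
  interpret ideal I A by (rule assms)
  show sub: "I \<subseteq> mclosure S" using a_subset by simp
  show "0 \<in> I" using additive_subgroup.zero_closed[OF additive_subgroup_axioms] by simp
  show add: "\<And>x y. x \<in> I \<Longrightarrow> y \<in> I \<Longrightarrow> x + y \<in> I" using additive_subgroup.a_closed[OF additive_subgroup_axioms] by simp
  show l: "\<And>a x. a \<in> mclosure S \<Longrightarrow> x \<in> I \<Longrightarrow> a \<star> x \<in> I" using I_l_closed by simp
  show "\<And>a x. a \<in> mclosure S \<Longrightarrow> x \<in> I \<Longrightarrow> x \<star> a \<in> I" using I_r_closed by simp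
  show sm: "msmult c x \<in> I" if "x \<in> I" for c x
  proof -
    have "msmult c mone \<in> mclosure S" using A.smult_in[of mone c] one_in_A by simp
    moreover have "msmult c mone \<star> x = msmult c x"
      using that sub by (subst mmult_smult_left) (auto intro: mclosure_bmat bmat_one)
    ultimately show ?thesis using l[of "msmult c mone" x] that by simp
  qed
  show "x - y \<in> I" if "x \<in> I" "y \<in> I" for x y
    using add[OF that(1) sm[OF that(2), of "-1"]] by (simp add: msmult_minus_one)
qed

lemma closed_idealD:
  assumes "closed_ideal A I" "a \<in> mclosure S" "\<And>\<epsilon>. \<epsilon> > 0 \<Longrightarrow> \<exists>y\<in>I. mbound (a - y) \<epsilon>"
  shows "a \<in> I"
  using assms by (auto simp: closed_ideal_def A.closedin_V)

text \<open>
  Multiplication is continuous, so that an ideal can be specified by a condition on the dense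
  subalgebra, where rows and columns are finite.
\<close>

lemma closed_ideal_mclosure:
  assumes "T \<subseteq> S" "0 \<in> T" "\<And>x y. x \<in> T \<Longrightarrow> y \<in> T \<Longrightarrow> x + y \<in> T"
    and l: "\<And>a x. a \<in> S \<Longrightarrow> x \<in> T \<Longrightarrow> a \<star> x \<in> T"
    and r: "\<And>a x. a \<in> S \<Longrightarrow> x \<in> T \<Longrightarrow> x \<star> a \<in> T"
  shows "closed_ideal A (mclosure T)"
  unfolding closed_ideal_def
proof
  have bT: "\<And>x. x \<in> T \<Longrightarrow> bmat x" using assms(1) bmat by blast
  show "ideal (mclosure T) A"
  proof (rule ideal_A)
    show "mclosure T \<subseteq> mclosure S" by (rule mclosure_mono) fact
    show "0 \<in> mclosure T" using mclosure_subset[of T] bT assms(2) by blast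
    show "x + y \<in> mclosure T" if "x \<in> mclosure T" "y \<in> mclosure T" for x y
      by (rule mclosure_add[OF assms(3) that])
    show "a \<star> x \<in> mclosure T" if "a \<in> mclosure S" "x \<in> mclosure T" for a x
      by (rule mclosure_mult[OF l _ _ that]) (auto simp: bmat bT)
    show "x \<star> a \<in> mclosure T" if "a \<in> mclosure S" "x \<in> mclosure T" for a x
      by (rule mclosure_mult[OF r _ _ that(2,1)]) (auto simp: bmat bT)
  qed
  show "closedin (norm_topology A (cnorm A)) (mclosure T)"
    using mclosure_mono[OF assms(1)] by (auto simp: A.closedin_V intro: mclosure_limit mclosure_bmat)
qed

end

section \<open>AF algebras from finite equivalence relations\<close>

lemma sum_fun_apply: "(sum g F) i = (\<Sum>f\<in>F. g f i)"
  by (induction F rule: infinite_finite_induct) auto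

lemma sum_single: "finite F \<Longrightarrow> f \<in> F \<Longrightarrow> (\<And>g. g \<in> F \<Longrightarrow> g \<noteq> f \<Longrightarrow> h g = 0) \<Longrightarrow> sum h F = h f"
  using sum.mono_neutral_right[of F "{f}" h] by auto

definition diag :: "(nat \<Rightarrow> bool) \<Rightarrow> cmat" where
  "diag P = (\<lambda>i j. if i = j \<and> P i then 1 else 0)"

lemma mmult_diag_right: "(a \<star> diag P) i j = (if P j then a i j else 0)"
  by (subst mmult_finite_right[of "{j}"]) (auto simp: diag_def)

lemma mmult_diag_left: "(diag P \<star> a) i j = (if P i then a i j else 0)"
  by (subst mmult_finite_left[of "{i}"]) (auto simp: diag_def)

lemma mconj_diag: "bij \<tau> \<Longrightarrow> mconj \<tau> (diag P) = diag (\<lambda>i. P (\<tau> i))"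
  by (auto simp: mconj_def diag_def fun_eq_iff bij_is_inj inj_eq)

lemma diag_disj: "diag (\<lambda>i. P i \<or> Q i) = diag P + diag Q - diag P \<star> diag Q"
  by (auto simp: fun_eq_iff mmult_diag_left) (auto simp: diag_def)

lemma diag_True: "diag (\<lambda>_. True) = mone"
  by (simp add: diag_def mone_def)

lemma diag_False: "diag (\<lambda>_. False) = 0"
  by (simp add: diag_def fun_eq_iff)

text \<open>
  The natural numbers index basis vectors. At stage \<open>k\<close>, \<open>R k\<close> is an equivalence relation with
  finite classes (the moves of the stage), and \<open>E k\<close> has finitely many classes (what a window of
  the stage shows). The conditions \<open>lift\<close> and \<open>unique\<close> say that the classes of \<open>R k\<close> at two points
  with the same window are isomorphic, by a unique isomorphism that preserves windows; this makes
  \<open>R k\<close>, seen through its windows, a finite groupoid. By \<open>compat\<close> the next window shows which of the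
  next moves are already moves of the present stage, so that the groupoids form a tower.
\<close>

locale af_system =
  fixes R E :: "nat \<Rightarrow> nat \<Rightarrow> nat \<Rightarrow> bool"
  assumes R_refl: "R k i i"
    and R_sym: "R k i j \<Longrightarrow> R k j i"
    and R_trans: "R k i j \<Longrightarrow> R k j l \<Longrightarrow> R k i l"
    and R_Suc: "R k i j \<Longrightarrow> R (Suc k) i j"
    and R_finite: "finite {j. R k i j}"
    and E_refl: "E k i i"
    and E_sym: "E k i j \<Longrightarrow> E k j i"
    and E_trans: "E k i j \<Longrightarrow> E k j l \<Longrightarrow> E k i l"
    and E_Suc: "E (Suc k) i j \<Longrightarrow> E k i j"
    and E_finite: "\<exists>T. finite T \<and> (\<forall>i. \<exists>t\<in>T. E k i t)"
    and lift: "E k i i' \<Longrightarrow> R k i j \<Longrightarrow> \<exists>j'. R k i' j' \<and> E k j j'"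
    and unique: "R k i j \<Longrightarrow> E k i j \<Longrightarrow> i = j"
    and compat: "R k i j \<Longrightarrow> R (Suc k) i' j' \<Longrightarrow> E (Suc k) i i' \<Longrightarrow> E (Suc k) j j' \<Longrightarrow> R k i' j'"
begin

lemma R_mono: "k \<le> m \<Longrightarrow> R k i j \<Longrightarrow> R m i j"
  by (induction rule: dec_induct) (auto intro: R_Suc)

lemma E_mono: "k \<le> m \<Longrightarrow> E m i j \<Longrightarrow> E k i j"
  by (induction rule: dec_induct) (auto intro: E_Suc)

lemma R_cong: "R k i j \<Longrightarrow> R k i l \<longleftrightarrow> R k j l"
  using R_trans[of k i j l] R_trans[of k j i l] R_sym[of k i j] by auto

lemma E_cong: "E k i j \<Longrightarrow> E k i l \<longleftrightarrow> E k j l"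
  using E_trans[of k i j l] E_trans[of k j i l] E_sym[of k i j] by auto

lemma unique_in_class: "R k i w \<Longrightarrow> R k i w' \<Longrightarrow> E k w t \<Longrightarrow> E k w' t \<Longrightarrow> w = w'"
  using unique[of k w w'] R_cong[of k i w w'] E_cong[of k w' t w] E_sym[of k w t] E_sym[of k w' w] by auto

text \<open>
  The convolution algebra of the finite groupoid of stage \<open>k\<close>, with \<open>unit\<close> its matrix units.
\<close>

definition level :: "nat \<Rightarrow> cmat set" where
  "level k = {a. (\<forall>i j. a i j \<noteq> 0 \<longrightarrow> R k i j) \<and>
     (\<forall>i j i' j'. R k i j \<longrightarrow> R k i' j' \<longrightarrow> E k i i' \<longrightarrow> E k j j' \<longrightarrow> a i j = a i' j')}"

definition unit :: "nat \<Rightarrow> nat \<Rightarrow> nat \<Rightarrow> cmat" where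
  "unit k s t = (\<lambda>i j. if R k i j \<and> E k i s \<and> E k j t then 1 else 0)"

definition levels :: "cmat set" where
  "levels = (\<Union>k. level k)"

lemma levelI:
  assumes "\<And>i j. a i j \<noteq> 0 \<Longrightarrow> R k i j"
    "\<And>i j i' j'. R k i j \<Longrightarrow> R k i' j' \<Longrightarrow> E k i i' \<Longrightarrow> E k j j' \<Longrightarrow> a i j = a i' j'"
  shows "a \<in> level k"
  unfolding level_def by (intro CollectI conjI allI impI, erule assms(1), rule assms(2))

lemma level_R: "a \<in> level k \<Longrightarrow> a i j \<noteq> 0 \<Longrightarrow> R k i j"
  unfolding level_def by blast

lemma level_eq: "a \<in> level k \<Longrightarrow> R k i j \<Longrightarrow> R k i' j' \<Longrightarrow> E k i i' \<Longrightarrow> E k j j' \<Longrightarrow> a i j = a i' j'"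
  unfolding level_def mem_Collect_eq by blast

lemma unit_eq_diag: "unit k s s = diag (\<lambda>i. E k i s)"
proof (intro ext)
  fix i j
  have "i = j" if "R k i j" "E k i s" "E k j s" using unique_in_class[OF R_refl that] .
  then show "unit k s s i j = diag (\<lambda>i. E k i s) i j" using R_refl by (auto simp: unit_def diag_def)
qed

lemma unit_nonzeroD: "unit k s t i j \<noteq> 0 \<Longrightarrow> R k i j \<and> E k i s \<and> E k j t"
  by (auto simp: unit_def split: if_splits)

lemma unit_in_level: "unit k s t \<in> level k"
proof (rule levelI)
  fix i j i' j' assume "R k i j" "R k i' j'" "E k i i'" "E k j j'"
  moreover from this have "E k i s \<longleftrightarrow> E k i' s" "E k j t \<longleftrightarrow> E k j' t"
    using E_cong[of k i i' s] E_cong[of k j j' t] by auto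
  ultimately show "unit k s t i j = unit k s t i' j'" by (simp add: unit_def)
qed (auto simp: unit_def split: if_splits)

lemma mbound_unit: "mbound (unit k s t) 1"
proof (rule mbound_partial_permutation)
  show "unit k s t i j = 0 \<or> unit k s t i j = 1" for i j by (simp add: unit_def)
next
  fix i j j' assume "unit k s t i j \<noteq> 0" "unit k s t i j' \<noteq> 0"
  then have "R k i j" "R k i j'" "E k j t" "E k j' t" by (auto simp: unit_def split: if_splits)
  then show "j = j'" by (rule unique_in_class)
next
  fix i i' j assume "unit k s t i j \<noteq> 0" "unit k s t i' j \<noteq> 0"
  then have "R k i j" "R k i' j" "E k i s" "E k i' s" by (auto simp: unit_def split: if_splits)
  then show "i = i'" using unique_in_class[of k j i i' s] R_sym by auto
qed

text \<open>
  Finitely many windows with finite classes leave finitely many matrix units. An element of the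
  level is constant on the support of each of them, and the supports are disjoint.
\<close>

lemma unit_span:
  "\<exists>F. finite F \<and> F \<subseteq> level k \<and> (\<forall>f\<in>F. bmat f) \<and> (\<forall>a\<in>level k. \<exists>c. a = (\<Sum>f\<in>F. msmult (c f) f))"
proof -
  obtain T where T: "finite T" "\<forall>i. \<exists>t\<in>T. E k i t" using E_finite by blast
  define F where "F = (\<lambda>(t, j). unit k t j) ` (SIGMA t:T. {j. R k t j})"
  have F: "finite F" unfolding F_def using T(1) R_finite by (intro finite_imageI finite_SigmaI) auto
  have units: "\<exists>s t. f = unit k s t" if "f \<in> F" for f using that by (auto simp: F_def)
  have ex: "\<exists>f\<in>F. f i j \<noteq> 0" if ij: "R k i j" for i j
  proof -
    obtain t where t: "t \<in> T" "E k i t" using T(2) by blast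
    obtain j' where j': "R k t j'" "E k j j'" using lift[OF t(2) ij] by blast
    have "unit k t j' i j \<noteq> 0" using ij t j' by (simp add: unit_def)
    moreover have "unit k t j' \<in> F" unfolding F_def using t(1) j'(1) by force
    ultimately show ?thesis by blast
  qed
  have uniq: "f = f'" if ff: "f \<in> F" "f' \<in> F" "f i j \<noteq> 0" "f' i j \<noteq> 0" for f f' i j
  proof -
    obtain s t where f: "f = unit k s t" using units[OF ff(1)] by blast
    obtain s' t' where f': "f' = unit k s' t'" using units[OF ff(2)] by blast
    have st: "E k i s" "E k j t" "E k i s'" "E k j t'"
      using ff(3,4) unfolding f f' by (auto dest: unit_nonzeroD)
    then have "E k s s'" "E k t t'" using E_cong[OF st(1), of s'] E_cong[OF st(2), of t'] by auto
    then have "E k x s \<longleftrightarrow> E k x s'" "E k y t \<longleftrightarrow> E k y t'" for x y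
      using E_trans[of k x s s'] E_trans[of k x s' s] E_trans[of k y t t'] E_trans[of k y t' t]
        E_sym[of k s s'] E_sym[of k t t'] by auto
    then show ?thesis unfolding f f' unit_def by simp
  qed
  have s3: "\<forall>a\<in>level k. \<exists>c. a = (\<Sum>f\<in>F. msmult (c f) f)"
  proof
    fix a assume a: "a \<in> level k"
    have "\<exists>c. \<forall>i j. f i j \<noteq> 0 \<longrightarrow> a i j = c" if "f \<in> F" for f
    proof (cases "\<exists>i j. f i j \<noteq> 0")
      case True
      then obtain i j where ij: "f i j \<noteq> 0" by blast
      obtain s t where f: "f = unit k s t" using units[OF \<open>f \<in> F\<close>] by blast
      have "a i' j' = a i j" if "f i' j' \<noteq> 0" for i' j'
      proof (rule level_eq[OF a])
        have st: "R k i j" "E k i s" "E k j t" "R k i' j'" "E k i' s" "E k j' t"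
          using that ij unfolding f by (auto dest: unit_nonzeroD)
        show "R k i' j'" "R k i j" "E k i' i" "E k j' j"
          using st E_trans[OF st(5) E_sym[OF st(2)]] E_trans[OF st(6) E_sym[OF st(3)]] by auto
      qed
      then show ?thesis by blast
    qed blast
    then obtain c where c: "\<And>f i j. f \<in> F \<Longrightarrow> f i j \<noteq> 0 \<Longrightarrow> a i j = c f" by metis
    have "a i j = (\<Sum>f\<in>F. c f * f i j)" for i j
    proof (cases "R k i j")
      case True
      obtain f where f: "f \<in> F" "f i j \<noteq> 0" using ex[OF True] by blast
      have "g i j = 0" if "g \<in> F" "g \<noteq> f" for g using uniq[OF that(1) f(1) _ f(2)] that(2) by metis
      then have "(\<Sum>f\<in>F. c f * f i j) = c f * f i j"
        by (intro sum_single F f(1)) simp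
      moreover obtain s t where "f = unit k s t" using units[OF f(1)] by blast
      then have "f i j = 1" using f(2) by (simp add: unit_def split: if_splits)
      ultimately show ?thesis using c[OF f] by simp
    next
      case False
      have "f i j = 0" if "f \<in> F" for f
      proof -
        obtain s t where "f = unit k s t" using units[OF \<open>f \<in> F\<close>] by blast
        then show ?thesis using False by (simp add: unit_def)
      qed
      then have "(\<Sum>f\<in>F. c f * f i j) = 0" by (intro sum.neutral) simp
      moreover have "a i j = 0" using False level_R[OF a] by blast
      ultimately show ?thesis by simp
    qed
    then have "a = (\<Sum>f\<in>F. msmult (c f) f)" by (intro ext) (simp only: sum_fun_apply msmult_apply)
    then show "\<exists>c. a = (\<Sum>f\<in>F. msmult (c f) f)" by (rule exI[of _ c])
  qed
  have s1: "F \<subseteq> level k" using units unit_in_level by blast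
  have s2: "\<forall>f\<in>F. bmat f"
  proof
    fix f assume "f \<in> F"
    then obtain s t where "f = unit k s t" using units by blast
    then show "bmat f" using bmatI[OF mbound_unit] by simp
  qed
  show ?thesis by (rule exI[of _ F], rule conjI[OF F conjI[OF s1 conjI[OF s2 s3]]])
qed

lemma bmat_sum: "(\<And>f. f \<in> F \<Longrightarrow> bmat (g f)) \<Longrightarrow> bmat (sum g F)"
  by (induction F rule: infinite_finite_induct) (auto simp: bmat_zero bmat_add)

lemma level_bmat:
  assumes "a \<in> level k" shows "bmat a"
proof -
  obtain F where F: "\<forall>f\<in>F. bmat f" "\<forall>a\<in>level k. \<exists>c. a = (\<Sum>f\<in>F. msmult (c f) f)"
    using unit_span[of k] by blast
  obtain c where c: "a = (\<Sum>f\<in>F. msmult (c f) f)" using bspec[OF F(2) assms] by (rule exE)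
  show ?thesis unfolding c using F(1) by (intro bmat_sum bmat_smult) simp
qed

lemma level_zero: "0 \<in> level k"
  by (rule levelI) auto

lemma level_one: "mone \<in> level k"
proof (rule levelI)
  show "R k i j" if "mone i j \<noteq> 0" for i j using that R_refl by (auto simp: mone_def split: if_splits)
  fix i j i' j' assume "R k i j" "R k i' j'" "E k i i'" "E k j j'"
  moreover have "i' = j'" if "i = j"
    using calculation that by (intro unique) (auto intro: E_trans E_sym)
  moreover have "i = j" if "i' = j'"
    using calculation that by (intro unique) (auto intro: E_trans E_sym)
  ultimately show "mone i j = mone i' j'" by (simp add: mone_def)
qed

lemma level_add: "a \<in> level k \<Longrightarrow> b \<in> level k \<Longrightarrow> a + b \<in> level k"
proof (rule levelI)
  fix i j assume a: "a \<in> level k" "b \<in> level k" "(a + b) i j \<noteq> 0"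
  then have "a i j \<noteq> 0 \<or> b i j \<noteq> 0" by auto
  then show "R k i j" using level_R a(1,2) by blast
next
  fix i j i' j' assume *: "a \<in> level k" "b \<in> level k" "R k i j" "R k i' j'" "E k i i'" "E k j j'"
  show "(a + b) i j = (a + b) i' j'"
    by (simp only: plus_fun_apply level_eq[OF *(1,3-6)] level_eq[OF *(2,3-6)])
qed

lemma level_smult: "a \<in> level k \<Longrightarrow> msmult c a \<in> level k"
proof (rule levelI)
  fix i j assume "a \<in> level k" "msmult c a i j \<noteq> 0"
  then show "R k i j" using level_R by (auto simp: msmult_apply)
next
  fix i j i' j' assume *: "a \<in> level k" "R k i j" "R k i' j'" "E k i i'" "E k j j'"
  show "msmult c a i j = msmult c a i' j'" by (simp only: msmult_apply level_eq[OF *])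
qed

lemma level_star: "a \<in> level k \<Longrightarrow> mstar a \<in> level k"
proof (rule levelI)
  fix i j assume "a \<in> level k" "mstar a i j \<noteq> 0"
  then show "R k i j" using level_R R_sym by (auto simp: mstar_def)
next
  fix i j i' j' assume *: "a \<in> level k" "R k i j" "R k i' j'" "E k i i'" "E k j j'"
  show "mstar a i j = mstar a i' j'"
    by (simp only: mstar_def level_eq[OF *(1) R_sym[OF *(2)] R_sym[OF *(3)] *(5,4)])
qed

lemma level_mult_entry:
  assumes "a \<in> level k"
  shows "(a \<star> b) i j = (\<Sum>w\<in>{w. R k i w}. a i w * b w j)"
  using level_R[OF assms] by (intro mmult_finite_left[OF R_finite]) auto

text \<open>
  Equivalent windows have isomorphic classes, and the isomorphism matches the terms of the two sums
  that compute corresponding entries of a product.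
\<close>

lemma level_mult:
  assumes a: "a \<in> level k" and b: "b \<in> level k"
  shows "a \<star> b \<in> level k"
proof (rule levelI)
  fix i j assume "(a \<star> b) i j \<noteq> 0"
  then obtain w where "w \<in> {w. R k i w}" "a i w * b w j \<noteq> 0"
    unfolding level_mult_entry[OF a] by (rule sum.not_neutral_contains_not_neutral)
  then have "R k i w" "b w j \<noteq> 0" by auto
  then show "R k i j" using level_R[OF b] by (blast intro: R_trans)
next
  fix i j i' j' assume ij: "R k i j" "R k i' j'" "E k i i'" "E k j j'"
  have "\<forall>w. \<exists>w'. R k i w \<longrightarrow> R k i' w' \<and> E k w w'" using lift[OF ij(3)] by blast
  then obtain f where f: "\<And>w. R k i w \<Longrightarrow> R k i' (f w)" "\<And>w. R k i w \<Longrightarrow> E k w (f w)" by metis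
  have bij: "bij_betw f {w. R k i w} {w. R k i' w}"
  proof (rule bij_betw_imageI)
    show "inj_on f {w. R k i w}"
    proof (rule inj_onI)
      fix w w' assume w: "w \<in> {w. R k i w}" "w' \<in> {w. R k i w}" "f w = f w'"
      have "E k w (f w)" "E k w' (f w)" using w(1,2) f(2)[of w] f(2)[of w'] unfolding w(3) by auto
      then show "w = w'" using w(1,2) by (auto intro: unique_in_class)
    qed
    show "f ` {w. R k i w} = {w. R k i' w}"
    proof
      show "f ` {w. R k i w} \<subseteq> {w. R k i' w}" using f(1) by auto
      show "{w. R k i' w} \<subseteq> f ` {w. R k i w}"
      proof
        fix w' assume "w' \<in> {w. R k i' w}"
        then have w': "R k i' w'" by simp
        obtain w where w: "R k i w" "E k w' w" using lift[OF E_sym[OF ij(3)] w'] by blast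
        have "R k w' (f w)" using f(1)[OF w(1)] R_cong[OF w'] by simp
        moreover have "E k w' (f w)" by (rule E_trans[OF w(2) f(2)[OF w(1)]])
        ultimately have "w' = f w" by (rule unique)
        then show "w' \<in> f ` {w. R k i w}" using w(1) by simp
      qed
    qed
  qed
  have "(a \<star> b) i' j' = (\<Sum>w\<in>{w. R k i w}. a i' (f w) * b (f w) j')"
    unfolding level_mult_entry[OF a] by (rule sum.reindex_bij_betw[OF bij, symmetric])
  also have "\<dots> = (\<Sum>w\<in>{w. R k i w}. a i w * b w j)"
  proof (rule sum.cong[OF refl])
    fix w assume "w \<in> {w. R k i w}"
    then have w: "R k i w" by simp
    have wj: "R k w j" using R_cong[OF w] ij(1) by simp
    have wj': "R k (f w) j'" using R_cong[OF f(1)[OF w]] ij(2) by simp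
    show "a i' (f w) * b (f w) j' = a i w * b w j"
      by (simp only: level_eq[OF a w f(1)[OF w] ij(3) f(2)[OF w]] level_eq[OF b wj wj' f(2)[OF w] ij(4)])
  qed
  also have "\<dots> = (a \<star> b) i j" by (rule level_mult_entry[OF a, symmetric])
  finally show "(a \<star> b) i j = (a \<star> b) i' j'" by (rule sym)
qed

lemma level_Suc: "level k \<subseteq> level (Suc k)"
proof
  fix a assume a: "a \<in> level k"
  show "a \<in> level (Suc k)"
  proof (rule levelI)
    show "R (Suc k) i j" if "a i j \<noteq> 0" for i j using level_R[OF a that] by (rule R_Suc)
    fix i j i' j' assume *: "R (Suc k) i j" "R (Suc k) i' j'" "E (Suc k) i i'" "E (Suc k) j j'"
    have iff: "R k i j \<longleftrightarrow> R k i' j'"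
      using compat[OF _ *(2-4)] compat[OF _ *(1) E_sym[OF *(3)] E_sym[OF *(4)]] by blast
    show "a i j = a i' j'"
    proof (cases "R k i j")
      case True
      then show ?thesis using iff * E_Suc by (intro level_eq[OF a]) auto
    next
      case False
      then show ?thesis using iff level_R[OF a] by metis
    qed
  qed
qed

lemma level_mono: "k \<le> m \<Longrightarrow> level k \<subseteq> level m"
  by (induction rule: dec_induct) (use level_Suc in auto)

lemma levelsE2:
  assumes "a \<in> levels" "b \<in> levels"
  obtains k where "a \<in> level k" "b \<in> level k"
proof -
  obtain k m where "a \<in> level k" "b \<in> level m" using assms by (auto simp: levels_def)
  then have "a \<in> level (max k m)" "b \<in> level (max k m)"
    using level_mono[of k "max k m"] level_mono[of m "max k m"] by auto
  then show thesis by (rule that)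
qed

sublocale matrix_star_algebra levels
proof
  show "bmat a" if "a \<in> levels" for a using that level_bmat by (auto simp: levels_def)
  show "mone \<in> levels" using level_one by (auto simp: levels_def)
  show "a + b \<in> levels" if "a \<in> levels" "b \<in> levels" for a b
    using that by (rule levelsE2) (auto simp: levels_def intro: level_add)
  show "a \<star> b \<in> levels" if "a \<in> levels" "b \<in> levels" for a b
    using that by (rule levelsE2) (auto simp: levels_def intro: level_mult)
  show "msmult c a \<in> levels" if "a \<in> levels" for a c using that by (auto simp: levels_def intro: level_smult)
  show "mstar a \<in> levels" if "a \<in> levels" for a using that by (auto simp: levels_def intro: level_star)
qed

lemma level_subset: "level k \<subseteq> mclosure levels"
  using S_subset by (auto simp: levels_def)

lemma unit_in_A: "unit k s t \<in> mclosure levels"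
  using level_subset unit_in_level by blast

lemma AF_algebra_A: "AF_algebra A"
  unfolding AF_algebra_def
proof (intro exI[of _ level] conjI allI)
  fix k
  show "star_subalgebra A (level k)"
    unfolding star_subalgebra_def
    using level_subset[of k] level_zero level_add level_smult level_mult level_star
    by (auto intro!: A.submodule_V)
  show "finite_dim A (level k)"
  proof -
    obtain F where F: "finite F" "F \<subseteq> level k" "\<forall>a\<in>level k. \<exists>c. a = (\<Sum>f\<in>F. msmult (c f) f)"
      using unit_span[of k] by blast
    have "finsum A (\<lambda>s. msmult (c s) s) F = (\<Sum>f\<in>F. msmult (c f) f)" for c
    proof (rule A.finsum_V[OF F(1)])
      show "msmult (c f) f \<in> carrier A" if "f \<in> F" for f
        using level_smult[of f k "c f"] F(2) level_subset[of k] that by auto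
    qed
    then show ?thesis
      unfolding finite_dim_def using F by (intro exI[of _ F]) (simp add: matrix_cstar_simps)
  qed
  show "level k \<subseteq> level (Suc k)" by (rule level_Suc)
next
  have "Abstract_Topology.closure_of (norm_topology A mnorm) (\<Union>k. level k)
      = {x \<in> carrier A. \<forall>\<epsilon>>0. \<exists>y\<in>(\<Union>k. level k). mbound (x - y) \<epsilon>}"
    using level_subset by (intro A.closure_of_V) auto
  also have "\<dots> = carrier A" by (auto simp: mclosure_def levels_def)
  finally show "Abstract_Topology.closure_of (cstar_topology A) (\<Union>k. level k) = carrier A"
    by (simp only: matrix_cstar_simps)
qed

lemma levels_R: "a \<in> levels \<Longrightarrow> a i j \<noteq> 0 \<Longrightarrow> \<exists>k. R k i j"
  unfolding levels_def by (blast intro: level_R)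

lemma A_R:
  assumes "a \<in> mclosure levels" "a i j \<noteq> 0" shows "\<exists>k. R k i j"
proof -
  obtain b where b: "b \<in> levels" "mbound (a - b) (cmod (a i j) / 2)"
    using mclosureD[OF assms(1), of "cmod (a i j) / 2"] assms(2) by auto
  have "cmod (a i j - b i j) \<le> cmod (a i j) / 2" using mbound_entry[OF b(2), of i j] by simp
  then have "b i j \<noteq> 0" using assms(2) by auto
  then show ?thesis using levels_R b(1) by blast
qed

lemma partner: "E k i s \<Longrightarrow> R k s t \<Longrightarrow> \<exists>w. R k i w \<and> E k w t"
  using lift[of k s i t] E_sym[of k] by blast

text \<open>A matrix unit acts on columns along the isomorphism of classes, which has one point over \<open>j\<close>.\<close>

lemma unit_mult_right:
  assumes "R k w j" "E k w s" "E k j t"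
  shows "(a \<star> unit k s t) i j = a i w"
proof -
  have "unit k s t w' j = 0" if "w' \<notin> {w}" for w'
  proof (rule ccontr)
    assume "unit k s t w' j \<noteq> 0"
    then have "R k j w'" "E k w' s" using R_sym by (auto dest: unit_nonzeroD)
    from unique_in_class[OF this(1) R_sym[OF assms(1)] this(2) assms(2)] that show False by simp
  qed
  then have "(a \<star> unit k s t) i j = (\<Sum>w\<in>{w}. a i w * unit k s t w j)"
    by (rule mmult_finite_right[OF finite.insertI[OF finite.emptyI]])
  then show ?thesis using assms by (simp add: unit_def)
qed

lemma unit_mult_right_zero: "\<not> E k j t \<Longrightarrow> (a \<star> unit k s t) i j = 0"
  using mmult_finite_right[of "{}" "unit k s t" j a i] by (simp add: unit_def)

lemma unit_mult_unit:
  assumes "R k s t" shows "unit k s t \<star> unit k t s = unit k s s"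
proof (intro ext)
  fix i j
  show "(unit k s t \<star> unit k t s) i j = unit k s s i j"
  proof (cases "E k j s")
    case True
    obtain w where w: "R k j w" "E k w t" using partner[OF True assms] by blast
    have "(unit k s t \<star> unit k t s) i j = unit k s t i w"
      using unit_mult_right[OF R_sym[OF w(1)] w(2) True] .
    also have "\<dots> = unit k s s i j"
      using w True R_cong[OF w(1), of i] R_sym[of k i] R_sym[of k _ i] by (auto simp: unit_def)
    finally show ?thesis .
  next
    case False
    then show ?thesis by (simp add: unit_mult_right_zero) (simp add: unit_def)
  qed
qed

text \<open>
  A class of \<open>R k\<close> has at most one point in a window of stage \<open>k\<close>. Cutting an element of the level down
  to the windows of \<open>i\<close> and \<open>j\<close> therefore leaves a single coefficient, the common value of its
  entries there.
\<close>

lemma corner: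
  assumes b: "b \<in> level k" and ij: "R k i j"
  shows "unit k i i \<star> (b \<star> unit k j i) = msmult (b i j) (unit k i i)"
proof (intro ext)
  fix x y
  show "(unit k i i \<star> (b \<star> unit k j i)) x y = msmult (b i j) (unit k i i) x y"
  proof (cases "E k x i \<and> E k y i")
    case True
    obtain w where w: "R k y w" "E k w j" using partner[OF _ ij] True by blast
    have "(b \<star> unit k j i) x y = b x w"
      using unit_mult_right[OF R_sym[OF w(1)] w(2)] True by blast
    also have "\<dots> = (if x = y then b i j else 0)"
    proof (cases "x = y")
      case True
      then show ?thesis using w ij \<open>E k x i \<and> E k y i\<close> by (auto intro: level_eq[OF b])
    next
      case neq: False
      have "x = y" if "R k x w"
        by (rule unique_in_class[of k w _ _ i]) (use that w R_sym True in auto)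
      then have "\<not> R k x w" using neq by blast
      then show ?thesis using neq level_R[OF b] by auto
    qed
    finally show ?thesis using True
      unfolding unit_eq_diag mmult_diag_left msmult_apply by (simp add: diag_def)
  next
    case False
    then show ?thesis
      unfolding unit_eq_diag mmult_diag_left msmult_apply by (auto simp: diag_def unit_mult_right_zero)
  qed
qed

text \<open>
  An element of the ideal can be cut down to a corner where it is close to a nonzero multiple of the
  projection \<open>p\<close> of a window. So the ideal contains \<open>p - d\<close> with \<open>d\<close> in the corner of norm below \<open>1\<close>,
  hence all \<open>p - d\<^sup>m\<close> and their limit \<open>p\<close>.
\<close>

lemma ideal_contains_unit:
  assumes I: "closed_ideal A I" and a: "a \<in> I" "a i j \<noteq> 0"
  shows "\<exists>k. unit k i i \<in> I"
proof -
  have I': "ideal I A" using I by (simp add: closed_ideal_def)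
  have aA: "a \<in> mclosure levels" using idealD(1)[OF I'] a(1) by blast
  \<comment> \<open>With a quarter, the corner element \<open>d\<close> below has norm at most \<open>\<epsilon> / |b i j| \<le> 1 / 3\<close>.\<close>
  define \<epsilon> where "\<epsilon> = cmod (a i j) / 4"
  have e: "\<epsilon> > 0" using a(2) by (simp add: \<epsilon>_def)
  obtain b where b: "b \<in> levels" "mbound (a - b) \<epsilon>" using mclosureD[OF aA e] by blast
  obtain k where k: "b \<in> level k" using b(1) by (auto simp: levels_def)
  have "cmod (a i j - b i j) \<le> \<epsilon>" using mbound_entry[OF b(2), of i j] by simp
  then have big: "cmod (b i j) \<ge> 3 * \<epsilon>"
    using norm_triangle_ineq2[of "a i j" "b i j"] by (simp add: \<epsilon>_def)
  then have nz: "b i j \<noteq> 0" using e by auto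
  have ij: "R k i j" using level_R[OF k nz] .
  define p where "p = unit k i i"
  define v where "v = unit k j i"
  define c where "c = inverse (b i j)"
  define d where "d = msmult c (p \<star> ((b - a) \<star> v))"
  have bm: "bmat p" "bmat v" "bmat a" "bmat b"
    using mbound_unit aA k by (auto simp: p_def v_def intro: bmatI mclosure_bmat level_bmat)
  have pA: "p \<in> mclosure levels" "v \<in> mclosure levels" by (auto simp: p_def v_def unit_in_A)
  have "p - d = msmult c (p \<star> (a \<star> v))"
  proof -
    have "p \<star> ((b - a) \<star> v) = msmult (b i j) p - p \<star> (a \<star> v)"
      using corner[OF k ij] bm by (simp add: p_def v_def mmult_diff_left mmult_diff_right bmat_mult)
    then show ?thesis unfolding d_def using nz by (intro ext) (simp add: c_def msmult_apply right_diff_distrib)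
  qed
  then have pd: "p - d \<in> I"
    using idealD(5-7)[OF I'] pA a(1) by auto
  have d_bound: "mbound d (1 / 2)"
  proof -
    have "mbound d (cmod c * (1 * (\<epsilon> * 1)))"
      unfolding d_def p_def v_def
      by (intro mbound_smult mbound_mult mbound_unit mbound_minus_commute[OF b(2)])
    moreover have "cmod c * (1 * (\<epsilon> * 1)) = \<epsilon> / cmod (b i j)"
      unfolding c_def norm_inverse by (simp add: divide_inverse)
    moreover have "\<epsilon> / cmod (b i j) \<le> 1 / 2" using big e nz by (subst pos_divide_le_eq) auto
    ultimately show ?thesis using mbound_mono by simp
  qed
  have pp: "p \<star> p = p" unfolding p_def using unit_mult_unit[OF R_refl] .
  have bd: "bmat d" using d_bound by (rule bmatI)
  have pdd: "p \<star> d = d"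
  proof -
    have "p \<star> (p \<star> ((b - a) \<star> v)) = p \<star> ((b - a) \<star> v)"
      using mmult_assoc[of p p "(b - a) \<star> v"] bm pp by (simp add: bmat_mult bmat_diff)
    then show ?thesis unfolding d_def using bm by (subst mmult_smult_right) (auto simp: bmat_mult bmat_diff)
  qed
  have dA: "d \<in> mclosure levels"
    using A.diff_in[of p "p - d"] pA(1) pd idealD(1)[OF I'] by auto
  define dp where "dp m = ((\<star>) d ^^ m) p" for m
  have dp_Suc: "dp (Suc m) = d \<star> dp m" for m by (simp add: dp_def)
  have dpA: "dp m \<in> mclosure levels" for m
    by (induction m) (auto simp: dp_Suc dA mult_in_A, simp add: dp_def pA)
  have bdp: "bmat (dp m)" for m using dpA by (rule mclosure_bmat)
  have pdp: "p \<star> dp m = dp m" for m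
  proof (cases m)
    case 0 then show ?thesis by (simp add: dp_def pp)
  next
    case (Suc m')
    then show ?thesis using mmult_assoc[of p d "dp m'"] bm bd bdp by (simp add: dp_Suc pdd)
  qed
  have in_I: "p - dp m \<in> I" for m
  proof (induction m)
    case 0 show ?case using idealD(2)[OF I'] by (simp only: dp_def funpow_0 diff_self)
  next
    case (Suc m)
    have "(p - d) \<star> dp m = dp m - dp (Suc m)"
      using bm bd bdp by (simp add: mmult_diff_left pdp dp_Suc)
    then have *: "p - dp (Suc m) = (p - dp m) + (p - d) \<star> dp m" by simp
    show ?case unfolding * by (rule idealD(3)[OF I' Suc idealD(6)[OF I' dpA pd]])
  qed
  have dp_bound: "mbound (dp m) ((1 / 2) ^ m)" for m
  proof (induction m)
    case 0 then show ?case by (simp add: dp_def p_def mbound_unit)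
  next
    case (Suc m) then show ?case using mbound_mult[OF d_bound Suc] by (simp add: dp_Suc)
  qed
  have "p \<in> I"
  proof (rule closed_idealD[OF I pA(1)])
    fix \<epsilon> :: real assume "\<epsilon> > 0"
    then obtain m where m: "(1 / 2) ^ m < \<epsilon>" using real_arch_pow_inv[of \<epsilon> "1 / 2"] by auto
    have "p - (p - dp m) = dp m" by simp
    then have "mbound (p - (p - dp m)) \<epsilon>" using mbound_mono[OF dp_bound[of m]] m by simp
    then show "\<exists>y\<in>I. mbound (p - y) \<epsilon>" using in_I by blast
  qed
  then show ?thesis unfolding p_def by blast
qed

lemma unit_in_ideal:
  assumes I: "ideal I A" and P: "diag P \<in> I" and xy: "R m x y" and sub: "\<And>y'. E m y' y \<Longrightarrow> P y'"
  shows "unit m x y \<in> I" "unit m x x \<in> I"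
proof -
  have "unit m x y \<star> diag P = unit m x y"
    using sub by (auto simp: fun_eq_iff mmult_diag_right unit_def)
  then show *: "unit m x y \<in> I" using idealD(5)[OF I unit_in_A[of m x y] P] by simp
  show "unit m x x \<in> I" using idealD(6)[OF I unit_in_A[of m y x] *] unit_mult_unit[OF xy] by simp
qed

lemma ideal_eq_carrier:
  assumes I: "ideal I A" and all: "\<And>x. unit m x x \<in> I"
  shows "I = carrier A"
proof -
  obtain T where T: "finite T" "\<forall>i. \<exists>t\<in>T. E m i t" using E_finite by blast
  have "diag (\<lambda>i. \<exists>t\<in>T. E m i t) \<in> I"
    using T(1)
  proof (induction T rule: finite_induct)
    case empty show ?case using idealD(2)[OF I] by (simp only: bex_empty diag_False)
  next
    case (insert t T)
    have t: "diag (\<lambda>i. E m i t) \<in> I" using all[of t] by (simp only: unit_eq_diag)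
    have "diag (\<lambda>i. E m i t) \<in> mclosure levels" using idealD(1)[OF I] t by (rule subsetD)
    from idealD(4)[OF I idealD(3)[OF I t insert.IH] idealD(5)[OF I this insert.IH]]
    have "diag (\<lambda>i. E m i t \<or> (\<exists>t\<in>T. E m i t)) \<in> I" by (simp only: diag_disj)
    then show ?case by (simp only: bex_simps)
  qed
  moreover have "(\<lambda>i. \<exists>t\<in>T. E m i t) = (\<lambda>_. True)" using T(2) by (intro ext) simp
  ultimately have one: "mone \<in> I" by (simp only: diag_True)
  have "a \<in> I" if "a \<in> mclosure levels" for a using idealD(5)[OF I that one] by simp
  then show ?thesis using idealD(1)[OF I] by auto
qed

lemma nonzero_ideal_contains_diag:
  assumes I: "closed_ideal A I" and nz: "I \<noteq> {0}"
  shows "\<exists>k i. diag (\<lambda>x. E k x i) \<in> I"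
proof -
  have "ideal I A" using I by (simp add: closed_ideal_def)
  then obtain a where "a \<in> I" "a \<noteq> 0" using nz idealD(2) by blast
  moreover from this obtain i j where "a i j \<noteq> 0" by (auto simp: fun_eq_iff)
  ultimately show ?thesis using ideal_contains_unit[OF I] by (metis unit_eq_diag)
qed

text \<open>
  The projection of a window lies in the ideal, hence so do its translates. By \<open>meets\<close> every window
  of stage \<open>m\<close> is equivalent, through a matrix unit, to a part of one of these translates, and
  finitely many windows of stage \<open>m\<close> cover everything.
\<close>

lemma invariant_ideal_eq_carrier:
  assumes I: "closed_ideal A I" and nz: "I \<noteq> {0}"
    and bij: "\<And>\<tau>. \<tau> \<in> T \<Longrightarrow> bij \<tau>" and inv: "\<And>\<tau> a. \<tau> \<in> T \<Longrightarrow> a \<in> I \<Longrightarrow> mconj \<tau> a \<in> I"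
    and meets: "\<And>k i. \<exists>m. \<forall>x. \<exists>\<tau>\<in>T. \<exists>y. R m x y \<and> (\<forall>y'. E m y' y \<longrightarrow> E k (\<tau> y') i)"
  shows "I = carrier A"
proof -
  have I': "ideal I A" using I by (simp add: closed_ideal_def)
  obtain k i where ki: "diag (\<lambda>x. E k x i) \<in> I" using nonzero_ideal_contains_diag[OF I nz] by blast
  obtain m where m: "\<forall>x. \<exists>\<tau>\<in>T. \<exists>y. R m x y \<and> (\<forall>y'. E m y' y \<longrightarrow> E k (\<tau> y') i)"
    using meets by blast
  show ?thesis
  proof (rule ideal_eq_carrier[OF I', of m])
    fix x
    obtain \<tau> y where \<tau>: "\<tau> \<in> T" and y: "R m x y" "\<forall>y'. E m y' y \<longrightarrow> E k (\<tau> y') i" using m by blast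
    have "diag (\<lambda>x. E k (\<tau> x) i) \<in> I" using inv[OF \<tau> ki] by (simp add: mconj_diag[OF bij[OF \<tau>]])
    from unit_in_ideal(2)[OF I' this y(1)] y(2) show "unit m x x \<in> I" by blast
  qed
qed

lemma A_nonzero: "carrier A \<noteq> {0}"
proof
  assume "carrier A = {0}"
  then have "mone = 0" using one_in_A by auto
  then have "mone 0 0 = 0" by simp
  then show False by (simp add: mone_def)
qed

text \<open>
  Two nonzero ideals contain the projections of two windows. A matrix unit that links points of
  these windows lies in the first ideal, its adjoint in the second, and their product is a nonzero
  projection.
\<close>

lemma prime_A:
  assumes linked: "\<And>k i m j. \<exists>x y l. E k x i \<and> E m y j \<and> R l x y"
  shows "prime_cstar A"
  unfolding prime_cstar_def
proof (intro conjI allI impI)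
  show "carrier A \<noteq> {\<zero>\<^bsub>A\<^esub>}" using A_nonzero by simp
  fix I J assume I: "closed_ideal A I" and J: "closed_ideal A J"
    and prod: "\<forall>x\<in>I. \<forall>y\<in>J. x \<otimes>\<^bsub>A\<^esub> y = \<zero>\<^bsub>A\<^esub>"
  have I': "ideal I A" "ideal J A" using I J by (auto simp: closed_ideal_def)
  show "I = {\<zero>\<^bsub>A\<^esub>} \<or> J = {\<zero>\<^bsub>A\<^esub>}"
  proof (rule ccontr)
    assume "\<not> ?thesis"
    then have nz: "I \<noteq> {0}" "J \<noteq> {0}" by auto
    obtain k i where ki: "diag (\<lambda>x. E k x i) \<in> I" using nonzero_ideal_contains_diag[OF I nz(1)] by blast
    obtain m j where mj: "diag (\<lambda>x. E m x j) \<in> J" using nonzero_ideal_contains_diag[OF J nz(2)] by blast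
    obtain x y l where xy: "E k x i" "E m y j" "R l x y" using linked by blast
    define h where "h = max l (max k m)"
    have h: "R h x y" "k \<le> h" "m \<le> h" using R_mono[OF _ xy(3)] by (auto simp: h_def)
    have "unit h y x \<in> I"
      by (rule unit_in_ideal(1)[OF I'(1) ki R_sym[OF h(1)]]) (use E_mono[OF h(2)] xy(1) E_trans in blast)
    moreover have "unit h x y \<in> J"
      by (rule unit_in_ideal(1)[OF I'(2) mj h(1)]) (use E_mono[OF h(3)] xy(2) E_trans in blast)
    ultimately have "unit h y x \<star> unit h x y = 0" using prod by simp
    then have "unit h y y = 0" using unit_mult_unit[OF R_sym[OF h(1)]] by simp
    then have "unit h y y y y = 0" by simp
    then show False by (simp add: unit_def R_refl E_refl)
  qed
qed

text \<open>
  A decreasing sequence of sets \<open>Q L\<close> of basis vectors, each saturated for the moves of the stages up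
  to \<open>L\<close>, plays the role of a closed invariant set: its limit points need not occur among the basis
  vectors themselves. If all \<open>Q L\<close> are nonempty, an element that vanishes on some \<open>Q L\<close> has distance
  at least \<open>1\<close> from the unit, and so the ideal is proper.
\<close>

definition vanishing :: "(nat \<Rightarrow> nat set) \<Rightarrow> cmat set" where
  "vanishing Q = {b \<in> levels. \<exists>L. \<forall>j\<in>Q L. \<forall>i. b i j = 0}"

lemma vanishing_closed_ideal:
  assumes dec: "decseq Q" and sat: "\<And>k L i j. k \<le> L \<Longrightarrow> j \<in> Q L \<Longrightarrow> R k j i \<Longrightarrow> i \<in> Q L"
  shows "closed_ideal A (mclosure (vanishing Q))"
proof (rule closed_ideal_mclosure)
  show "vanishing Q \<subseteq> levels" by (auto simp: vanishing_def)
  show "0 \<in> vanishing Q" using zero_in by (auto simp: vanishing_def)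
  show "x + y \<in> vanishing Q" if xy: "x \<in> vanishing Q" "y \<in> vanishing Q" for x y
  proof -
    obtain L M where "\<forall>j\<in>Q L. \<forall>i. x i j = 0" "\<forall>j\<in>Q M. \<forall>i. y i j = 0"
      using xy by (auto simp: vanishing_def)
    moreover have "Q (max L M) \<subseteq> Q L" "Q (max L M) \<subseteq> Q M" using dec by (auto simp: decseq_def)
    ultimately have "\<forall>j\<in>Q (max L M). \<forall>i. (x + y) i j = 0" by (auto simp: subset_iff)
    then show ?thesis using xy add_in unfolding vanishing_def by blast
  qed
  show "a \<star> x \<in> vanishing Q" if ax: "a \<in> levels" "x \<in> vanishing Q" for a x
  proof -
    obtain L where L: "\<forall>j\<in>Q L. \<forall>i. x i j = 0" using ax by (auto simp: vanishing_def)
    have "(a \<star> x) i j = 0" if "j \<in> Q L" for i j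
      using L that by (subst mmult_finite_right[of "{}"]) auto
    then show ?thesis using ax mult_in unfolding vanishing_def by blast
  qed
  show "x \<star> a \<in> vanishing Q" if ax: "a \<in> levels" "x \<in> vanishing Q" for a x
  proof -
    obtain L where L: "\<forall>j\<in>Q L. \<forall>i. x i j = 0" using ax by (auto simp: vanishing_def)
    obtain k where k: "a \<in> level k" using ax by (auto simp: levels_def)
    have "(x \<star> a) i j = 0" if j: "j \<in> Q (max L k)" for i j
    proof -
      have "x i w * a w j = 0" for w
      proof (cases "a w j = 0")
        case False
        then have "R k j w" using level_R[OF k] R_sym by blast
        then have "w \<in> Q (max L k)" using sat[of k "max L k"] j by auto
        moreover have "Q (max L k) \<subseteq> Q L" using dec by (auto simp: decseq_def)
        ultimately show ?thesis using L by auto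
      qed simp
      then have "(\<lambda>w. x i w * a w j) = (\<lambda>_. 0)" by (rule ext)
      then show ?thesis unfolding mmult_def by (simp only: infsum_0_simp)
    qed
    then show ?thesis using ax mult_in unfolding vanishing_def by blast
  qed
qed

lemma vanishing_proper:
  assumes "\<And>L. Q L \<noteq> {}"
  shows "mclosure (vanishing Q) \<noteq> carrier A"
proof
  assume "mclosure (vanishing Q) = carrier A"
  then have "mone \<in> mclosure (vanishing Q)" using one_in_A by simp
  then obtain b where b: "b \<in> vanishing Q" "mbound (mone - b) (1 / 2)"
    using mclosureD[of mone _ "1 / 2"] by auto
  obtain L where L: "\<forall>j\<in>Q L. \<forall>i. b i j = 0" using b(1) by (auto simp: vanishing_def)
  obtain j where "j \<in> Q L" using assms by blast
  then show False using mbound_entry[OF b(2), of j j] L by (simp add: mone_def)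
qed

lemma vanishing_nonzero:
  assumes "\<And>j. j \<in> Q L \<Longrightarrow> \<not> E k j i"
  shows "mclosure (vanishing Q) \<noteq> {0}"
proof
  assume *: "mclosure (vanishing Q) = {0}"
  have "unit k i i a j = 0" if "j \<in> Q L" for a j using assms that by (simp add: unit_def)
  then have "unit k i i \<in> vanishing Q"
    using unit_in_level unfolding vanishing_def levels_def by blast
  then have "unit k i i \<in> mclosure (vanishing Q)"
    using mclosure_subset[of "vanishing Q"] bmat by (auto simp: vanishing_def)
  then have "unit k i i i i = 0" using * by simp
  then show False by (simp add: unit_def R_refl E_refl)
qed

lemma vanishing_conj:
  assumes bij: "bij \<tau>" and lev: "\<And>b. b \<in> levels \<Longrightarrow> mconj \<tau> b \<in> levels"
    and Q: "\<And>L. \<exists>M. \<forall>j\<in>Q M. \<tau> j \<in> Q L" and a: "a \<in> mclosure (vanishing Q)"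
  shows "mconj \<tau> a \<in> mclosure (vanishing Q)"
proof (rule mclosure_conj[OF bij _ a])
  fix x assume x: "x \<in> vanishing Q"
  then obtain L where L: "\<forall>j\<in>Q L. \<forall>i. x i j = 0" by (auto simp: vanishing_def)
  obtain M where "\<forall>j\<in>Q M. \<tau> j \<in> Q L" using Q by blast
  then have "\<forall>j\<in>Q M. \<forall>i. mconj \<tau> x i j = 0" using L by (auto simp: mconj_apply)
  then show "mconj \<tau> x \<in> vanishing Q" using x lev unfolding vanishing_def by blast
qed

end

section \<open>Irreducible representations on orbits\<close>

lemma infsum_nonzeroE:
  fixes f :: "nat \<Rightarrow> complex"
  assumes "(\<Sum>\<^sub>\<infinity>j. f j) \<noteq> 0"
  obtains j where "f j \<noteq> 0"
proof -
  have "\<exists>j. f j \<noteq> 0"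
  proof (rule ccontr)
    assume "\<not> ?thesis"
    then have "f = (\<lambda>_. 0)" by (intro ext) simp
    then show False using assms by simp
  qed
  then show thesis using that by blast
qed

text \<open>
  \<open>\<ell>\<^sup>2(X)\<close> as the bounded matrices that are supported in column \<open>0\<close> and in rows from \<open>X\<close>. The
  representation is then matrix multiplication, and its laws, as well as completeness, are those of
  bounded matrices.
\<close>

definition column_space :: "nat set \<Rightarrow> cmat hilbert" where
  "column_space X = \<lparr>carrier = {x. bmat x \<and> (\<forall>i j. x i j \<noteq> 0 \<longrightarrow> i \<in> X \<and> j = 0)},
     monoid.mult = mmult, one = 0, zero = 0, add = (+), smult = msmult,
     cinner = \<lambda>x y. (mstar y \<star> x) 0 0\<rparr>"

lemma column_space_simps [simp]:
  "zero (column_space X) = 0" "add (column_space X) = (+)" "smult (column_space X) = msmult"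
  "cinner (column_space X) x y = (mstar y \<star> x) 0 0"
  by (simp_all add: column_space_def)

lemma columnI: "bmat x \<Longrightarrow> (\<And>i j. x i j \<noteq> 0 \<Longrightarrow> i \<in> X \<and> j = 0) \<Longrightarrow> x \<in> carrier (column_space X)"
  by (simp add: column_space_def)

lemma column_bmat: "x \<in> carrier (column_space X) \<Longrightarrow> bmat x"
  by (simp add: column_space_def)

lemma columnD: "x \<in> carrier (column_space X) \<Longrightarrow> x i j \<noteq> 0 \<Longrightarrow> i \<in> X \<and> j = 0"
  by (simp add: column_space_def)

lemma column_zero: "x \<in> carrier (column_space X) \<Longrightarrow> \<not> (i \<in> X \<and> j = 0) \<Longrightarrow> x i j = 0"
  using columnD[of x X i j] by blast

lemma matrix_space_column_space: "matrix_space (column_space X)"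
proof
  show "x \<in> carrier (column_space X)"
    if "bmat x" and lim: "\<And>\<epsilon>. \<epsilon> > 0 \<Longrightarrow> \<exists>y\<in>carrier (column_space X). mbound (x - y) \<epsilon>" for x
  proof -
    have "x i j = 0" if "\<not> (i \<in> X \<and> j = 0)" for i j
    proof -
      have "cmod (x i j) \<le> \<epsilon>" if e: "\<epsilon> > 0" for \<epsilon>
      proof -
        obtain y where y: "y \<in> carrier (column_space X)" "mbound (x - y) \<epsilon>" using lim[OF e] by blast
        then have "y i j = 0" using column_zero[OF y(1)] \<open>\<not> (i \<in> X \<and> j = 0)\<close> by blast
        then show ?thesis using mbound_entry[OF y(2), of i j] by simp
      qed
      then have "cmod (x i j) \<le> 0" by (rule field_le_epsilon[of _ 0, simplified])
      then show ?thesis by simp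
    qed
    then show ?thesis using \<open>bmat x\<close> by (intro columnI) blast+
  qed
  show "x + y \<in> carrier (column_space X)"
    if xy: "x \<in> carrier (column_space X)" "y \<in> carrier (column_space X)" for x y
  proof -
    have "i \<in> X \<and> j = 0" if "(x + y) i j \<noteq> 0" for i j
    proof -
      have "x i j \<noteq> 0 \<or> y i j \<noteq> 0" using that by auto
      then show ?thesis
        using columnD[OF xy(1), of i j] columnD[OF xy(2), of i j] by blast
    qed
    then show ?thesis by (intro columnI bmat_add column_bmat[OF xy(1)] column_bmat[OF xy(2)])
  qed
  show "msmult c x \<in> carrier (column_space X)" if "x \<in> carrier (column_space X)" for c x
  proof (rule columnI)
    show "bmat (msmult c x)" by (rule bmat_smult[OF column_bmat[OF that]])
    show "i \<in> X \<and> j = 0" if "msmult c x i j \<noteq> 0" for i j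
      using columnD[OF \<open>x \<in> carrier (column_space X)\<close>, of i j] that by (simp add: msmult_apply)
  qed
  show "0 \<in> carrier (column_space X)" by (rule columnI[OF bmat_zero]) simp
qed (auto intro: column_bmat)

interpretation column_space: matrix_space "column_space X" for X
  by (rule matrix_space_column_space)

text \<open>
  The matrix \<open>x\<^sup>* x\<close> has a single nonzero entry, the square of the Hilbert space norm, and the
  C*-identity equates it with the square of the operator norm.
\<close>

lemma column_product:
  assumes x: "x \<in> carrier (column_space X)"
  shows "Re ((mstar x \<star> x) 0 0) = (mnorm x)\<^sup>2" "Re ((mstar x \<star> x) 0 0) \<ge> 0"
proof -
  let ?z = "(mstar x \<star> x) 0 0"
  have bx: "bmat x" using x by (rule column_bmat)
  have hs: "((\<lambda>i. cnj (x i 0) * x i 0) has_sum ?z) UNIV"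
    using mmult_has_sum[OF bmat_star[OF bx] bx, of 0 0] by (simp add: mstar_def)
  then have hs: "((\<lambda>i. complex_of_real ((cmod (x i 0))\<^sup>2)) has_sum ?z) UNIV"
    unfolding cmod_square .
  have "((\<lambda>i. (cmod (x i 0))\<^sup>2) has_sum Re ?z) UNIV"
    using has_sum_Re[OF hs] unfolding Re_complex_of_real .
  then show nonneg: "Re ?z \<ge> 0" by (rule has_sum_nonneg) simp
  have "((\<lambda>i::nat. 0) has_sum Im ?z) UNIV"
    using has_sum_Im[OF hs] unfolding Im_complex_of_real .
  then have "Im ?z = 0" using has_sum_unique[OF has_sum_0_simp] by metis
  then have cz: "cmod ?z = Re ?z" using nonneg by (simp add: cmod_def)
  have b: "bmat (mstar x \<star> x)" using bx by (intro bmat_mult bmat_star)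
  have other: "(mstar x \<star> x) i j = 0" if "i \<noteq> 0 \<or> j \<noteq> 0" for i j
  proof (rule ccontr)
    assume "(mstar x \<star> x) i j \<noteq> 0"
    then obtain w where "mstar x i w * x w j \<noteq> 0" unfolding mmult_def by (rule infsum_nonzeroE)
    then have "x w i \<noteq> 0" "x w j \<noteq> 0" by (auto simp: mstar_def)
    then show False using columnD[OF x] that by blast
  qed
  have "mbound (mstar x \<star> x) (cmod ?z)"
  proof (rule single_row_bound[of _ 0])
    fix F :: "nat set" assume F: "finite F"
    have "l2 ((mstar x \<star> x) 0) F \<le> (\<Sum>j\<in>F. \<bar>cmod ((mstar x \<star> x) 0 j)\<bar>)" by (rule L2_set_le_sum_abs)
    also have "\<dots> \<le> (\<Sum>j\<in>insert 0 F. \<bar>cmod ((mstar x \<star> x) 0 j)\<bar>)" using F by (intro sum_mono2) auto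
    also have "\<dots> = \<bar>cmod ?z\<bar>" using F other by (intro sum_single) auto
    finally show "l2 ((mstar x \<star> x) 0) F \<le> cmod ?z" by simp
  qed (use other in auto)
  then have "mnorm (mstar x \<star> x) = cmod ?z"
    using mnorm_le mnorm_entry[OF b, of 0 0] by (intro antisym)
  then show "Re ?z = (mnorm x)\<^sup>2" using mnorm_cstar[OF bx] cz by simp
qed

lemma hnorm_column_space: "x \<in> carrier (column_space X) \<Longrightarrow> hnorm (column_space X) x = mnorm x"
  using column_product(1)[of x X] mnorm_nonneg[of x] column_bmat[of x X] by (simp add: hnorm_def)

lemma norm_dist_column_space:
  "norm_dist (column_space X) (hnorm (column_space X)) = norm_dist (column_space X) mnorm"
proof (intro ext)
  fix x y
  show "norm_dist (column_space X) (hnorm (column_space X)) x y = norm_dist (column_space X) mnorm x y"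
  proof (cases "x \<in> carrier (column_space X) \<and> y \<in> carrier (column_space X)")
    case True
    then have "x \<ominus>\<^bsub>column_space X\<^esub> y \<in> carrier (column_space X)"
      using column_space.a_minus_V column_space.diff_in by metis
    then show ?thesis unfolding norm_dist_def by (simp only: hnorm_column_space)
  next
    case False
    then show ?thesis unfolding norm_dist_def by (simp only: if_False)
  qed
qed

lemma hilbert_space_column_space: "hilbert_space (column_space X)"
proof (intro hilbert_space.intro complex_inner_space.intro column_space.module_V
    complex_inner_space_axioms.intro hilbert_space_axioms.intro)
  let ?H = "column_space X"
  show "Metric_space.mcomplete (carrier ?H) (norm_dist ?H (hnorm ?H))"
    unfolding norm_dist_column_space by (rule column_space.complete_V)
  fix u v w c
  assume u: "u \<in> carrier ?H"
  show "Re (cinner ?H u u) \<ge> 0" using column_product(2)[OF u] by simp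
  show "u = \<zero>\<^bsub>?H\<^esub>" if "cinner ?H u u = 0"
    using that column_product(1)[OF u] mnorm_eq_0_iff[OF column_bmat[OF u]] by simp
  assume v: "v \<in> carrier ?H"
  show "cinner ?H (c \<odot>\<^bsub>?H\<^esub> u) v = c * cinner ?H u v"
    using u v mmult_smult_right[of "mstar v" u c] by (simp add: bmat_star msmult_apply column_bmat)
  have "mstar (mstar v \<star> u) = mstar u \<star> v" using u v by (simp add: mstar_mult bmat_star column_bmat)
  then show "cinner ?H v u = cnj (cinner ?H u v)" unfolding column_space_simps mstar_def by metis
  assume w: "w \<in> carrier ?H"
  show "cinner ?H (u \<oplus>\<^bsub>?H\<^esub> v) w = cinner ?H u w + cinner ?H v w"
    using u v w mmult_add_right[of u v "mstar w"] by (simp add: bmat_star column_bmat)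
qed

definition basis_column :: "nat \<Rightarrow> cmat" where
  "basis_column y = (\<lambda>i j. if i = y \<and> j = 0 then 1 else 0)"

lemma basis_column_in: "y \<in> X \<Longrightarrow> basis_column y \<in> carrier (column_space X)"
proof -
  assume "y \<in> X"
  moreover have "mbound (basis_column y) 1"
    by (rule mbound_partial_permutation) (auto simp: basis_column_def split: if_splits)
  ultimately show ?thesis
    by (intro columnI bmatI[of _ 1]) (auto simp: basis_column_def split: if_splits)
qed

lemma mult_basis_column: "(a \<star> basis_column y) i j = (if j = 0 then a i y else 0)"
  by (subst mmult_finite_right[of "{y}"]) (auto simp: basis_column_def)

definition restrict_rows :: "nat set \<Rightarrow> cmat \<Rightarrow> cmat" where
  "restrict_rows J v = (\<lambda>i j. if i \<in> J then v i j else 0)"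

lemma restrict_rows_apply: "restrict_rows J v i j = (if i \<in> J then v i j else 0)"
  by (simp add: restrict_rows_def)

lemma restrict_rows_empty: "restrict_rows {} v = 0"
  by (intro ext) (simp add: restrict_rows_apply)

lemma restrict_rows_insert_orbit:
  assumes v: "v \<in> carrier (column_space X)" and a: "a \<notin> J"
  shows "restrict_rows (insert a J) v = restrict_rows J v + msmult (v a 0) (basis_column a)"
proof (intro ext)
  fix i j
  have "v i j = 0" if "j \<noteq> 0" by (rule column_zero[OF v]) (simp add: that)
  then show "restrict_rows (insert a J) v i j = (restrict_rows J v + msmult (v a 0) (basis_column a)) i j"
    using a by (auto simp: restrict_rows_apply msmult_apply basis_column_def)
qed

lemma restrict_rows_insert_other:
  assumes v: "v \<in> carrier (column_space X)" and a: "a \<notin> X"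
  shows "restrict_rows (insert a J) v = restrict_rows J v"
proof (intro ext)
  fix i j
  have "v a j = 0" by (rule column_zero[OF v]) (simp add: a)
  then show "restrict_rows (insert a J) v i j = restrict_rows J v i j" by (auto simp: restrict_rows_apply)
qed

text \<open>
  The set \<open>X\<close> is one orbit of the union of all \<open>R k\<close>. That windows separate points makes each single
  basis vector the limit of its windows.
\<close>

locale af_orbit = af_system +
  fixes X :: "nat set"
  assumes separating: "i \<noteq> j \<Longrightarrow> \<exists>k. \<not> E k i j"
    and nonempty: "X \<noteq> {}"
    and saturated: "i \<in> X \<Longrightarrow> R k i j \<Longrightarrow> j \<in> X"
    and transitive: "i \<in> X \<Longrightarrow> j \<in> X \<Longrightarrow> \<exists>k. R k i j"
begin

abbreviation H :: "cmat hilbert" where "H \<equiv> column_space X"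

lemma mult_in_H:
  assumes a: "a \<in> mclosure levels" and v: "v \<in> carrier H" shows "a \<star> v \<in> carrier H"
proof -
  have "i \<in> X \<and> j = 0" if nz: "(a \<star> v) i j \<noteq> 0" for i j
  proof -
    obtain w where "a i w * v w j \<noteq> 0" using nz unfolding mmult_def by (rule infsum_nonzeroE)
    then have w: "a i w \<noteq> 0" "v w j \<noteq> 0" by auto
    have "w \<in> X" "j = 0" using columnD[OF v w(2)] by blast+
    moreover obtain k where "R k i w" using A_R[OF a w(1)] by blast
    ultimately show ?thesis using saturated R_sym by blast
  qed
  moreover have "bmat (a \<star> v)" by (rule bmat_mult[OF mclosure_bmat[OF a] column_bmat[OF v]])
  ultimately show ?thesis by (intro columnI)
qed

lemma star_representation_H: "star_representation A H mmult"
proof (intro star_representation.intro unital_cstar_algebra_A hilbert_space_column_space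
    star_representation_axioms.intro)
  fix a b v w c
  assume a: "a \<in> carrier A"
  then have ba: "bmat a" and aA: "a \<in> mclosure levels" by (auto intro: mclosure_bmat)
  show "\<exists>K. \<forall>v\<in>carrier H. hnorm H (a \<star> v) \<le> K * hnorm H v"
  proof (intro exI ballI)
    fix v assume v: "v \<in> carrier H"
    then have "bmat v" by (rule column_bmat)
    then show "hnorm H (a \<star> v) \<le> mnorm a * hnorm H v"
      unfolding hnorm_column_space[OF v] hnorm_column_space[OF mult_in_H[OF aA v]] by (rule mnorm_mult[OF ba])
  qed
  assume v: "v \<in> carrier H"
  then have bv: "bmat v" by (rule column_bmat)
  show "a \<star> v \<in> carrier H" by (rule mult_in_H[OF aA v])
  show "a \<star> (c \<odot>\<^bsub>H\<^esub> v) = c \<odot>\<^bsub>H\<^esub> (a \<star> v)" using ba bv by (simp add: mmult_smult_right)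
  show "(c \<odot>\<^bsub>A\<^esub> a) \<star> v = c \<odot>\<^bsub>H\<^esub> (a \<star> v)" using ba bv by (simp add: mmult_smult_left)
  show "a \<star> (v \<oplus>\<^bsub>H\<^esub> w) = a \<star> v \<oplus>\<^bsub>H\<^esub> a \<star> w" if "w \<in> carrier H"
    using ba bv that by (simp add: mmult_add_right column_bmat)
  show "cinner H (star A a \<star> v) w = cinner H v (a \<star> w)" if "w \<in> carrier H"
    using ba bv that mmult_assoc[of "mstar w" "mstar a" v] by (simp add: mstar_mult bmat_star column_bmat)
  assume b: "b \<in> carrier A"
  then have bb: "bmat b" by (auto intro: mclosure_bmat)
  show "(a \<oplus>\<^bsub>A\<^esub> b) \<star> v = a \<star> v \<oplus>\<^bsub>H\<^esub> b \<star> v" using ba bb bv by (simp add: mmult_add_left)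
  show "(a \<otimes>\<^bsub>A\<^esub> b) \<star> v = a \<star> (b \<star> v)" using ba bb bv by (simp add: mmult_assoc)
qed

lemma rep_kernel_H: "rep_kernel A H mmult = {a \<in> mclosure levels. \<forall>j\<in>X. \<forall>i. a i j = 0}"
proof (intro equalityI subsetI)
  fix a assume a: "a \<in> rep_kernel A H mmult"
  have "a i j = 0" if "j \<in> X" for i j
  proof -
    have "a \<star> basis_column j = 0"
      using a basis_column_in[OF that] unfolding rep_kernel_def by simp
    then have "(a \<star> basis_column j) i 0 = 0" by simp
    then show ?thesis by (simp add: mult_basis_column)
  qed
  then show "a \<in> {a \<in> mclosure levels. \<forall>j\<in>X. \<forall>i. a i j = 0}"
    using a by (simp add: rep_kernel_def)
next
  fix a assume a: "a \<in> {a \<in> mclosure levels. \<forall>j\<in>X. \<forall>i. a i j = 0}"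
  have "a \<star> v = 0" if v: "v \<in> carrier H" for v
  proof (intro ext)
    fix i j
    have "(a \<star> v) i j = 0"
    proof (rule ccontr)
      assume "(a \<star> v) i j \<noteq> 0"
      then obtain w where "a i w * v w j \<noteq> 0" unfolding mmult_def by (rule infsum_nonzeroE)
      then have "a i w \<noteq> 0" "w \<in> X" using columnD[OF v] by auto
      then show False using a by auto
    qed
    then show "(a \<star> v) i j = 0 i j" by simp
  qed
  then show "a \<in> rep_kernel A H mmult" using a by (simp add: rep_kernel_def)
qed

text \<open>
  The projections of the windows around \<open>y\<close> decrease to the projection onto the basis vector at
  \<open>y\<close>. So a closed invariant subspace with a vector that is not orthogonal to this basis vector
  contains it, and the matrix units then yield all basis vectors of the orbit.
\<close>

lemma basis_column_in_subspace:
  assumes W: "submodule W complex_ring H" "closedin (norm_topology H mnorm) W"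
    and inv: "\<And>a v. a \<in> mclosure levels \<Longrightarrow> v \<in> W \<Longrightarrow> a \<star> v \<in> W"
    and x: "x \<in> W" "x y 0 \<noteq> 0"
  shows "basis_column y \<in> W"
proof -
  have xH: "x \<in> carrier H" using column_space.submoduleD(1)[OF W(1)] x(1) by blast
  then have yX: "y \<in> X" using columnD[OF xH x(2)] by blast
  obtain K where K: "mbound x K" using column_bmat[OF xH] by (auto simp: bmat_def)
  let ?d = "msmult (x y 0) (basis_column y)"
  have dH: "?d \<in> carrier H" using column_space.smult_in[OF basis_column_in[OF yX]] .
  have "?d \<in> W"
  proof -
    have "\<exists>v\<in>W. mbound (?d - v) \<epsilon>" if e: "\<epsilon> > 0" for \<epsilon>
    proof -
      obtain J where J: "finite J" "\<And>F. finite F \<Longrightarrow> F \<inter> J = {} \<Longrightarrow> l2 (\<lambda>i. x i 0) F \<le> \<epsilon>"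
        using tail_small[OF column_summable[OF K] e] by blast
      have "\<forall>j. \<exists>k. j \<noteq> y \<longrightarrow> \<not> E k j y" using separating by blast
      then obtain f where f: "\<And>j. j \<noteq> y \<Longrightarrow> \<not> E (f j) j y" by metis
      define k where "k = Max (insert 0 (f ` J))"
      have sep: "\<not> E k j y" if "j \<in> J" "j \<noteq> y" for j
      proof -
        have "f j \<le> k" unfolding k_def using J(1) that(1) by (intro Max_ge) auto
        then show ?thesis using E_mono f[OF that(2)] by blast
      qed
      let ?v = "unit k y y \<star> x"
      have v: "?v i j = (if E k i y then x i j else 0)" for i j
        unfolding unit_eq_diag by (rule mmult_diag_left)
      have entry: "(?v - ?d) i 0 = (if i \<noteq> y \<and> E k i y then x i 0 else 0)" for i
        using E_refl by (simp add: v msmult_apply basis_column_def)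
      have "mbound (?v - ?d) \<epsilon>"
      proof (rule single_column_bound[of \<epsilon> 0])
        fix F :: "nat set" assume F: "finite F"
        let ?F = "{i \<in> F. i \<noteq> y \<and> E k i y}"
        have "l2 (\<lambda>i. (?v - ?d) i 0) F = L2_set (\<lambda>i. cmod (if i \<in> ?F then x i 0 else 0)) F"
          unfolding entry by (rule L2_set_cong) auto
        also have "\<dots> = l2 (\<lambda>i. x i 0) ?F" using F by (intro L2_set_extend) auto
        also have "\<dots> \<le> \<epsilon>" using F sep by (intro J(2)) auto
        finally show "l2 (\<lambda>i. (?v - ?d) i 0) F \<le> \<epsilon>" .
      next
        fix i j' :: nat assume j': "j' \<noteq> 0"
        have "x i j' = 0" by (rule column_zero[OF xH]) (simp add: j')
        then have "?v i j' = 0" unfolding v by simp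
        moreover have "?d i j' = 0" using j' by (simp add: msmult_apply basis_column_def)
        ultimately show "(?v - ?d) i j' = 0" by simp
      qed (use e in simp)
      then have "mbound (?d - ?v) \<epsilon>" by (rule mbound_minus_commute)
      then show ?thesis using inv[OF unit_in_A x(1)] by blast
    qed
    then show ?thesis using W(2) dH unfolding column_space.closedin_V by blast
  qed
  then have "msmult (inverse (x y 0)) ?d \<in> W" by (rule column_space.submoduleD(4)[OF W(1)])
  then show ?thesis using x(2) by (simp add: msmult_msmult)
qed

lemma irreducible_H: "irreducible_rep A H mmult"
  unfolding irreducible_rep_def
proof (intro conjI allI impI star_representation_H)
  obtain y where y: "y \<in> X" using nonempty by blast
  have "mone y y \<noteq> 0" by (simp add: mone_def)
  then have "mone \<notin> rep_kernel A H mmult" using y by (auto simp: rep_kernel_H)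
  then show "rep_kernel A H mmult \<noteq> carrier A" using one_in_A by auto
  fix W assume sub: "submodule W complex_ring H" and cl: "closedin (norm_topology H (hnorm H)) W"
    and inv: "\<forall>a\<in>carrier A. \<forall>v\<in>W. a \<star> v \<in> W"
  have cl': "closedin (norm_topology H mnorm) W"
    using cl unfolding norm_topology_def norm_dist_column_space .
  have inv': "a \<star> v \<in> W" if "a \<in> mclosure levels" "v \<in> W" for a v using inv that by simp
  note W = column_space.submoduleD[OF sub]
  show "W = {\<zero>\<^bsub>H\<^esub>} \<or> W = carrier H"
  proof (rule disjCI)
    assume "W \<noteq> carrier H"
    show "W = {\<zero>\<^bsub>H\<^esub>}"
    proof (rule ccontr)
      assume "W \<noteq> {\<zero>\<^bsub>H\<^esub>}"
      then have "W \<noteq> {0}" by simp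
      then obtain x where x: "x \<in> W" "x \<noteq> 0" using W(2) by blast
      then obtain y j where "x y j \<noteq> 0" by (auto simp: fun_eq_iff)
      moreover have xH: "x \<in> carrier H" using W(1) x(1) by blast
      ultimately have "y \<in> X \<and> j = 0" by (intro columnD[OF xH])
      with \<open>x y j \<noteq> 0\<close> have y: "y \<in> X" "x y 0 \<noteq> 0" by auto
      have dy: "basis_column y \<in> W" by (rule basis_column_in_subspace[OF sub cl' inv' x(1) y(2)])
      have dz: "basis_column z \<in> W" if z: "z \<in> X" for z
      proof -
        obtain k where k: "R k y z" using transitive[OF y(1) z] by blast
        have "unit k z y \<star> basis_column y = basis_column z"
        proof (intro ext)
          fix i j
          have h: "unit k z y i y = (if i = z then 1 else 0)"
            using unique_in_class[of k y i z z] k R_sym[OF k] R_sym[of k i y] E_refl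
            by (auto simp: unit_def)
          show "(unit k z y \<star> basis_column y) i j = basis_column z i j"
            unfolding mult_basis_column h by (simp add: basis_column_def)
        qed
        then show ?thesis using inv'[OF unit_in_A[of k z y] dy] by simp
      qed
      have fin: "restrict_rows J v \<in> W" if "finite J" and v: "v \<in> carrier H" for v J
        using that(1)
      proof (induction J rule: finite_induct)
        case empty
        show ?case unfolding restrict_rows_empty by (rule W(2))
      next
        case (insert a J)
        show ?case
        proof (cases "a \<in> X")
          case True
          show ?thesis
            unfolding restrict_rows_insert_orbit[OF v insert.hyps(2)] by (rule W(3)[OF insert.IH W(4)[OF dz[OF True]]])
        next
          case False
          show ?thesis unfolding restrict_rows_insert_other[OF v False] by (rule insert.IH)
        qed
      qed
      have "v \<in> W" if v: "v \<in> carrier H" for v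
      proof -
        obtain K where K: "mbound v K" using column_bmat[OF v] by (auto simp: bmat_def)
        have "\<exists>w\<in>W. mbound (v - w) \<epsilon>" if e: "\<epsilon> > 0" for \<epsilon>
        proof -
          obtain J where J: "finite J" "\<And>F. finite F \<Longrightarrow> F \<inter> J = {} \<Longrightarrow> l2 (\<lambda>i. v i 0) F \<le> \<epsilon>"
            using tail_small[OF column_summable[OF K] e] by blast
          let ?w = "restrict_rows J v"
          have "mbound (v - ?w) \<epsilon>"
          proof (rule single_column_bound[of \<epsilon> 0])
            fix F :: "nat set" assume F: "finite F"
            have "l2 (\<lambda>i. (v - ?w) i 0) F = L2_set (\<lambda>i. cmod (if i \<in> F - J then v i 0 else 0)) F"
              by (rule L2_set_cong) (auto simp: restrict_rows_apply)
            also have "\<dots> = l2 (\<lambda>i. v i 0) (F - J)" using F by (intro L2_set_extend) auto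
            also have "\<dots> \<le> \<epsilon>" using F by (intro J(2)) auto
            finally show "l2 (\<lambda>i. (v - ?w) i 0) F \<le> \<epsilon>" .
          next
            fix i j' :: nat assume j': "j' \<noteq> 0"
            have "v i j' = 0" by (rule column_zero[OF v]) (simp add: j')
            then show "(v - ?w) i j' = 0" by (simp add: restrict_rows_apply)
          qed (use e in simp)
          then show ?thesis using fin[OF J(1) v] by blast
        qed
        then show ?thesis using cl' v unfolding column_space.closedin_V by blast
      qed
      then have "W = carrier H" using W(1) by blast
      then show False using \<open>W \<noteq> carrier H\<close> by contradiction
    qed
  qed
qed

lemma kernel_in_Prim: "{a \<in> mclosure levels. \<forall>j\<in>X. \<forall>i. a i j = 0} \<in> Prim A"
  unfolding Prim_def rep_kernel_H[symmetric]
  by (rule CollectI, rule exI[of _ H], rule exI[of _ mmult]) (simp add: irreducible_H)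

end

section \<open>Configurations on a group\<close>

lemma trunc_mono:
  fixes a b c d :: "'a :: linorder"
  shows "min a c = min b c \<Longrightarrow> d \<le> c \<Longrightarrow> min a d = min b d"
  by (auto simp: min_def split: if_splits)

lemma trunc_eq: "min a (enat (Suc k)) = min b (enat (Suc k)) \<Longrightarrow> b \<le> enat k \<Longrightarrow> a = b"
  by (cases a; cases b) (auto simp: min_def split: if_splits)

locale length_group = group G for G :: "('g :: countable, 'm) monoid_scheme" (structure) +
  fixes len :: "'g \<Rightarrow> nat"
  assumes len_eq_0: "s \<in> carrier G \<Longrightarrow> len s = 0 \<longleftrightarrow> s = \<one>"
    and len_inv: "s \<in> carrier G \<Longrightarrow> len (inv s) = len s"
    and len_mult: "s \<in> carrier G \<Longrightarrow> t \<in> carrier G \<Longrightarrow> len (s \<otimes> t) \<le> len s + len t"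
    and finite_ball: "finite {s \<in> carrier G. len s \<le> k}"
begin

definition gball :: "nat \<Rightarrow> 'g set" where
  "gball k = {s \<in> carrier G. len s \<le> k}"

definition gdist :: "'g \<Rightarrow> 'g \<Rightarrow> nat" where
  "gdist s t = len (inv s \<otimes> t)"

text \<open>
  The inequality \<open>t s\<^sup>-\<^sup>1 u \<noteq> u s\<^sup>-\<^sup>1 t\<close> says that \<open>s\<^sup>-\<^sup>1 t\<close> and \<open>s\<^sup>-\<^sup>1 u\<close> do not commute, in a form that is
  obviously invariant under left translation. A bound that grows with the distances keeps the
  condition local: it can fail because of a value \<open>v\<close> only within distance \<open>v\<close>.
\<close>

definition spread_out :: "('g \<Rightarrow> enat) \<Rightarrow> bool" where
  "spread_out y \<longleftrightarrow> (\<forall>s\<in>carrier G. \<forall>t\<in>carrier G. \<forall>u\<in>carrier G. t \<otimes> inv s \<otimes> u \<noteq> u \<otimes> inv s \<otimes> t \<longrightarrow>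
     \<not> (enat (gdist s t + gdist s u) < y s \<and> enat (gdist s t + gdist s u) < y t \<and> enat (gdist s t + gdist s u) < y u))"

text \<open>
  Finite support makes the set countable. At most one infinite value is allowed, so that an
  orbit of moves is determined by the place of the infinite value, if there is one.
\<close>

definition configs :: "('g \<Rightarrow> enat) set" where
  "configs = {y. (\<forall>s. s \<notin> carrier G \<longrightarrow> y s = 0) \<and> finite {s. y s \<noteq> 0} \<and>
     (\<forall>s t. y s = \<infinity> \<longrightarrow> y t = \<infinity> \<longrightarrow> s = t) \<and> spread_out y}"

definition move :: "nat \<Rightarrow> ('g \<Rightarrow> enat) \<Rightarrow> ('g \<Rightarrow> enat) \<Rightarrow> bool" where
  "move k y x \<longleftrightarrow> (\<forall>s. y s = x s \<or> s \<in> gball k \<and> y s \<le> enat k \<and> x s \<le> enat k)"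

text \<open>
  Values above \<open>k\<close> are not told apart. The radius is \<open>2 * k\<close>, twice that of \<open>move\<close>, because a constraint
  on a value up to \<open>k\<close> at a site of length up to \<open>k\<close> can involve sites at distance \<open>k\<close> from it.
\<close>

definition agree :: "nat \<Rightarrow> ('g \<Rightarrow> enat) \<Rightarrow> ('g \<Rightarrow> enat) \<Rightarrow> bool" where
  "agree k y x \<longleftrightarrow> (\<forall>s\<in>gball (2 * k). min (y s) (enat (Suc k)) = min (x s) (enat (Suc k)))"

definition shift :: "'g \<Rightarrow> ('g \<Rightarrow> enat) \<Rightarrow> 'g \<Rightarrow> enat" where
  "shift g y = (\<lambda>s. if s \<in> carrier G then y (g \<otimes> s) else 0)"

lemma cancel:
  assumes "g \<in> carrier G" "s \<in> carrier G"
  shows "g \<otimes> (inv g \<otimes> s) = s" "inv g \<otimes> (g \<otimes> s) = s"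
  using assms by (simp_all flip: m_assoc)

lemma ball_carrier: "s \<in> gball k \<Longrightarrow> s \<in> carrier G"
  by (simp add: gball_def)

lemma len_one: "len \<one> = 0"
  using len_eq_0[of \<one>] by simp

lemma dist_sym: "s \<in> carrier G \<Longrightarrow> t \<in> carrier G \<Longrightarrow> gdist s t = gdist t s"
  using len_inv[of "inv s \<otimes> t"] by (simp add: gdist_def inv_mult_group)

lemma dist_triangle:
  assumes "s \<in> carrier G" "t \<in> carrier G" "u \<in> carrier G"
  shows "gdist s u \<le> gdist s t + gdist t u"
proof -
  have "inv s \<otimes> u = (inv s \<otimes> t) \<otimes> (inv t \<otimes> u)"
    using assms by (simp add: m_assoc cancel)
  then show ?thesis using len_mult[of "inv s \<otimes> t" "inv t \<otimes> u"] assms by (simp add: gdist_def)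
qed

lemma len_le_dist: "s \<in> carrier G \<Longrightarrow> t \<in> carrier G \<Longrightarrow> len t \<le> len s + gdist s t"
  using dist_triangle[of \<one> s t] by (simp add: gdist_def)

lemma dist_shift: "g \<in> carrier G \<Longrightarrow> s \<in> carrier G \<Longrightarrow> t \<in> carrier G \<Longrightarrow> gdist (g \<otimes> s) (g \<otimes> t) = gdist s t"
  by (simp add: gdist_def inv_mult_group m_assoc cancel)

lemma spread_outI:
  assumes "\<And>s t u \<kappa>. s \<in> carrier G \<Longrightarrow> t \<in> carrier G \<Longrightarrow> u \<in> carrier G \<Longrightarrow>
     t \<otimes> inv s \<otimes> u \<noteq> u \<otimes> inv s \<otimes> t \<Longrightarrow> \<kappa> = gdist s t + gdist s u \<Longrightarrow>
     enat \<kappa> < y s \<Longrightarrow> enat \<kappa> < y t \<Longrightarrow> enat \<kappa> < y u \<Longrightarrow> False"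
  shows "spread_out y"
  unfolding spread_out_def by (intro ballI impI notI, elim conjE) (rule assms[OF _ _ _ _ refl])

lemma spread_outD:
  assumes "spread_out y" "s \<in> carrier G" "t \<in> carrier G" "u \<in> carrier G"
    "t \<otimes> inv s \<otimes> u \<noteq> u \<otimes> inv s \<otimes> t"
    "enat (gdist s t + gdist s u) < y s" "enat (gdist s t + gdist s u) < y t" "enat (gdist s t + gdist s u) < y u"
  shows False
  using assms unfolding spread_out_def by blast

lemma configsI:
  assumes "\<And>s. s \<notin> carrier G \<Longrightarrow> y s = 0" "finite {s. y s \<noteq> 0}"
    "\<And>s t. y s = \<infinity> \<Longrightarrow> y t = \<infinity> \<Longrightarrow> s = t" "spread_out y"
  shows "y \<in> configs"
  unfolding configs_def
  by (intro CollectI conjI allI impI assms(2,4), erule assms(1), erule (1) assms(3))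

lemma configsD:
  assumes "y \<in> configs"
  shows "s \<notin> carrier G \<Longrightarrow> y s = 0" "finite {s. y s \<noteq> 0}"
    "y s = \<infinity> \<Longrightarrow> y t = \<infinity> \<Longrightarrow> s = t" "spread_out y"
  using assms unfolding configs_def by blast+

text \<open>
  The bound in the constraint dominates the distance between any two of the three sites, also
  that between \<open>t\<close> and \<open>u\<close>, by the triangle inequality through \<open>s\<close>.
\<close>

lemma triple_near:
  assumes "s \<in> carrier G" "t \<in> carrier G" "u \<in> carrier G" "v \<in> {s, t, u}" "w \<in> {s, t, u}"
  shows "gdist v w \<le> gdist s t + gdist s u"
proof -
  have zero: "gdist s s = 0" "gdist t t = 0" "gdist u u = 0" using assms len_one by (simp_all add: gdist_def)
  have "gdist t u \<le> gdist s t + gdist s u" using dist_triangle[of t s u] dist_sym[of s t] assms by simp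
  then show ?thesis using assms(4,5) zero dist_sym[of s t] dist_sym[of s u] dist_sym[of t u] assms(1-3) by auto
qed

lemma moveI: "(\<And>s. y s \<noteq> x s \<Longrightarrow> s \<in> gball k \<and> y s \<le> enat k \<and> x s \<le> enat k) \<Longrightarrow> move k y x"
  unfolding move_def by blast

lemma moveD: "move k y x \<Longrightarrow> y s \<noteq> x s \<Longrightarrow> s \<in> gball k \<and> y s \<le> enat k \<and> x s \<le> enat k"
  unfolding move_def by blast

lemma ball_mono: "k \<le> m \<Longrightarrow> gball k \<subseteq> gball m" by (auto simp: gball_def)

lemma agreeD: "agree k y x \<Longrightarrow> s \<in> gball (2 * k) \<Longrightarrow> min (y s) (enat (Suc k)) = min (x s) (enat (Suc k))"
  by (simp add: agree_def)

lemma move_refl: "move k y y" by (simp add: move_def)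

lemma move_sym: "move k y x \<Longrightarrow> move k x y" unfolding move_def by metis

lemma move_trans: "move k y x \<Longrightarrow> move k x z \<Longrightarrow> move k y z" unfolding move_def by metis

lemma move_mono: "move k y x \<Longrightarrow> k \<le> m \<Longrightarrow> move m y x"
proof (rule moveI)
  fix s assume "move k y x" "k \<le> m" "y s \<noteq> x s"
  moreover from this have "s \<in> gball k" "y s \<le> enat k" "x s \<le> enat k" using moveD by blast+
  moreover have "enat k \<le> enat m" using \<open>k \<le> m\<close> by simp
  ultimately show "s \<in> gball m \<and> y s \<le> enat m \<and> x s \<le> enat m"
    using ball_mono[of k m] order_trans by blast
qed

lemma agree_refl: "agree k y y" by (simp add: agree_def)

lemma agree_sym: "agree k y x \<Longrightarrow> agree k x y" by (simp add: agree_def)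

lemma agree_trans: "agree k y x \<Longrightarrow> agree k x z \<Longrightarrow> agree k y z" by (simp add: agree_def)

lemma agree_mono: "agree m y x \<Longrightarrow> k \<le> m \<Longrightarrow> agree k y x"
  unfolding agree_def
proof
  fix s assume a: "\<forall>s\<in>gball (2 * m). min (y s) (enat (Suc m)) = min (x s) (enat (Suc m))" "k \<le> m" "s \<in> gball (2 * k)"
  then have "s \<in> gball (2 * m)" using ball_mono[of "2 * k" "2 * m"] by auto
  then have "min (y s) (enat (Suc m)) = min (x s) (enat (Suc m))" using a(1) by blast
  then show "min (y s) (enat (Suc k)) = min (x s) (enat (Suc k))" by (rule trunc_mono) (use a(2) in simp)
qed

lemma agree_eq: "agree k y x \<Longrightarrow> s \<in> gball (2 * k) \<Longrightarrow> x s \<le> enat k \<Longrightarrow> y s = x s"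
  by (rule trunc_eq[OF agreeD])

lemma move_agree_eq:
  assumes "move k y x" "agree k y x" shows "y = x"
proof
  fix s
  show "y s = x s"
  proof (cases "y s = x s")
    case False
    then have s: "s \<in> gball k" "x s \<le> enat k" using assms(1) by (auto simp: move_def)
    then show ?thesis using ball_mono[of k "2 * k"] agree_eq[OF assms(2)] by auto
  qed
qed

lemma finite_moves: "finite {x. move k y x}"
proof -
  let ?r = "\<lambda>x s. if s \<in> gball k then x s else (0 :: enat)"
  let ?V = "{..enat k} \<union> y ` gball k"
  have fb: "finite (gball k)" using finite_ball by (simp add: gball_def)
  have fV: "finite ?V" using fb finite_enat_bounded[of "{..enat k}" k] by auto
  have "?r ` {x. move k y x} \<subseteq> {f. \<forall>s. (s \<in> gball k \<longrightarrow> f s \<in> ?V) \<and> (s \<notin> gball k \<longrightarrow> f s = 0)}"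
  proof
    fix f assume "f \<in> ?r ` {x. move k y x}"
    then obtain x where x: "move k y x" "f = ?r x" by blast
    have "x s \<in> ?V" if "s \<in> gball k" for s
    proof (cases "y s = x s")
      case True then show ?thesis using that by (metis UnI2 imageI)
    next
      case False then show ?thesis using x(1) unfolding move_def by blast
    qed
    then show "f \<in> {f. \<forall>s. (s \<in> gball k \<longrightarrow> f s \<in> ?V) \<and> (s \<notin> gball k \<longrightarrow> f s = 0)}" using x(2) by simp
  qed
  then have "finite (?r ` {x. move k y x})"
    by (rule finite_subset) (rule finite_set_of_finite_funs[OF fb fV])
  moreover have "inj_on ?r {x. move k y x}"
  proof (rule inj_onI)
    fix x x' assume x: "x \<in> {x. move k y x}" "x' \<in> {x. move k y x}" "?r x = ?r x'"
    show "x = x'"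
    proof
      fix s
      show "x s = x' s"
      proof (cases "s \<in> gball k")
        case True then show ?thesis using fun_cong[OF x(3), of s] by simp
      next
        case False
        then have "y s = x s" "y s = x' s" using x(1,2) unfolding move_def by blast+
        then show ?thesis by simp
      qed
    qed
  qed
  ultimately show ?thesis by (rule finite_imageD)
qed

lemma finite_windows: "\<exists>T. finite T \<and> T \<subseteq> Y \<and> (\<forall>y\<in>Y. \<exists>t\<in>T. agree k y t)"
proof -
  let ?w = "\<lambda>y s. if s \<in> gball (2 * k) then min (y s) (enat (Suc k)) else 0"
  have fb: "finite (gball (2 * k))" using finite_ball by (simp add: gball_def)
  have fV: "finite {..enat (Suc k)}" using finite_enat_bounded[of "{..enat (Suc k)}" "Suc k"] by auto
  have "?w ` Y \<subseteq> {f. \<forall>s. (s \<in> gball (2 * k) \<longrightarrow> f s \<in> {..enat (Suc k)}) \<and> (s \<notin> gball (2 * k) \<longrightarrow> f s = 0)}"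
    by auto
  then have fin: "finite (?w ` Y)"
    by (rule finite_subset) (rule finite_set_of_finite_funs[OF fb fV])
  obtain T where T: "T \<subseteq> Y" "finite T" "?w ` Y = ?w ` T"
    using finite_subset_image[OF fin, of ?w Y] by blast
  have "\<exists>t\<in>T. agree k y t" if "y \<in> Y" for y
  proof -
    have "?w y \<in> ?w ` T" using that T(3) by blast
    then obtain t where t: "t \<in> T" "?w y = ?w t" by blast
    have "agree k y t"
      unfolding agree_def
    proof
      fix s assume "s \<in> gball (2 * k)"
      then show "min (y s) (enat (Suc k)) = min (t s) (enat (Suc k))" using fun_cong[OF t(2), of s] by simp
    qed
    then show ?thesis using t(1) by blast
  qed
  then show ?thesis using T by blast
qed

text \<open>
  The change from \<open>y\<close> to \<open>x\<close> is copied to \<open>y'\<close>. A constraint violated by the result involves either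
  no changed site, and is then violated by \<open>y'\<close>, or a changed one; in that case it takes place inside
  the window, and is violated by \<open>x\<close>.
\<close>

lemma configs_lift:
  assumes y: "y \<in> configs" and y': "y' \<in> configs" and x: "x \<in> configs"
    and yy': "agree k y y'" and yx: "move k y x"
  shows "\<exists>x'\<in>configs. move k y' x' \<and> agree k x x'"
proof -
  define C where "C = {s \<in> gball k. x s \<le> enat k}"
  define x' where "x' = (\<lambda>s. if s \<in> C then x s else y' s)"
  have inC: "s \<in> C \<Longrightarrow> y s \<le> enat k \<and> y' s = y s" for s
  proof -
    assume s: "s \<in> C"
    have 1: "y s \<le> enat k" using moveD[OF yx, of s] s by (cases "y s = x s") (auto simp: C_def)
    moreover have "s \<in> gball (2 * k)" using s ball_mono[of k "2 * k"] by (auto simp: C_def)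
    ultimately show ?thesis using agree_eq[OF agree_sym[OF yy']] by simp
  qed
  have outC: "s \<notin> C \<Longrightarrow> y s = x s" for s
    using moveD[OF yx, of s] by (auto simp: C_def)
  have move: "move k y' x'"
    unfolding move_def
  proof
    fix s show "y' s = x' s \<or> s \<in> gball k \<and> y' s \<le> enat k \<and> x' s \<le> enat k"
      using inC[of s] by (auto simp: x'_def C_def)
  qed
  have agree: "agree k x x'"
    unfolding agree_def
  proof
    fix s assume "s \<in> gball (2 * k)"
    then show "min (x s) (enat (Suc k)) = min (x' s) (enat (Suc k))"
      using yy' outC[of s] by (auto simp: x'_def agree_def)
  qed
  have "x' \<in> configs"
  proof (rule configsI)
    show "x' s = 0" if "s \<notin> carrier G" for s
      using configsD(1)[OF y' that] configsD(1)[OF x that] by (simp add: x'_def)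
    have "{s. x' s \<noteq> 0} \<subseteq> {s. x s \<noteq> 0} \<union> {s. y' s \<noteq> 0}" by (auto simp: x'_def)
    then show "finite {s. x' s \<noteq> 0}"
      using configsD(2)[OF x] configsD(2)[OF y'] by (meson finite_UnI finite_subset)
    have "y' s = \<infinity>" if "x' s = \<infinity>" for s using that by (auto simp: x'_def C_def split: if_splits)
    then show "s = t" if "x' s = \<infinity>" "x' t = \<infinity>" for s t using that configsD(3)[OF y'] by blast
    show "spread_out x'"
    proof (rule spread_outI)
      fix s t u \<kappa>
      assume stu: "s \<in> carrier G" "t \<in> carrier G" "u \<in> carrier G" "t \<otimes> inv s \<otimes> u \<noteq> u \<otimes> inv s \<otimes> t"
        and \<kappa>: "\<kappa> = gdist s t + gdist s u" and gt: "enat \<kappa> < x' s" "enat \<kappa> < x' t" "enat \<kappa> < x' u"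
      have gt': "enat \<kappa> < x' v" if "v \<in> {s, t, u}" for v using that gt by auto
      show False
      proof (cases "\<exists>v\<in>{s, t, u}. v \<in> C")
        case True
        then obtain v where v: "v \<in> {s, t, u}" "v \<in> C" by blast
        have "x' v \<le> enat k" "len v \<le> k" using v(2) by (auto simp: x'_def C_def gball_def)
        then have "enat \<kappa> < enat k" using gt'[OF v(1)] by (meson less_le_trans)
        then have k: "\<kappa> < k" by simp
        have "enat \<kappa> < x w" if w: "w \<in> {s, t, u}" for w
        proof -
          have vw: "v \<in> carrier G" "w \<in> carrier G" using v(1) w stu by auto
          have "len w \<le> len v + gdist v w" by (rule len_le_dist[OF vw])
          also have "\<dots> \<le> k + \<kappa>" using triple_near[OF stu(1-3) v(1) w] \<open>len v \<le> k\<close> \<kappa> by simp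
          finally have "w \<in> gball (2 * k)" using k vw by (simp add: gball_def)
          then have "min (x w) (enat (Suc k)) = min (x' w) (enat (Suc k))" using agree by (simp add: agree_def)
          moreover have "enat \<kappa> < min (x' w) (enat (Suc k))" using gt'[OF w] k by simp
          ultimately show ?thesis by (metis min_less_iff_conj)
        qed
        then show False using spread_outD[OF configsD(4)[OF x] stu] \<kappa> by blast
      next
        case False
        then have "enat \<kappa> < y' w" if "w \<in> {s, t, u}" for w using gt'[OF that] that by (auto simp: x'_def)
        then show False using spread_outD[OF configsD(4)[OF y'] stu] \<kappa> by blast
      qed
    qed
  qed
  then show ?thesis using move agree by blast
qed

lemma shift_one: "y \<in> configs \<Longrightarrow> shift \<one> y = y"
  using configsD(1) by (auto simp: shift_def fun_eq_iff)

lemma shift_mult: "g \<in> carrier G \<Longrightarrow> h \<in> carrier G \<Longrightarrow> shift (g \<otimes> h) y = shift h (shift g y)"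
  by (auto simp: shift_def fun_eq_iff m_assoc)

lemma shift_configs:
  assumes g: "g \<in> carrier G" and y: "y \<in> configs"
  shows "shift g y \<in> configs"
proof (rule configsI)
  have "{s. shift g y s \<noteq> 0} \<subseteq> (\<lambda>s. inv g \<otimes> s) ` {s. y s \<noteq> 0}"
  proof
    fix s assume "s \<in> {s. shift g y s \<noteq> 0}"
    then have "s \<in> carrier G" "y (g \<otimes> s) \<noteq> 0" by (auto simp: shift_def split: if_splits)
    moreover from this have "s = inv g \<otimes> (g \<otimes> s)" using g by (simp add: cancel)
    ultimately show "s \<in> (\<lambda>s. inv g \<otimes> s) ` {s. y s \<noteq> 0}" by blast
  qed
  then show "finite {s. shift g y s \<noteq> 0}" using configsD(2)[OF y] by (meson finite_imageI finite_subset)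
  show "s = t" if "shift g y s = \<infinity>" "shift g y t = \<infinity>" for s t
  proof -
    have st: "s \<in> carrier G" "t \<in> carrier G" "y (g \<otimes> s) = \<infinity>" "y (g \<otimes> t) = \<infinity>"
      using that by (auto simp: shift_def split: if_splits)
    then have "g \<otimes> s = g \<otimes> t" using configsD(3)[OF y] by blast
    then show ?thesis using st(1,2) g by simp
  qed
  show "spread_out (shift g y)"
  proof (rule spread_outI)
    fix s t u \<kappa>
    assume stu: "s \<in> carrier G" "t \<in> carrier G" "u \<in> carrier G" "t \<otimes> inv s \<otimes> u \<noteq> u \<otimes> inv s \<otimes> t"
      and \<kappa>: "\<kappa> = gdist s t + gdist s u"
      and gt: "enat \<kappa> < shift g y s" "enat \<kappa> < shift g y t" "enat \<kappa> < shift g y u"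
    have tr: "(g \<otimes> v) \<otimes> inv (g \<otimes> s) \<otimes> (g \<otimes> w) = g \<otimes> (v \<otimes> inv s \<otimes> w)"
      if "v \<in> carrier G" "w \<in> carrier G" for v w
    proof -
      have "inv (g \<otimes> s) \<otimes> (g \<otimes> w) = inv s \<otimes> w"
        using that stu g by (simp add: inv_mult_group m_assoc cancel)
      then show ?thesis using that stu g by (simp add: m_assoc)
    qed
    have "(g \<otimes> t) \<otimes> inv (g \<otimes> s) \<otimes> (g \<otimes> u) \<noteq> (g \<otimes> u) \<otimes> inv (g \<otimes> s) \<otimes> (g \<otimes> t)"
      using stu g by (simp add: tr)
    then show False
      using stu g gt \<kappa> by (intro spread_outD[OF configsD(4)[OF y], of "g \<otimes> s" "g \<otimes> t" "g \<otimes> u"])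
        (auto simp: dist_shift shift_def)
  qed
qed (simp add: shift_def)

lemma move_shift:
  assumes g: "g \<in> carrier G" and y: "y \<in> configs" "x \<in> configs" and m: "move k (shift g y) (shift g x)"
  shows "move (k + len g) y x"
  unfolding move_def
proof
  fix s
  show "y s = x s \<or> s \<in> gball (k + len g) \<and> y s \<le> enat (k + len g) \<and> x s \<le> enat (k + len g)"
  proof (cases "s \<in> carrier G")
    case True
    have gs: "g \<otimes> (inv g \<otimes> s) = s" using True g by (simp add: cancel)
    have v: "shift g z (inv g \<otimes> s) = z s" for z using True g gs by (simp add: shift_def)
    have "len s \<le> len g + len (inv g \<otimes> s)" using len_mult[of g "inv g \<otimes> s"] True g gs by simp
    moreover have "y s = x s \<or> inv g \<otimes> s \<in> gball k \<and> y s \<le> enat k \<and> x s \<le> enat k"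
      using m unfolding move_def by (metis v)
    moreover have "enat k \<le> enat (k + len g)" by simp
    ultimately show ?thesis using True unfolding gball_def by (auto intro: order_trans)
  next
    case False
    then show ?thesis using configsD(1)[OF y(1)] configsD(1)[OF y(2)] by simp
  qed
qed

lemma agree_shift:
  assumes g: "g \<in> carrier G" and a: "agree (k + len g) y x"
  shows "agree k (shift g y) (shift g x)"
  unfolding agree_def
proof
  fix s assume s: "s \<in> gball (2 * k)"
  then have "g \<otimes> s \<in> gball (2 * (k + len g))" using len_mult[of g s] g by (auto simp: gball_def)
  then have "min (y (g \<otimes> s)) (enat (Suc (k + len g))) = min (x (g \<otimes> s)) (enat (Suc (k + len g)))"
    using a by (simp add: agree_def)
  then have "min (y (g \<otimes> s)) (enat (Suc k)) = min (x (g \<otimes> s)) (enat (Suc k))"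
    by (rule trunc_mono) simp
  then show "min (shift g y s) (enat (Suc k)) = min (shift g x s) (enat (Suc k))"
    by (simp add: shift_def)
qed

text \<open>
  A difference between \<open>y'\<close> and \<open>x'\<close> consists of values up to \<open>m\<close>, which are exactly visible in the
  windows, and is therefore a difference between \<open>y\<close> and \<open>x\<close>. The case \<open>g = \<one>\<close> compares successive
  stages; the general one shows that translation maps finite levels to finite levels.
\<close>

lemma move_transfer:
  assumes g: "g \<in> carrier G" and le: "k + len g \<le> m"
    and yx: "move k (shift g y) (shift g x)" and yx': "move m y' x'"
    and ag: "agree m y y'" "agree m x x'"
  shows "move k (shift g y') (shift g x')"
  unfolding move_def
proof
  fix s
  show "shift g y' s = shift g x' s \<or>
      s \<in> gball k \<and> shift g y' s \<le> enat k \<and> shift g x' s \<le> enat k"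
  proof (cases "s \<in> carrier G \<and> y' (g \<otimes> s) \<noteq> x' (g \<otimes> s)")
    case True
    then have b: "g \<otimes> s \<in> gball m" "y' (g \<otimes> s) \<le> enat m" "x' (g \<otimes> s) \<le> enat m"
      using yx' unfolding move_def by blast+
    then have b2: "g \<otimes> s \<in> gball (2 * m)" using ball_mono[of m "2 * m"] by auto
    have "y (g \<otimes> s) = y' (g \<otimes> s)" "x (g \<otimes> s) = x' (g \<otimes> s)"
      using agree_eq[OF ag(1) b2 b(2)] agree_eq[OF ag(2) b2 b(3)] by auto
    then have "shift g y s = shift g y' s" "shift g x s = shift g x' s" by (simp_all add: shift_def)
    then show ?thesis using yx unfolding move_def by metis
  next
    case False
    then show ?thesis by (auto simp: shift_def)
  qed
qed

lemma agree_separates: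
  assumes "y \<in> configs" "x \<in> configs" "y \<noteq> x"
  shows "\<exists>k. \<not> agree k y x"
proof -
  have sep: "\<exists>k. \<not> agree k a b" if s: "s \<in> carrier G" "a s < b s" for a b :: "'g \<Rightarrow> enat" and s
  proof -
    obtain v where v: "a s = enat v" using s(2) by (cases "a s") auto
    define k where "k = max v (len s)"
    have "s \<in> gball (2 * k)" using s(1) by (simp add: gball_def k_def)
    moreover have "a s \<le> enat k" by (simp add: v k_def)
    ultimately have "b s = a s" if "agree k a b" using agree_eq[OF agree_sym[OF that]] by blast
    then show ?thesis using s(2) by (intro exI[of _ k]) auto
  qed
  obtain s where s: "y s \<noteq> x s" using assms(3) by blast
  then have "s \<in> carrier G" using configsD(1)[OF assms(1)] configsD(1)[OF assms(2)] by metis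
  then show ?thesis using sep[of s y x] sep[of s x y] s agree_sym by (metis linorder_neqE)
qed

lemma move_if_same_infinities:
  assumes y: "y \<in> configs" "x \<in> configs" and inf: "\<And>s. y s = \<infinity> \<longleftrightarrow> x s = \<infinity>"
  shows "\<exists>k. move k y x"
proof -
  let ?D = "{s. y s \<noteq> 0} \<union> {s. x s \<noteq> 0}"
  define f where "f s = max (len s) (max (the_enat (y s)) (the_enat (x s)))" for s
  define k where "k = Max (insert 0 (f ` ?D))"
  have fin: "finite ?D" using configsD(2)[OF y(1)] configsD(2)[OF y(2)] by simp
  have "move k y x"
    unfolding move_def
  proof
    fix s
    show "y s = x s \<or> s \<in> gball k \<and> y s \<le> enat k \<and> x s \<le> enat k"
    proof (cases "y s = x s")
      case False
      then have "s \<in> ?D" by auto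
      then have "f s \<le> k" unfolding k_def using fin by (intro Max_ge) auto
      moreover have "y s \<noteq> \<infinity>" "x s \<noteq> \<infinity>" using inf[of s] False by auto
      moreover have "s \<in> carrier G" using False configsD(1)[OF y(1)] configsD(1)[OF y(2)] by metis
      ultimately show ?thesis unfolding f_def gball_def by (cases "y s"; cases "x s") auto
    qed simp
  qed
  then show ?thesis by blast
qed

definition trunc :: "nat \<Rightarrow> ('g \<Rightarrow> enat) \<Rightarrow> 'g \<Rightarrow> enat" where
  "trunc k y = (\<lambda>s. min (y s) (enat (Suc k)))"

lemma trunc_finite: "trunc k y s \<noteq> \<infinity>"
  by (cases "y s") (simp_all add: trunc_def min_def)

lemma trunc_configs: assumes y: "y \<in> configs" shows "trunc k y \<in> configs"
proof (rule configsI)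
  show "trunc k y s = 0" if "s \<notin> carrier G" for s using configsD(1)[OF y that] by (simp add: trunc_def)
  have "{s. trunc k y s \<noteq> 0} \<subseteq> {s. y s \<noteq> 0}" by (auto simp: trunc_def)
  then show "finite {s. trunc k y s \<noteq> 0}" using configsD(2)[OF y] by (rule finite_subset)
  show "s = t" if "trunc k y s = \<infinity>" "trunc k y t = \<infinity>" for s t using that trunc_finite by blast
  show "spread_out (trunc k y)"
    using spread_outD[OF configsD(4)[OF y]] by (intro spread_outI) (auto simp: trunc_def)
qed

lemma agree_trunc: "agree k (trunc k y) y"
  by (auto simp: agree_def trunc_def)

definition spike :: "'g \<Rightarrow> enat \<Rightarrow> 'g \<Rightarrow> enat" where
  "spike g v = (\<lambda>s. if s = g then v else 0)"

lemma spike_configs: "g \<in> carrier G \<Longrightarrow> spike g v \<in> configs"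
proof (rule configsI)
  have "{s. spike g v s \<noteq> 0} \<subseteq> {g}" by (auto simp: spike_def)
  then show "finite {s. spike g v s \<noteq> 0}" by (rule finite_subset) simp
  show "spread_out (spike g v)" by (rule spread_outI) (auto simp: spike_def split: if_splits)
qed (auto simp: spike_def split: if_splits)

lemma infinite_configs: "infinite configs"
proof
  assume "finite configs"
  then have "finite (range (\<lambda>v. spike \<one> (enat v)))"
    by (rule finite_subset[rotated]) (auto intro: spike_configs)
  moreover have "inj (\<lambda>v. spike \<one> (enat v))"
    by (rule injI) (metis enat.inject spike_def)
  ultimately show False using finite_imageD infinite_UNIV_nat by blast
qed

lemma countable_configs: "countable configs"
proof -
  let ?f = "\<lambda>y :: 'g \<Rightarrow> enat. {(s, y s) | s. y s \<noteq> 0}"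
  have inj: "inj ?f"
  proof (rule injI)
    fix y x assume eq: "?f y = ?f x"
    show "y = x"
    proof
      fix s
      have "(s, v) \<in> ?f y \<longleftrightarrow> (s, v) \<in> ?f x" for v by (simp only: eq)
      then have "v \<noteq> 0 \<Longrightarrow> y s = v \<longleftrightarrow> x s = v" for v by auto
      then show "y s = x s" by metis
    qed
  qed
  have "?f y \<in> Collect finite" if "y \<in> configs" for y
  proof -
    have "?f y = (\<lambda>s. (s, y s)) ` {s. y s \<noteq> 0}" by auto
    then show ?thesis using configsD(2)[OF that] by simp
  qed
  then have "?f ` configs \<subseteq> Collect finite" by blast
  then have "countable (?f ` configs)" by (rule countable_subset) (rule countable_Collect_finite)
  then show ?thesis by (rule countable_image_inj_on) (rule inj_on_subset[OF inj subset_UNIV])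
qed

end

section \<open>The algebra of a group with spread-out translates\<close>

text \<open>
  The ball \<open>gball r\<close> has three translates such that points of the three never form a commuting triple.
  This is the way in which the group has to be far from abelian, at every scale.
\<close>

locale spread_group = length_group +
  assumes spread: "\<exists>t1\<in>carrier G. \<exists>t2\<in>carrier G. \<exists>t3\<in>carrier G.
    \<forall>u1\<in>gball r. \<forall>u2\<in>gball r. \<forall>u3\<in>gball r.
      (t2 \<otimes> u2) \<otimes> inv (t1 \<otimes> u1) \<otimes> (t3 \<otimes> u3) \<noteq> (t3 \<otimes> u3) \<otimes> inv (t1 \<otimes> u1) \<otimes> (t2 \<otimes> u2)"
begin

definition conf :: "nat \<Rightarrow> 'a \<Rightarrow> enat" where
  "conf = from_nat_into configs"

definition code :: "('a \<Rightarrow> enat) \<Rightarrow> nat" where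
  "code = to_nat_on configs"

lemma conf_configs: "conf i \<in> configs"
  unfolding conf_def using infinite_configs by (intro from_nat_into) auto

lemma conf_code: "y \<in> configs \<Longrightarrow> conf (code y) = y"
  unfolding conf_def code_def by (rule from_nat_into_to_nat_on[OF countable_configs])

lemma code_conf: "code (conf i) = i"
  unfolding conf_def code_def by (rule to_nat_on_from_nat_into_infinite[OF countable_configs infinite_configs])

lemma conf_inj: "conf i = conf j \<Longrightarrow> i = j"
  using code_conf by metis

definition imove :: "nat \<Rightarrow> nat \<Rightarrow> nat \<Rightarrow> bool" where
  "imove k i j \<longleftrightarrow> move k (conf i) (conf j)"

definition iagree :: "nat \<Rightarrow> nat \<Rightarrow> nat \<Rightarrow> bool" where
  "iagree k i j \<longleftrightarrow> agree k (conf i) (conf j)"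

sublocale af_system imove iagree
proof
  fix k i j l i' j'
  show "imove k i i" by (simp add: imove_def move_refl)
  show "imove k j i" if "imove k i j" using that unfolding imove_def by (rule move_sym)
  show "imove k i l" if "imove k i j" "imove k j l" using that unfolding imove_def by (rule move_trans)
  show "imove (Suc k) i j" if "imove k i j" using that unfolding imove_def by (rule move_mono) simp
  show "finite {j. imove k i j}"
  proof -
    have "conf ` {j. imove k i j} \<subseteq> {x. move k (conf i) x}" by (auto simp: imove_def)
    then have "finite (conf ` {j. imove k i j})" using finite_moves by (rule finite_subset)
    then show ?thesis by (rule finite_imageD) (rule inj_onI, rule conf_inj)
  qed
  show "iagree k i i" by (simp add: iagree_def agree_refl)
  show "iagree k j i" if "iagree k i j" using that unfolding iagree_def by (rule agree_sym)
  show "iagree k i l" if "iagree k i j" "iagree k j l" using that unfolding iagree_def by (rule agree_trans)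
  show "iagree k i j" if "iagree (Suc k) i j" using that unfolding iagree_def by (rule agree_mono) simp
  show "\<exists>T. finite T \<and> (\<forall>i. \<exists>t\<in>T. iagree k i t)"
  proof -
    obtain T where T: "finite T" "T \<subseteq> configs" "\<forall>y\<in>configs. \<exists>t\<in>T. agree k y t"
      using finite_windows[where Y = configs and k = k] by (elim exE conjE)
    have "\<exists>t\<in>code ` T. iagree k i t" for i
    proof -
      obtain t where t: "t \<in> T" "agree k (conf i) t" using bspec[OF T(3) conf_configs[of i]] by (rule bexE)
      have "conf (code t) = t" using T(2) t(1) by (intro conf_code) (rule subsetD)
      then have "iagree k i (code t)" unfolding iagree_def using t(2) by (simp only:)
      then show ?thesis using imageI[OF t(1)] by (rule bexI)
    qed
    then show ?thesis using T(1) by blast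
  qed
  show "\<exists>j'. imove k i' j' \<and> iagree k j j'" if "iagree k i i'" "imove k i j"
  proof -
    have "agree k (conf i) (conf i')" "move k (conf i) (conf j)" using that by (simp_all only: iagree_def imove_def)
    from configs_lift[OF conf_configs conf_configs conf_configs this]
    obtain x where x: "x \<in> configs" "move k (conf i') x" "agree k (conf j) x" by (elim bexE conjE)
    then have "imove k i' (code x) \<and> iagree k j (code x)" by (simp add: imove_def iagree_def conf_code)
    then show ?thesis by (rule exI)
  qed
  show "i = j" if "imove k i j" "iagree k i j"
    using that unfolding imove_def iagree_def by (intro conf_inj move_agree_eq)
  show "imove k i' j'" if "imove k i j" "imove (Suc k) i' j'" "iagree (Suc k) i i'" "iagree (Suc k) j j'"
    using move_transfer[OF one_closed, of k "Suc k" "conf i" "conf j" "conf i'" "conf j'"] that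
    unfolding imove_def iagree_def len_one shift_one[OF conf_configs] by simp
qed

text \<open>
  \<open>shift g\<close> is the translation by the inverse of \<open>g\<close>, so that \<open>perm\<close> reverses products. Substituting
  it into the arguments of a matrix reverses them once more, which makes \<open>act\<close> a homomorphism.
\<close>

definition perm :: "'a \<Rightarrow> nat \<Rightarrow> nat" where
  "perm g i = code (shift g (conf i))"

lemma conf_perm: "g \<in> carrier G \<Longrightarrow> conf (perm g i) = shift g (conf i)"
  unfolding perm_def by (intro conf_code shift_configs conf_configs)

lemma perm_one: "perm \<one> = id"
  by (rule ext) (simp add: perm_def shift_one conf_configs code_conf)

lemma perm_mult: "g \<in> carrier G \<Longrightarrow> h \<in> carrier G \<Longrightarrow> perm (g \<otimes> h) = perm h \<circ> perm g"
  by (rule ext) (simp add: perm_def[of "g \<otimes> h"] perm_def[of h] conf_perm shift_mult)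

lemma bij_perm: "g \<in> carrier G \<Longrightarrow> bij (perm g)"
  using perm_mult[of g "inv g"] perm_mult[of "inv g" g] perm_one
  by (intro o_bij[of "perm (inv g)"]) simp_all

lemma levels_perm:
  assumes g: "g \<in> carrier G" and b: "b \<in> levels" shows "mconj (perm g) b \<in> levels"
proof -
  obtain k where k: "b \<in> level k" using b by (auto simp: levels_def)
  let ?m = "k + len g"
  have "mconj (perm g) b \<in> level ?m"
  proof (rule levelI)
    fix i j assume "mconj (perm g) b i j \<noteq> 0"
    then have "imove k (perm g i) (perm g j)" unfolding mconj_apply by (rule level_R[OF k])
    then show "imove ?m i j"
      unfolding imove_def conf_perm[OF g] by (rule move_shift[OF g conf_configs conf_configs])
  next
    fix i j i' j' assume *: "imove ?m i j" "imove ?m i' j'" "iagree ?m i i'" "iagree ?m j j'"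
    have E: "iagree k (perm g i) (perm g i')" "iagree k (perm g j) (perm g j')"
      using agree_shift[OF g, of k "conf i" "conf i'"] agree_shift[OF g, of k "conf j" "conf j'"] *(3,4)
      unfolding iagree_def conf_perm[OF g] by simp_all
    have iff: "imove k (perm g i) (perm g j) \<longleftrightarrow> imove k (perm g i') (perm g j')"
    proof
      assume "imove k (perm g i) (perm g j)"
      then show "imove k (perm g i') (perm g j')"
        using *(2-4) unfolding imove_def iagree_def conf_perm[OF g] by (rule move_transfer[OF g order_refl])
    next
      assume "imove k (perm g i') (perm g j')"
      then show "imove k (perm g i) (perm g j)"
        using *(1) *(3,4)[THEN E_sym] unfolding imove_def iagree_def conf_perm[OF g]
        by (rule move_transfer[OF g order_refl])
    qed
    show "mconj (perm g) b i j = mconj (perm g) b i' j'"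
    proof (cases "imove k (perm g i) (perm g j)")
      case True
      then show ?thesis unfolding mconj_apply using iff E by (intro level_eq[OF k]) auto
    next
      case False
      have "b (perm g i) (perm g j) = 0" using level_R[OF k] False by blast
      moreover have "b (perm g i') (perm g j') = 0" using level_R[OF k] False iff by blast
      ultimately show ?thesis by (simp add: mconj_apply)
    qed
  qed
  then show ?thesis by (auto simp: levels_def)
qed

lemma mconj_perm_closed: "g \<in> carrier G \<Longrightarrow> a \<in> mclosure levels \<Longrightarrow> mconj (perm g) a \<in> mclosure levels"
  by (rule mclosure_conj[OF bij_perm levels_perm])

lemma mconj_perm_mult:
  "g \<in> carrier G \<Longrightarrow> h \<in> carrier G \<Longrightarrow> mconj (perm (g \<otimes> h)) a = mconj (perm g) (mconj (perm h) a)"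
  by (simp add: mconj_mconj perm_mult)

lemma mconj_perm_inv:
  assumes "g \<in> carrier G"
  shows "mconj (perm g) (mconj (perm (inv g)) a) = a" "mconj (perm (inv g)) (mconj (perm g) a) = a"
proof -
  have 1: "mconj (perm \<one>) a = a" by (simp add: perm_one mconj_def)
  show "mconj (perm g) (mconj (perm (inv g)) a) = a"
    using mconj_perm_mult[of g "inv g" a] assms 1 by simp
  show "mconj (perm (inv g)) (mconj (perm g) a) = a"
    using mconj_perm_mult[of "inv g" g a] assms 1 by simp
qed

definition act :: "'a \<Rightarrow> cmat \<Rightarrow> cmat" where
  "act g = restrict (mconj (perm g)) (carrier A)"

lemma act_apply: "a \<in> mclosure levels \<Longrightarrow> act g a = mconj (perm g) a"
  by (simp add: act_def)

lemma act_Bij: "g \<in> carrier G \<Longrightarrow> act g \<in> Bij (carrier A)"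
proof -
  assume g: "g \<in> carrier G"
  have "bij_betw (act g) (carrier A) (carrier A)"
    by (rule bij_betw_byWitness[where f' = "mconj (perm (inv g))"])
      (auto simp: act_apply mconj_perm_inv g mconj_perm_closed)
  then show ?thesis by (simp add: Bij_def act_def)
qed

lemma act_Aut: "g \<in> carrier G \<Longrightarrow> act g \<in> carrier (cstar_Aut A)"
proof -
  assume g: "g \<in> carrier G"
  note b = bij_perm[OF g]
  have "act g \<in> ring_hom A A"
    by (rule ring_hom_memI)
      (auto simp: act_apply mult_in_A one_in_A A.add_in[simplified] mconj_mult[OF b] mconj_add mconj_one[OF b]
        mconj_perm_closed[OF g])
  moreover have "act g (c \<odot>\<^bsub>A\<^esub> x) = c \<odot>\<^bsub>A\<^esub> act g x" if "x \<in> carrier A" for c x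
    using that A.smult_in[of x c] by (simp add: act_apply mconj_smult)
  moreover have "act g (star A x) = star A (act g x)" if "x \<in> carrier A" for x
    using that star_in_A[of x] by (simp add: act_apply mconj_star)
  ultimately show ?thesis using act_Bij[OF g] by (simp add: cstar_Aut_def)
qed

lemma cstar_action_act: "cstar_action G A act"
  unfolding cstar_action_def
proof (rule homI)
  fix g h assume g: "g \<in> carrier G" and h: "h \<in> carrier G"
  show "act g \<in> carrier (cstar_Aut A)" by (rule act_Aut[OF g])
  have "act (g \<otimes> h) = compose (carrier A) (act g) (act h)"
  proof (rule ext)
    fix a
    show "act (g \<otimes> h) a = compose (carrier A) (act g) (act h) a"
    proof (cases "a \<in> mclosure levels")
      case True
      then show ?thesis using g h mconj_perm_closed[OF h True]
        by (simp add: compose_def act_apply mconj_perm_mult)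
    qed (simp add: act_def compose_def)
  qed
  then show "act (g \<otimes> h) = act g \<otimes>\<^bsub>cstar_Aut A\<^esub> act h"
    using act_Bij[OF g] act_Bij[OF h] by (simp add: cstar_Aut_def BijGroup_def)
qed

lemma prime_A_configs: "prime_cstar A"
proof (rule prime_A)
  fix k i m j
  let ?x = "trunc k (conf i)" and ?y = "trunc m (conf j)"
  have c: "?x \<in> configs" "?y \<in> configs" by (intro trunc_configs conf_configs)+
  have "\<exists>l. move l ?x ?y" by (rule move_if_same_infinities[OF c]) (simp add: trunc_finite)
  then obtain l where "move l ?x ?y" by (rule exE)
  then have "iagree k (code ?x) i \<and> iagree m (code ?y) j \<and> imove l (code ?x) (code ?y)"
    by (simp add: iagree_def imove_def conf_code[OF c(1)] conf_code[OF c(2)] agree_trunc)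
  then show "\<exists>x y l. iagree k x i \<and> iagree m y j \<and> imove l x y" by (intro exI)
qed

text \<open>
  If each of the three translates contained a value above \<open>K\<close>, these values would sit at a
  noncommuting triple whose distances are at most \<open>K\<close>, which the constraint excludes.
\<close>

lemma bounded_ball:
  "\<exists>T K. finite T \<and> T \<subseteq> carrier G \<and> (\<forall>x\<in>configs. \<exists>t\<in>T. \<forall>u\<in>gball r. x (t \<otimes> u) \<le> enat K)"
proof -
  obtain t1 t2 t3 where t: "t1 \<in> carrier G" "t2 \<in> carrier G" "t3 \<in> carrier G"
    and nc: "\<forall>u1\<in>gball r. \<forall>u2\<in>gball r. \<forall>u3\<in>gball r.
      (t2 \<otimes> u2) \<otimes> inv (t1 \<otimes> u1) \<otimes> (t3 \<otimes> u3) \<noteq> (t3 \<otimes> u3) \<otimes> inv (t1 \<otimes> u1) \<otimes> (t2 \<otimes> u2)"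
    using spread[of r] by (elim bexE)
  define M where "M = len t1 + len t2 + len t3"
  \<comment> \<open>Points of the three translates have length at most \<open>M + r\<close>, and two distances are added.\<close>
  define K where "K = 4 * (M + r)"
  have "\<exists>t\<in>{t1, t2, t3}. \<forall>u\<in>gball r. x (t \<otimes> u) \<le> enat K" if x: "x \<in> configs" for x
  proof (rule ccontr)
    assume "\<not> ?thesis"
    then have "\<exists>u\<in>gball r. enat K < x (t1 \<otimes> u)" "\<exists>u\<in>gball r. enat K < x (t2 \<otimes> u)"
      "\<exists>u\<in>gball r. enat K < x (t3 \<otimes> u)" by (auto simp: not_le)
    then obtain u1 u2 u3 where u: "u1 \<in> gball r" "u2 \<in> gball r" "u3 \<in> gball r"
      and gt: "enat K < x (t1 \<otimes> u1)" "enat K < x (t2 \<otimes> u2)" "enat K < x (t3 \<otimes> u3)" by blast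
    have uc: "u1 \<in> carrier G" "u2 \<in> carrier G" "u3 \<in> carrier G" using u by (auto intro: ball_carrier)
    have len: "len (t1 \<otimes> u1) \<le> M + r" "len (t2 \<otimes> u2) \<le> M + r" "len (t3 \<otimes> u3) \<le> M + r"
      using len_mult[OF t(1) uc(1)] len_mult[OF t(2) uc(2)] len_mult[OF t(3) uc(3)] u
      by (auto simp: M_def gball_def)
    have "gdist s s' \<le> len s + len s'" if "s \<in> carrier G" "s' \<in> carrier G" for s s'
      using len_mult[of "inv s" s'] that by (simp add: gdist_def len_inv)
    then have "gdist (t1 \<otimes> u1) (t2 \<otimes> u2) + gdist (t1 \<otimes> u1) (t3 \<otimes> u3)
        \<le> (len (t1 \<otimes> u1) + len (t2 \<otimes> u2)) + (len (t1 \<otimes> u1) + len (t3 \<otimes> u3))"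
      using t uc by (intro add_mono) auto
    also have "\<dots> \<le> K" using len by (simp add: K_def)
    finally have le: "enat (gdist (t1 \<otimes> u1) (t2 \<otimes> u2) + gdist (t1 \<otimes> u1) (t3 \<otimes> u3)) \<le> enat K"
      unfolding enat_ord_simps .
    show False
      by (rule spread_outD[OF configsD(4)[OF x], of "t1 \<otimes> u1" "t2 \<otimes> u2" "t3 \<otimes> u3"])
        (intro m_closed t uc nc[rule_format] u le_less_trans[OF le] gt)+
  qed
  then show ?thesis using t by (intro exI[of _ "{t1, t2, t3}"] exI[of _ K]) auto
qed

text \<open>
  The window of \<open>z\<close> is written into the inner ball of radius \<open>2 * k\<close>, truncated at \<open>Suc k\<close>, and the rest of
  the ball of radius \<open>3 * k\<close> is set to \<open>0\<close>. A constraint that involves the inner ball has bound at most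
  \<open>k\<close>. It does not reach beyond the layer of zeros, and so it is a constraint on \<open>z\<close>; any other
  violated constraint lies outside of the ball and is one on \<open>x\<close>.
\<close>

lemma overwrite:
  assumes x: "x \<in> configs" and z: "z \<in> configs" and g: "g \<in> carrier G"
    and bd: "\<And>u. u \<in> gball (3 * k) \<Longrightarrow> x (g \<otimes> u) \<le> enat K"
    and m: "K \<le> m" "Suc k \<le> m" "len g + 3 * k \<le> m"
  shows "\<exists>y\<in>configs. move m x y \<and> (\<forall>y'. agree m y' y \<longrightarrow> agree k (shift g y') z)"
proof -
  define w where "w s = (if s \<in> gball (2 * k) then min (z s) (enat (Suc k)) else 0)" for s
  define D where "D = {s \<in> carrier G. inv g \<otimes> s \<in> gball (3 * k)}"
  define y where "y = (\<lambda>s. if s \<in> D then w (inv g \<otimes> s) else x s)"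
  have w_le: "w s \<le> enat (Suc k)" for s by (simp add: w_def)
  have w_le_z: "w s \<le> z s" for s by (simp add: w_def)
  have D_ball: "s \<in> gball m \<and> x s \<le> enat K" if "s \<in> D" for s
  proof -
    have s: "s \<in> carrier G" "inv g \<otimes> s \<in> gball (3 * k)" using that by (auto simp: D_def)
    have "len (g \<otimes> (inv g \<otimes> s)) \<le> len g + len (inv g \<otimes> s)" using s g by (intro len_mult) auto
    then have "s \<in> gball m" using s g m by (simp add: cancel gball_def)
    moreover have "x s \<le> enat K" using bd[OF s(2)] s g by (simp add: cancel)
    ultimately show ?thesis by blast
  qed
  have move: "move m x y"
  proof (rule moveI)
    fix s assume "x s \<noteq> y s"
    then have s: "s \<in> D" "y s = w (inv g \<otimes> s)" by (auto simp: y_def split: if_splits)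
    have "enat K \<le> enat m" "enat (Suc k) \<le> enat m" using m by simp_all
    then show "s \<in> gball m \<and> x s \<le> enat m \<and> y s \<le> enat m"
      using D_ball[OF s(1)] w_le[of "inv g \<otimes> s"] s(2) by (metis order_trans)
  qed
  have "y \<in> configs"
  proof (rule configsI)
    show "y s = 0" if "s \<notin> carrier G" for s using configsD(1)[OF x that] that by (simp add: y_def D_def)
    have "{s. y s \<noteq> 0} \<subseteq> {s. x s \<noteq> 0} \<union> gball m" using D_ball by (auto simp: y_def)
    then show "finite {s. y s \<noteq> 0}"
      using configsD(2)[OF x] finite_ball[of m] unfolding gball_def by (meson finite_UnI finite_subset)
    have "x s = \<infinity>" if "y s = \<infinity>" for s
    proof (cases "s \<in> D")
      case True
      then show ?thesis using that w_le[of "inv g \<otimes> s"] by (simp add: y_def)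
    next
      case False
      then show ?thesis using that by (simp add: y_def)
    qed
    then show "s = t" if "y s = \<infinity>" "y t = \<infinity>" for s t using that configsD(3)[OF x] by blast
    show "spread_out y"
    proof (rule spread_outI)
      fix s t u \<kappa>
      assume stu: "s \<in> carrier G" "t \<in> carrier G" "u \<in> carrier G" "t \<otimes> inv s \<otimes> u \<noteq> u \<otimes> inv s \<otimes> t"
        and \<kappa>: "\<kappa> = gdist s t + gdist s u" and gt: "enat \<kappa> < y s" "enat \<kappa> < y t" "enat \<kappa> < y u"
      have gt': "enat \<kappa> < y v" if "v \<in> {s, t, u}" for v using that gt by auto
      show False
      proof (cases "\<exists>v\<in>{s, t, u}. v \<in> D")
        case True
        then obtain v where v: "v \<in> {s, t, u}" "v \<in> D" by blast
        have vc: "v \<in> carrier G" using v(1) stu by auto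
        have yv: "enat \<kappa> < w (inv g \<otimes> v)" using gt'[OF v(1)] v(2) by (simp add: y_def)
        then have near: "inv g \<otimes> v \<in> gball (2 * k)" by (auto simp: w_def split: if_splits)
        have "enat \<kappa> < enat (Suc k)" using yv w_le by (rule less_le_trans)
        then have k: "\<kappa> \<le> k" by simp
        have zw: "enat \<kappa> < z (inv g \<otimes> q)" if q: "q \<in> {s, t, u}" for q
        proof -
          have qc: "q \<in> carrier G" using q stu by auto
          have "len (inv g \<otimes> q) \<le> len (inv g \<otimes> v) + gdist (inv g \<otimes> v) (inv g \<otimes> q)"
            using vc qc g by (intro len_le_dist) auto
          also have "gdist (inv g \<otimes> v) (inv g \<otimes> q) = gdist v q" using vc qc g by (intro dist_shift) auto
          also have "len (inv g \<otimes> v) + gdist v q \<le> 2 * k + \<kappa>"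
            using near triple_near[OF stu(1-3) v(1) q] by (intro add_mono) (auto simp: gball_def \<kappa>)
          finally have "q \<in> D" using k qc g by (simp add: D_def gball_def)
          then have "enat \<kappa> < w (inv g \<otimes> q)" using gt'[OF q] by (simp add: y_def)
          then show ?thesis using w_le_z by (rule less_le_trans)
        qed
        have "enat \<kappa> < shift (inv g) z q" if "q \<in> {s, t, u}" for q
          using zw[OF that] that stu by (auto simp: shift_def)
        then show False
          using spread_outD[OF configsD(4)[OF shift_configs[OF inv_closed[OF g] z]] stu] \<kappa> by blast
      next
        case False
        then have "enat \<kappa> < x q" if "q \<in> {s, t, u}" for q using gt'[OF that] that by (simp add: y_def split: if_splits) blast
        then show False using spread_outD[OF configsD(4)[OF x] stu] \<kappa> by blast
      qed
    qed
  qed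
  moreover have "agree k (shift g y') z" if ag: "agree m y' y" for y'
    unfolding agree_def
  proof
    fix s assume s: "s \<in> gball (2 * k)"
    then have sc: "s \<in> carrier G" by (rule ball_carrier)
    have sD: "g \<otimes> s \<in> D" using s sc g by (simp add: D_def cancel gball_def)
    then have ys: "y (g \<otimes> s) = min (z s) (enat (Suc k))" using s sc g by (simp add: y_def cancel w_def)
    also have "\<dots> \<le> enat m" using m(2) by (simp add: min_le_iff_disj)
    finally have "y' (g \<otimes> s) = y (g \<otimes> s)"
      using agree_eq[OF ag, of "g \<otimes> s"] D_ball[OF sD] ball_mono[of m "2 * m"] by auto
    then show "min (shift g y' s) (enat (Suc k)) = min (z s) (enat (Suc k))"
      using sc by (simp add: shift_def ys)
  qed
  ultimately show ?thesis using move by blast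
qed

lemma translates_meet:
  "\<exists>m. \<forall>x. \<exists>g\<in>carrier G. \<exists>y. imove m x y \<and> (\<forall>y'. iagree m y' y \<longrightarrow> iagree k (perm g y') i)"
proof -
  obtain T K where T: "finite T" "T \<subseteq> carrier G"
    and K: "\<And>x. x \<in> configs \<Longrightarrow> \<exists>t\<in>T. \<forall>u\<in>gball (3 * k). x (t \<otimes> u) \<le> enat K"
    using bounded_ball[of "3 * k"] by blast
  define m where "m = K + Suc k + Max (insert 0 (len ` T)) + 3 * k"
  have "\<exists>g\<in>carrier G. \<exists>y. imove m x y \<and> (\<forall>y'. iagree m y' y \<longrightarrow> iagree k (perm g y') i)" for x
  proof -
    obtain g where g: "g \<in> T" "\<And>u. u \<in> gball (3 * k) \<Longrightarrow> conf x (g \<otimes> u) \<le> enat K"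
      using K[OF conf_configs[of x]] by blast
    have gc: "g \<in> carrier G" using g(1) T(2) by blast
    have "len g \<le> Max (insert 0 (len ` T))" using T(1) g(1) by (intro Max_ge) auto
    then have m: "K \<le> m" "Suc k \<le> m" "len g + 3 * k \<le> m" by (simp_all add: m_def)
    obtain y where y: "y \<in> configs" "move m (conf x) y" "\<forall>y'. agree m y' y \<longrightarrow> agree k (shift g y') (conf i)"
      using overwrite[OF conf_configs conf_configs gc g(2) m] by blast
    have "imove m x (code y) \<and> (\<forall>y'. iagree m y' (code y) \<longrightarrow> iagree k (perm g y') i)"
      using y(2,3) by (simp add: imove_def iagree_def conf_code[OF y(1)] conf_perm[OF gc])
    then show ?thesis using gc by blast
  qed
  then show ?thesis by blast
qed

lemma minimal_act: "minimal_action G A act"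
  unfolding minimal_action_def
proof (intro allI impI)
  fix I assume I: "closed_ideal A I" and inv: "\<forall>g\<in>carrier G. act g ` I = I"
  have sub: "I \<subseteq> mclosure levels" using I idealD(1) by (simp add: closed_ideal_def)
  show "I = {\<zero>\<^bsub>A\<^esub>} \<or> I = carrier A"
  proof (rule disjCI)
    assume "I \<noteq> carrier A"
    show "I = {\<zero>\<^bsub>A\<^esub>}"
    proof (rule ccontr)
      assume "I \<noteq> {\<zero>\<^bsub>A\<^esub>}"
      then have nz: "I \<noteq> {0}" by simp
      have "I = carrier A"
      proof (rule invariant_ideal_eq_carrier[OF I nz, of "perm ` carrier G"])
        show "bij \<tau>" if "\<tau> \<in> perm ` carrier G" for \<tau> using that bij_perm by blast
        show "mconj \<tau> a \<in> I" if "\<tau> \<in> perm ` carrier G" "a \<in> I" for \<tau> a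
        proof -
          obtain g where g: "g \<in> carrier G" "\<tau> = perm g" using \<open>\<tau> \<in> perm ` carrier G\<close> by blast
          have "act g a \<in> I" using inv g(1) \<open>a \<in> I\<close> by blast
          moreover have "a \<in> mclosure levels" using sub \<open>a \<in> I\<close> by blast
          ultimately show ?thesis by (simp add: act_apply g(2))
        qed
        show "\<exists>m. \<forall>x. \<exists>\<tau>\<in>perm ` carrier G. \<exists>y. imove m x y \<and> (\<forall>y'. iagree m y' y \<longrightarrow> iagree k (\<tau> y') i)" for k i
          using translates_meet[of k i] by (simp only: bex_simps)
      qed
      then show False using \<open>I \<noteq> carrier A\<close> by contradiction
    qed
  qed
qed

text \<open>
  The limit of these sets consists of configurations that are infinite on all of \<open>H\<close>. They do not belong
  to \<open>configs\<close> unless \<open>H\<close> is trivial, hence the description of their ideal by a sequence.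
\<close>

definition large :: "'a set \<Rightarrow> nat \<Rightarrow> nat set" where
  "large H L = {i. \<forall>h\<in>H. len h \<le> L \<longrightarrow> enat L < conf i h}"

text \<open>
  The triples in \<open>H\<close> commute in the sense of the constraint, so that large values on a ball of \<open>H\<close> are
  permitted and the ideal is proper. It contains the projection of the window that shows \<open>0\<close> at \<open>\<one>\<close>.
  Translation by elements of \<open>H\<close> permutes \<open>H\<close> and changes lengths by a bounded amount.
\<close>

lemma abelian_subgroup_ideal:
  assumes H: "subgroup H G" and ab: "comm_group (G\<lparr>carrier := H\<rparr>)"
  shows "\<exists>J. closed_ideal A J \<and> J \<noteq> {0} \<and> J \<noteq> carrier A \<and> (\<forall>h\<in>H. act h ` J = J)"
proof -
  interpret H: subgroup H G by (rule H)
  interpret ab: comm_group "G\<lparr>carrier := H\<rparr>" by (rule ab)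
  have comm: "t \<otimes> inv s \<otimes> u = u \<otimes> inv s \<otimes> t" if "s \<in> H" "t \<in> H" "u \<in> H" for s t u
  proof -
    have hc: "x \<otimes> y = y \<otimes> x" if "x \<in> H" "y \<in> H" for x y using ab.m_comm[of x y] that by simp
    have "t \<otimes> inv s \<otimes> u = u \<otimes> (t \<otimes> inv s)" using that by (intro hc) auto
    also have "\<dots> = u \<otimes> (inv s \<otimes> t)" using that hc[of t "inv s"] by simp
    also have "\<dots> = u \<otimes> inv s \<otimes> t" using that by (intro m_assoc[symmetric]) auto
    finally show ?thesis .
  qed
  let ?J = "mclosure (vanishing (large H))"
  have dec: "decseq (large H)"
  proof (rule decseq_SucI)
    fix L
    show "large H (Suc L) \<subseteq> large H L"
    proof
      fix i assume i: "i \<in> large H (Suc L)"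
      have "enat L < conf i h" if h: "h \<in> H" "len h \<le> L" for h
      proof -
        have "enat (Suc L) < conf i h" using i h by (simp add: large_def)
        moreover have "enat L < enat (Suc L)" by simp
        ultimately show ?thesis by (rule less_trans[rotated])
      qed
      then show "i \<in> large H L" by (simp add: large_def)
    qed
  qed
  have closed: "closed_ideal A ?J"
  proof (rule vanishing_closed_ideal[OF dec])
    fix k L i j assume k: "k \<le> L" and j: "j \<in> large H L" and ji: "imove k j i"
    have "enat L < conf i h" if h: "h \<in> H" "len h \<le> L" for h
    proof -
      have l: "enat L < conf j h" using j h by (simp add: large_def)
      have "conf j h = conf i h"
      proof (rule ccontr)
        assume "conf j h \<noteq> conf i h"
        then have "conf j h \<le> enat k" using moveD ji unfolding imove_def by blast
        also have "enat k \<le> enat L" using k by simp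
        finally show False using l by simp
      qed
      then show ?thesis using l by simp
    qed
    then show "i \<in> large H L" by (simp add: large_def)
  qed
  have proper: "?J \<noteq> carrier A"
  proof (rule vanishing_proper)
    fix L
    define y where "y = (\<lambda>s. if s \<in> H \<and> len s \<le> L then enat (Suc L) else 0)"
    have "y \<in> configs"
    proof (rule configsI)
      show "y s = 0" if "s \<notin> carrier G" for s using that H.subset by (auto simp: y_def)
      have "{s. y s \<noteq> 0} \<subseteq> {s \<in> carrier G. len s \<le> L}" using H.subset by (auto simp: y_def)
      then show "finite {s. y s \<noteq> 0}" using finite_ball by (rule finite_subset)
      show "s = t" if "y s = \<infinity>" for s t using that by (simp add: y_def split: if_splits)
      show "spread_out y"
      proof (rule spread_outI)
        fix s t u \<kappa>
        assume nc: "t \<otimes> inv s \<otimes> u \<noteq> u \<otimes> inv s \<otimes> t"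
          and gt: "enat \<kappa> < y s" "enat \<kappa> < y t" "enat \<kappa> < y u"
        have "v \<in> H" if "enat \<kappa> < y v" for v using that by (simp add: y_def split: if_splits)
        then show False using comm gt nc by blast
      qed
    qed
    then have "code y \<in> large H L" by (simp add: large_def conf_code) (simp add: y_def)
    then show "large H L \<noteq> {}" by blast
  qed
  have nonzero: "?J \<noteq> {0}"
  proof (rule vanishing_nonzero[where L = 0 and k = 0 and i = "code (spike \<one> 0)"])
    fix j assume j: "j \<in> large H 0"
    let ?z = "spike \<one> 0"
    have one: "\<one> \<in> H" "\<one> \<in> gball (2 * 0)" by (auto simp: gball_def len_one)
    show "\<not> iagree 0 j (code ?z)"
    proof
      assume "iagree 0 j (code ?z)"
      then have "agree 0 (conf j) ?z" by (simp add: iagree_def conf_code spike_configs)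
      then have "conf j \<one> = ?z \<one>" by (rule agree_eq[OF _ one(2)]) (simp add: spike_def)
      moreover have "enat 0 < conf j \<one>" using j one(1) len_one unfolding large_def by blast
      ultimately show False by (simp add: spike_def)
    qed
  qed
  have inv: "mconj (perm h) a \<in> ?J" if h: "h \<in> H" and a: "a \<in> ?J" for h a
  proof (rule vanishing_conj[OF bij_perm levels_perm _ a])
    show hG: "h \<in> carrier G" "h \<in> carrier G" using h by auto
    fix L
    have "perm h j \<in> large H L" if j: "j \<in> large H (L + len h)" for j
    proof -
      have "enat L < conf (perm h j) q" if q: "q \<in> H" "len q \<le> L" for q
      proof -
        have "len (h \<otimes> q) \<le> L + len h" using len_mult[of h q] q hG by auto
        then have "enat (L + len h) < conf j (h \<otimes> q)" using j h q(1) by (simp add: large_def)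
        moreover have "enat L \<le> enat (L + len h)" by simp
        ultimately have "enat L < conf j (h \<otimes> q)" by (rule le_less_trans[rotated])
        then show ?thesis using q hG by (auto simp: conf_perm shift_def)
      qed
      then show ?thesis by (simp add: large_def)
    qed
    then show "\<exists>M. \<forall>j\<in>large H M. perm h j \<in> large H L" by blast
  qed
  have "act h ` ?J = ?J" if h: "h \<in> H" for h
  proof -
    have hG: "h \<in> carrier G" using h by auto
    have JA: "?J \<subseteq> mclosure levels" using closed idealD(1) by (simp add: closed_ideal_def)
    show ?thesis
    proof (intro equalityI subsetI)
      fix b assume "b \<in> act h ` ?J"
      then obtain a where a: "a \<in> ?J" "b = act h a" by blast
      then show "b \<in> ?J" using inv[OF h a(1)] JA by (simp add: act_apply subset_iff)
    next
      fix b assume b: "b \<in> ?J"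
      have ib: "mconj (perm (inv h)) b \<in> ?J" using h by (intro inv b) auto
      then have "act h (mconj (perm (inv h)) b) = b" using JA hG by (simp add: act_apply subset_iff mconj_perm_inv)
      then show "b \<in> act h ` ?J" using ib by (metis imageI)
    qed
  qed
  then show ?thesis using closed proper nonzero by blast
qed

lemma not_minimal_abelian:
  assumes "subgroup H G" "comm_group (G\<lparr>carrier := H\<rparr>)"
  shows "\<not> minimal_action (G\<lparr>carrier := H\<rparr>) A act"
proof -
  obtain J where "closed_ideal A J" "J \<noteq> {0}" "J \<noteq> carrier A" "\<forall>h\<in>H. act h ` J = J"
    using abelian_subgroup_ideal[OF assms] by blast
  then show ?thesis unfolding minimal_action_def by (intro notI) (auto dest: spec[of _ J])
qed

lemma not_simple_A: "\<not> simple_cstar A"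
proof -
  have "comm_group (G\<lparr>carrier := {\<one>}\<rparr>)"
    by (rule group.group_comm_groupI[OF subgroup.subgroup_is_group[OF triv_subgroup is_group]]) auto
  from abelian_subgroup_ideal[OF triv_subgroup this] obtain J
    where "closed_ideal A J" "J \<noteq> {0}" "J \<noteq> carrier A" by blast
  then show ?thesis unfolding simple_cstar_def by auto
qed

definition orbit :: "nat set" where
  "orbit = {i. conf i \<one> = \<infinity>}"

sublocale orbit: af_orbit imove iagree orbit
proof
  show "\<exists>k. \<not> iagree k i j" if "i \<noteq> j" for i j
    using agree_separates[OF conf_configs conf_configs, of i j] that conf_inj unfolding iagree_def by blast
  have "code (spike \<one> \<infinity>) \<in> orbit" by (simp add: orbit_def conf_code spike_configs) (simp add: spike_def)
  then show "orbit \<noteq> {}" by blast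
  show "j \<in> orbit" if "i \<in> orbit" "imove k i j" for i j k
  proof (rule ccontr)
    assume "j \<notin> orbit"
    then have "conf i \<one> = \<infinity>" "conf i \<one> \<noteq> conf j \<one>" using that by (auto simp: orbit_def)
    moreover from this have "conf i \<one> \<le> enat k" using moveD that(2) unfolding imove_def by blast
    ultimately show False by simp
  qed
  show "\<exists>k. imove k i j" if "i \<in> orbit" "j \<in> orbit" for i j
    unfolding imove_def
  proof (rule move_if_same_infinities[OF conf_configs conf_configs])
    fix s
    have "conf i s = \<infinity> \<longleftrightarrow> s = \<one>" "conf j s = \<infinity> \<longleftrightarrow> s = \<one>"
      using configsD(3)[OF conf_configs, of _ s \<one>] that by (auto simp: orbit_def)
    then show "conf i s = \<infinity> \<longleftrightarrow> conf j s = \<infinity>" by simp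
  qed
qed

text \<open>
  The kernel of the representation on \<open>orbit\<close> contains the projection \<open>e\<close> of the window that shows
  \<open>0\<close> at \<open>\<one>\<close>. Its image under \<open>g\<close> consists of elements that vanish at the configurations with
  value \<open>\<infinity>\<close> at \<open>g\<close>. The projection \<open>e\<close> is not one of them if \<open>g \<noteq> \<one>\<close>, for some of these
  configurations show \<open>0\<close> at \<open>\<one>\<close>.
\<close>

lemma effective_act: "effective_action G (ideal_action act) (Prim A)"
  unfolding effective_action_def
proof
  fix g assume g: "g \<in> carrier G - {\<one>}"
  then have gG: "g \<in> carrier G" by blast
  let ?J = "{a \<in> mclosure levels. \<forall>j\<in>orbit. \<forall>i. a i j = 0}"
  have "act g ` ?J \<noteq> ?J"
  proof
    assume eq: "act g ` ?J = ?J"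
    define z where "z = code (spike \<one> 0)"
    have conf_z: "conf z = spike \<one> 0" by (simp add: z_def conf_code spike_configs)
    let ?e = "unit 0 z z"
    have one: "\<one> \<in> gball (2 * 0)" by (simp add: gball_def len_one)
    have "\<not> iagree 0 j z" if j: "j \<in> orbit" for j
    proof
      assume "iagree 0 j z"
      then have "agree 0 (conf j) (spike \<one> 0)" by (simp add: iagree_def conf_z)
      then have "conf j \<one> = spike \<one> 0 \<one>" by (rule agree_eq[OF _ one]) (simp add: spike_def)
      then show False using j by (simp add: orbit_def spike_def)
    qed
    then have "?e i j = 0" if "j \<in> orbit" for i j using that by (simp add: unit_def)
    then have "?e \<in> ?J" using unit_in_A by blast
    then obtain b where b: "b \<in> ?J" "?e = act g b" using eq by blast
    define i where "i = code (spike g \<infinity>)"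
    have conf_i: "conf i = spike g \<infinity>" using gG by (simp add: i_def conf_code spike_configs)
    have "perm g i \<in> orbit" using gG by (simp add: orbit_def conf_perm conf_i shift_def) (simp add: spike_def)
    then have "b (perm g i) (perm g i) = 0" using b(1) by blast
    moreover have "?e i i = mconj (perm g) b i i" using b by (simp add: act_apply)
    ultimately have zero: "?e i i = 0" by (simp only: mconj_apply)
    have "iagree 0 i z"
      unfolding iagree_def agree_def conf_i conf_z
    proof
      fix s assume "s \<in> gball (2 * 0)"
      then have "s = \<one>" using len_eq_0[of s] by (simp add: gball_def)
      then show "min (spike g \<infinity> s) (enat (Suc 0)) = min (spike \<one> 0 s) (enat (Suc 0))"
        using g by (auto simp: spike_def)
    qed
    then have "?e i i = 1" unfolding unit_def using R_refl[of 0 i] by simp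
    then show False using zero by simp
  qed
  then show "\<exists>s\<in>Prim A. ideal_action act g s \<noteq> s"
    unfolding ideal_action_def by (rule bexI) (rule orbit.kernel_in_Prim)
qed

end

section \<open>Free groups\<close>

lemma free_group_simps:
  "carrier (free_group n) = {w. reduced w \<and> fst ` set w \<subseteq> {..<n}}"
  "monoid.mult (free_group n) u v = foldr push u v" "one (free_group n) = []"
  by (simp_all add: free_group_def)

lemma length_push: "length (push x w) \<le> Suc (length w)"
  by (cases w) auto

lemma length_foldr_push: "length (foldr push u w) \<le> length u + length w"
proof (induction u)
  case (Cons x u)
  then show ?case using length_push[of x "foldr push u w"] by simp
qed simp

lemma reduced_flip_rev: "reduced w \<Longrightarrow> reduced (map flip (rev w))"
proof -
  assume "reduced w"
  then have "successively (\<lambda>y x. y \<noteq> flip x) (rev w)"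
    by (simp add: reduced_def)
  then have "successively (\<lambda>y x. flip x \<noteq> flip (flip y)) (rev w)"
    by (rule successively_mono) auto
  then show ?thesis by (simp add: reduced_def successively_map)
qed

lemma inv_free_group:
  assumes w: "w \<in> carrier (free_group n)"
  shows "inv\<^bsub>free_group n\<^esub> w = map flip (rev w)"
proof -
  interpret group "free_group n" by (rule group_free_group)
  have r: "reduced w" using w by (simp add: free_group_simps)
  have "foldr push (map flip (rev w)) w = foldr push (map flip (rev w)) (foldr push w [])"
    by (simp only: foldr_reduced[OF r])
  also have "\<dots> = []" by (rule foldr_inverse) simp
  finally have "map flip (rev w) \<otimes>\<^bsub>free_group n\<^esub> w = \<one>\<^bsub>free_group n\<^esub>"
    by (simp only: free_group_simps)
  moreover have "map flip (rev w) \<in> carrier (free_group n)"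
    using w reduced_flip_rev[OF r] by (auto simp: free_group_simps)
  ultimately show ?thesis using w by (intro inv_equality)
qed

lemma length_inv_free_group: "w \<in> carrier (free_group n) \<Longrightarrow> length (inv\<^bsub>free_group n\<^esub> w) = length w"
  by (simp add: inv_free_group)

lemma finite_free_ball: "finite {w \<in> carrier (free_group n). length w \<le> k}"
proof (rule finite_subset)
  show "{w \<in> carrier (free_group n). length w \<le> k} \<subseteq> {w. set w \<subseteq> {..<n} \<times> UNIV \<and> length w \<le> k}"
    by (force simp: free_group_simps)
  show "finite {w. set w \<subseteq> {..<n} \<times> (UNIV :: bool set) \<and> length w \<le> k}"
    by (rule finite_lists_length_le) simp
qed

interpretation free: length_group "free_group n" length for n
proof (intro length_group.intro group_free_group length_group_axioms.intro)
  show "length s = 0 \<longleftrightarrow> s = \<one>\<^bsub>free_group n\<^esub>" for s :: "letter list" by (simp add: free_group_simps)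
  show "length (s \<otimes>\<^bsub>free_group n\<^esub> t) \<le> length s + length t" for s t
    by (simp add: free_group_simps length_foldr_push)
qed (simp_all add: length_inv_free_group finite_free_ball)

text \<open>
  The homomorphism to the integers that counts the first generator, the one of index \<open>0\<close>.
\<close>

definition exponent_sum :: "letter list \<Rightarrow> int" where
  "exponent_sum w = (\<Sum>x\<leftarrow>w. if fst x = 0 then (if snd x then -1 else 1) else 0)"

lemma exponent_sum_push: "exponent_sum (push x w) = exponent_sum [x] + exponent_sum w"
  by (cases w) (auto simp: exponent_sum_def flip_def)

lemma exponent_sum_mult: "exponent_sum (foldr push u w) = exponent_sum u + exponent_sum w"
proof (induction u)
  case (Cons x u)
  then show ?case by (simp add: exponent_sum_push) (simp add: exponent_sum_def)
qed (simp add: exponent_sum_def)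

lemma exponent_sum_le_length: "\<bar>exponent_sum w\<bar> \<le> int (length w)"
proof (induction w)
  case (Cons x w)
  then show ?case by (auto simp: exponent_sum_def)
qed (simp add: exponent_sum_def)

lemma foldr_push_replicate:
  assumes "g = [] \<or> hd g \<noteq> flip x"
  shows "foldr push (replicate m x) g = replicate m x @ g"
proof (induction m)
  case (Suc m)
  have "x \<noteq> flip x" by (simp add: flip_def prod_eq_iff)
  with Suc assms show ?case by (cases g; cases m) auto
qed simp

lemma replicate_in_free_group: "fst x < n \<Longrightarrow> replicate m x \<in> carrier (free_group n)"
proof -
  have "x \<noteq> flip x" by (simp add: flip_def prod_eq_iff)
  then have "reduced (replicate m x)"
    by (induction m) (auto simp: reduced_Cons hd_replicate)
  then show "fst x < n \<Longrightarrow> ?thesis" by (auto simp: free_group_simps)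
qed

lemma inv_replicate: "fst x < n \<Longrightarrow> inv\<^bsub>free_group n\<^esub> (replicate m x) = replicate m (flip x)"
  using inv_free_group[OF replicate_in_free_group[of x n m]] by simp

text \<open>
  Suppose that both products are equal to \<open>g\<close>. Since \<open>g\<close> does not begin with both of the first two
  generators, one of \<open>a\<^sup>-\<^sup>1 g\<close> and \<open>b\<^sup>-\<^sup>1 g\<close> is a reduced concatenation, of length \<open>M\<close> plus the length
  of \<open>g\<close>. Both have length at most \<open>M + 3r\<close>, as the products show, so that \<open>g\<close> has length at most \<open>3r\<close>.
  But the exponent sum of the first generator in \<open>g\<close> is at least \<open>M - 3r > 3r\<close>.
\<close>

lemma free_group_spread:
  assumes n: "n \<ge> 2" and u: "u1 \<in> free.gball n r" "u2 \<in> free.gball n r" "u3 \<in> free.gball n r"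
    and M: "M = 6 * r + 1"
  defines "a \<equiv> replicate M (0, False)" and "b \<equiv> replicate M (1, False)"
  shows "(a \<otimes>\<^bsub>free_group n\<^esub> u2) \<otimes>\<^bsub>free_group n\<^esub> inv\<^bsub>free_group n\<^esub> u1 \<otimes>\<^bsub>free_group n\<^esub> (b \<otimes>\<^bsub>free_group n\<^esub> u3)
    \<noteq> (b \<otimes>\<^bsub>free_group n\<^esub> u3) \<otimes>\<^bsub>free_group n\<^esub> inv\<^bsub>free_group n\<^esub> u1 \<otimes>\<^bsub>free_group n\<^esub> (a \<otimes>\<^bsub>free_group n\<^esub> u2)"
    (is "?L \<noteq> ?R")
proof
  let ?G = "free_group n"
  assume eq: "?L = ?R"
  define g where "g = ?L"
  define v where "v = inv\<^bsub>?G\<^esub> u1"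
  have ab: "a \<in> carrier ?G" "b \<in> carrier ?G"
    unfolding a_def b_def using n by (auto intro!: replicate_in_free_group)
  have uc: "u1 \<in> carrier ?G" "u2 \<in> carrier ?G" "u3 \<in> carrier ?G" "v \<in> carrier ?G"
    and ul: "length u1 \<le> r" "length u2 \<le> r" "length u3 \<le> r" "length v \<le> r"
    using u by (auto simp: free.gball_def v_def length_inv_free_group)
  have len: "length (s \<otimes>\<^bsub>?G\<^esub> t) \<le> length s + length t" for s t
    by (simp add: free_group_simps length_foldr_push)
  have lenM: "length a = M" "length b = M" by (simp_all add: a_def b_def)
  have gc: "g \<in> carrier ?G" using ab uc by (simp add: g_def flip: v_def)
  have short: "length (p \<otimes>\<^bsub>?G\<^esub> (q \<otimes>\<^bsub>?G\<^esub> (s \<otimes>\<^bsub>?G\<^esub> t))) \<le> length p + length q + length s + length t" for p q s t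
    using len[of p "q \<otimes>\<^bsub>?G\<^esub> (s \<otimes>\<^bsub>?G\<^esub> t)"] len[of q "s \<otimes>\<^bsub>?G\<^esub> t"] len[of s t] by linarith
  have ga: "g = a \<otimes>\<^bsub>?G\<^esub> (u2 \<otimes>\<^bsub>?G\<^esub> (v \<otimes>\<^bsub>?G\<^esub> (b \<otimes>\<^bsub>?G\<^esub> u3)))"
    unfolding g_def v_def[symmetric] using ab uc by (simp add: free.m_assoc)
  have gb: "g = b \<otimes>\<^bsub>?G\<^esub> (u3 \<otimes>\<^bsub>?G\<^esub> (v \<otimes>\<^bsub>?G\<^esub> (a \<otimes>\<^bsub>?G\<^esub> u2)))"
    unfolding g_def[unfolded eq] v_def[symmetric] using ab uc by (simp add: free.m_assoc)
  have "inv\<^bsub>?G\<^esub> a \<otimes>\<^bsub>?G\<^esub> g = u2 \<otimes>\<^bsub>?G\<^esub> (v \<otimes>\<^bsub>?G\<^esub> (b \<otimes>\<^bsub>?G\<^esub> u3))"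
    unfolding ga using ab uc by (intro free.cancel(2)) auto
  then have la: "length (inv\<^bsub>?G\<^esub> a \<otimes>\<^bsub>?G\<^esub> g) \<le> M + 3 * r"
    using short[of u2 v b u3] ul lenM by simp
  have "inv\<^bsub>?G\<^esub> b \<otimes>\<^bsub>?G\<^esub> g = u3 \<otimes>\<^bsub>?G\<^esub> (v \<otimes>\<^bsub>?G\<^esub> (a \<otimes>\<^bsub>?G\<^esub> u2))"
    unfolding gb using ab uc by (intro free.cancel(2)) auto
  then have lb: "length (inv\<^bsub>?G\<^esub> b \<otimes>\<^bsub>?G\<^esub> g) \<le> M + 3 * r"
    using short[of u3 v a u2] ul lenM by simp
  have step: "length (inv\<^bsub>?G\<^esub> (replicate M x) \<otimes>\<^bsub>?G\<^esub> g) = M + length g"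
    if "fst x < n" "g = [] \<or> hd g \<noteq> x" for x
    using foldr_push_replicate[of g "flip x" M] that by (simp add: inv_replicate free_group_simps(2))
  have "length g \<le> 3 * r"
  proof (cases "g = [] \<or> hd g \<noteq> (0, False)")
    case True
    then show ?thesis using step[of "(0, False)"] la n by (simp add: a_def)
  next
    case False
    then have "hd g \<noteq> (1, False)" by auto
    then show ?thesis using step[of "(1, False)"] lb n by (simp add: b_def)
  qed
  moreover have "int M - 3 * int r \<le> exponent_sum g"
  proof -
    have "exponent_sum g = exponent_sum a + (exponent_sum u2 + (exponent_sum v + (exponent_sum b + exponent_sum u3)))"
      unfolding ga by (simp add: free_group_simps(2) exponent_sum_mult)
    moreover have "exponent_sum a = int M" "exponent_sum b = 0" by (simp_all add: a_def b_def exponent_sum_def sum_list_replicate)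
    ultimately show ?thesis
      using exponent_sum_le_length[of u2] exponent_sum_le_length[of v] exponent_sum_le_length[of u3] ul by linarith
  qed
  moreover have "exponent_sum g \<le> int (length g)" using exponent_sum_le_length[of g] by linarith
  ultimately show False using M by linarith
qed

lemma spread_group_free_group: "n \<ge> 2 \<Longrightarrow> spread_group (free_group n) length"
proof (intro spread_group.intro free.length_group_axioms spread_group_axioms.intro)
  fix r assume n: "n \<ge> 2"
  let ?G = "free_group n"
  let ?a = "replicate (6 * r + 1) (0, False)" and ?b = "replicate (6 * r + 1) (1, False)"
  have ab: "?a \<in> carrier ?G" "?b \<in> carrier ?G" "\<one>\<^bsub>?G\<^esub> \<in> carrier ?G"
    using n by (auto intro!: replicate_in_free_group simp del: replicate.simps)
  show "\<exists>t1\<in>carrier ?G. \<exists>t2\<in>carrier ?G. \<exists>t3\<in>carrier ?G.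
    \<forall>u1\<in>free.gball n r. \<forall>u2\<in>free.gball n r. \<forall>u3\<in>free.gball n r.
      (t2 \<otimes>\<^bsub>?G\<^esub> u2) \<otimes>\<^bsub>?G\<^esub> inv\<^bsub>?G\<^esub> (t1 \<otimes>\<^bsub>?G\<^esub> u1) \<otimes>\<^bsub>?G\<^esub> (t3 \<otimes>\<^bsub>?G\<^esub> u3)
      \<noteq> (t3 \<otimes>\<^bsub>?G\<^esub> u3) \<otimes>\<^bsub>?G\<^esub> inv\<^bsub>?G\<^esub> (t1 \<otimes>\<^bsub>?G\<^esub> u1) \<otimes>\<^bsub>?G\<^esub> (t2 \<otimes>\<^bsub>?G\<^esub> u2)"
  proof (rule bexI[OF _ ab(3)], rule bexI[OF _ ab(1)], rule bexI[OF _ ab(2)], intro ballI)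
    fix u1 u2 u3 assume u: "u1 \<in> free.gball n r" "u2 \<in> free.gball n r" "u3 \<in> free.gball n r"
    have one: "\<one>\<^bsub>?G\<^esub> \<otimes>\<^bsub>?G\<^esub> u1 = u1" using free.ball_carrier[OF u(1)] by (rule free.l_one)
    show "(?a \<otimes>\<^bsub>?G\<^esub> u2) \<otimes>\<^bsub>?G\<^esub> inv\<^bsub>?G\<^esub> (\<one>\<^bsub>?G\<^esub> \<otimes>\<^bsub>?G\<^esub> u1) \<otimes>\<^bsub>?G\<^esub> (?b \<otimes>\<^bsub>?G\<^esub> u3)
      \<noteq> (?b \<otimes>\<^bsub>?G\<^esub> u3) \<otimes>\<^bsub>?G\<^esub> inv\<^bsub>?G\<^esub> (\<one>\<^bsub>?G\<^esub> \<otimes>\<^bsub>?G\<^esub> u1) \<otimes>\<^bsub>?G\<^esub> (?a \<otimes>\<^bsub>?G\<^esub> u2)"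
      unfolding one by (rule free_group_spread[OF n u refl])
  qed
qed

theorem mainTheorem3:
  fixes n :: nat
  assumes "n \<ge> 2"
  shows "\<exists>(A :: (nat \<Rightarrow> nat \<Rightarrow> complex) cstar) \<alpha>.
    unital_cstar_algebra A \<and> AF_algebra A \<and> prime_cstar A \<and> \<not> simple_cstar A \<and>
    cstar_action (free_group n) A \<alpha> \<and>
    minimal_action (free_group n) A \<alpha> \<and>
    effective_action (free_group n) (ideal_action \<alpha>) (Prim A) \<and>
    (\<forall>H. subgroup H (free_group n) \<longrightarrow> comm_group ((free_group n)\<lparr>carrier := H\<rparr>) \<longrightarrow>
       \<not> minimal_action ((free_group n)\<lparr>carrier := H\<rparr>) A \<alpha>)"
proof -
  interpret F: spread_group "free_group n" length
    by (rule spread_group_free_group[OF assms])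
  show ?thesis
    by (intro exI[of _ F.A] exI[of _ F.act] conjI allI impI F.unital_cstar_algebra_A F.AF_algebra_A
        F.prime_A_configs F.not_simple_A F.cstar_action_act F.minimal_act F.effective_act
        F.not_minimal_abelian)
qed

end
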